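(* Let $X=(X_1,\dots,X_N)$ be the queue length process with strictly positive arrival rates $\lambda_1,\dots,\lambda_N$ and a (bounded) partially decreasing service allocation $\phi=(\phi_1,\dots,\phi_N)$ having uniform limits at infinity. Assume that there is an index $n\in\{0,\dots,N-1\}$ such that $$\lambda_i < L^{i-1}_i(\lambda_1,\dots,\lambda_{i-1};\phi)\quad\text{for all } i\le n,$$ $$\lambda_i > L^n_i(\lambda_1,\dots,\lambda_n;\phi)\quad\text{for all } i>n.$$ Then the process $(X_{n+1},\dots,X_N)$ is unstable, regardless of the initial state of $X$.
   Context: $\mathbb{Z}_+=\{0,1,2,\dots\}$, $\mathbb{R}_+=[0,\infty)$, $e_i$ is the $i$-th unit vector, and $\le$ on $\mathbb{Z}_+^N$ is the coordinatewise order. Indices $i$ range over $\{1,\dots,N\}$. Queue length process: given arrival rates $\lambda_i>0$ and a bounded function $\phi=(\phi_1,\dots,\phi_N):\mathbb{Z}_+^N\to\mathbb{R}_+^N$ (the service allocation), $X$ is the continuous-time Markov process on $\mathbb{Z}_+^N$ with transitions $x\mapsto x+e_i$ at rate $\lambda_i$ and $x\mapsto x-e_i$ at rate $\phi_i(x)1(x_i>0)$, $i=1,\dots,N$. $\phi$ is partially decreasing if for all $i$, $\phi_i(x)\ge\phi_i(y)$ for all $x\le y$ in $\mathbb{Z}_+^N$ such that $x_i=y_i$. A function $f:\mathbb{Z}_+^N\to\mathbb{R}$ has uniform limits at infinity if (a) there is a constant $f^0$ with $\sup_{x\in\mathbb{Z}_+^N:\,x_1,\dots,x_N>r}|f(x)-f^0|\to0$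 as $r\to\infty$; and (b) for any $n=1,\dots,N-1$ and any permutation $\sigma$ of $\{1,\dots,N\}$ there is a function $f^{n,\sigma}:\mathbb{Z}_+^n\to\mathbb{R}$ such that $\sup_{x\in\mathbb{Z}_+^N:\,x_{\sigma(n+1)},\dots,x_{\sigma(N)}>r}|f(x)-f^{n,\sigma}(x_{\sigma(1)},\dots,x_{\sigma(n)})|\to0$ as $r\to\infty$. The allocation $\phi$ has uniform limits at infinity if each $\phi_i$ does. Lower partial limits: for $0\le n\le N$ and $1\le i\le N$, $$\ell^n\phi_i(x_1,\dots,x_n)=\lim_{r\to\infty}\ \inf_{x_{n+1},\dots,x_N>r}\phi_i(x_1,\dots,x_N)$$ (so $\ell^0\phi_i$ is a constant and $\ell^N\phi_i=\phi_i$). For $n\ge1$, $Y^n$ is the continuous-time Markov process on $\mathbb{Z}_+^n$ with transitions $x\mapsto x+e_i$ at rate $\lambda_i$ and $x\mapsto x-e_i$ at rate $\ell^n\phi_i(x)1(x_i>0)$, $i=1,\dots,n$. If $Y^n$ has a unique stationary distribution $\pi^n$, then $$L^n_i(\lambda_1,\dots,\lambda_n;\phi)=\sum_{x\in\mathbb{Z}_+^n}\ell^n\phi_i(x)\,\pi^n(x),$$ and otherwise $L^n_i(\lambda_1,\dots,\lambda_n;\phi)=0$. For $n=0$, $L^0_i=\ell^0\phi_i$. A stochastic process $U$ with values in a countable space $S$ is stable if for every $\epsilon>0$ there is a finite set $K\subset S$ such that $\Pr(U(t)\notin K)\le\epsilon$ for all $t\ge0$; otherwise it is unstable. *)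

theory Defs
  imports "HOL-Probability.Probability"
begin

section \<open>Continuous-time Markov processes on a discrete state space\<close>

text \<open>
  A standard transition function on \<open>S\<close> whose transition rates are \<open>q x y\<close> for \<open>x \<noteq> y\<close>;
  the diagonal of \<open>q\<close> is ignored, and the total rate out of \<open>x\<close> is \<open>\<Sum>y\<noteq>x. q x y\<close>, assumed
  summable. For \<open>q \<ge> 0\<close> with bounded total rates there is exactly one such \<open>P\<close> (on \<open>t \<ge> 0\<close> and \<open>S\<close>).
\<close>

definition transition_function ::
  "'s set \<Rightarrow> ('s \<Rightarrow> 's \<Rightarrow> real) \<Rightarrow> (real \<Rightarrow> 's \<Rightarrow> 's pmf) \<Rightarrow> bool" where
  "transition_function S q P \<longleftrightarrow>
     (\<forall>t\<ge>0. \<forall>x\<in>S. set_pmf (P t x) \<subseteq> S) \<and>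
     (\<forall>x\<in>S. P 0 x = return_pmf x) \<and>
     (\<forall>s\<ge>0. \<forall>t\<ge>0. \<forall>x\<in>S. P (s + t) x = bind_pmf (P s x) (P t)) \<and>
     (\<forall>x\<in>S. q x summable_on (S - {x})) \<and>
     (\<forall>x\<in>S. \<forall>y\<in>S.
        ((\<lambda>t. pmf (P t x) y) has_real_derivative
           (if y = x then - (\<Sum>\<^sub>\<infinity>z\<in>S - {x}. q x z) else q x y)) (at 0 within {0..}))"

text \<open>
  The history up to time \<open>s\<close> is recorded at finitely many times \<open>F \<subseteq> [0, s]\<close> with \<open>s \<in> F\<close>.
  The law of the initial state \<open>X 0\<close> is unrestricted.
\<close>

definition markov_process ::
  "'w measure \<Rightarrow> 's set \<Rightarrow> ('s \<Rightarrow> 's \<Rightarrow> real) \<Rightarrow> (real \<Rightarrow> 'w \<Rightarrow> 's) \<Rightarrow> bool" where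
  "markov_process M S q X \<longleftrightarrow>
     prob_space M \<and>
     (\<forall>t\<ge>0. X t \<in> M \<rightarrow>\<^sub>M count_space S) \<and>
     (\<exists>P. transition_function S q P \<and>
        (\<forall>F \<xi> s t y. finite F \<and> F \<subseteq> {0..s} \<and> s \<in> F \<and> s \<le> t \<and>
           \<P>(\<omega> in M. \<forall>r\<in>F. X r \<omega> = \<xi> r) > 0 \<longrightarrow>
           \<P>(\<omega> in M. X t \<omega> = y \<bar> \<forall>r\<in>F. X r \<omega> = \<xi> r) = pmf (P (t - s) (\<xi> s)) y))"

definition stationary_distribution :: "'s set \<Rightarrow> ('s \<Rightarrow> 's \<Rightarrow> real) \<Rightarrow> 's pmf \<Rightarrow> bool" where
  "stationary_distribution S q \<pi> \<longleftrightarrow>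
     set_pmf \<pi> \<subseteq> S \<and>
     (\<exists>P. transition_function S q P \<and> (\<forall>t\<ge>0. bind_pmf \<pi> (P t) = \<pi>))"

definition stable_process :: "'w measure \<Rightarrow> 's set \<Rightarrow> (real \<Rightarrow> 'w \<Rightarrow> 's) \<Rightarrow> bool" where
  "stable_process M S U \<longleftrightarrow>
     (\<forall>\<epsilon>>0. \<exists>K. finite K \<and> K \<subseteq> S \<and> (\<forall>t\<ge>0. \<P>(\<omega> in M. U t \<omega> \<notin> K) \<le> \<epsilon>))"

section \<open>Queue length processes\<close>

text \<open>Vectors \<open>(x\<^sub>i)\<close> of nonnegative integers with \<open>i\<close> ranging over the index set \<open>I\<close>.\<close>

abbreviation states :: "nat set \<Rightarrow> (nat \<Rightarrow> nat) set" where
  "states I \<equiv> I \<rightarrow>\<^sub>E UNIV"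

definition queue_rate ::
  "nat set \<Rightarrow> (nat \<Rightarrow> real) \<Rightarrow> (nat \<Rightarrow> (nat \<Rightarrow> nat) \<Rightarrow> real) \<Rightarrow> (nat \<Rightarrow> nat) \<Rightarrow> (nat \<Rightarrow> nat) \<Rightarrow> real" where
  "queue_rate I lam \<phi> x y =
     (\<Sum>i\<in>I. (if y = x(i := x i + 1) then lam i else 0) +
             (if x i > 0 \<and> y = x(i := x i - 1) then \<phi> i x else 0))"

definition queue_length_process ::
  "'w measure \<Rightarrow> nat \<Rightarrow> (nat \<Rightarrow> real) \<Rightarrow> (nat \<Rightarrow> (nat \<Rightarrow> nat) \<Rightarrow> real) \<Rightarrow>
   (real \<Rightarrow> 'w \<Rightarrow> nat \<Rightarrow> nat) \<Rightarrow> bool" where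
  "queue_length_process M N lam \<phi> X \<longleftrightarrow>
     markov_process M (states {1..N}) (queue_rate {1..N} lam \<phi>) X"

definition bounded_allocation :: "nat \<Rightarrow> (nat \<Rightarrow> (nat \<Rightarrow> nat) \<Rightarrow> real) \<Rightarrow> bool" where
  "bounded_allocation N \<phi> \<longleftrightarrow>
     (\<exists>B. \<forall>i\<in>{1..N}. \<forall>x\<in>states {1..N}. 0 \<le> \<phi> i x \<and> \<phi> i x \<le> B)"

definition partially_decreasing :: "nat \<Rightarrow> (nat \<Rightarrow> (nat \<Rightarrow> nat) \<Rightarrow> real) \<Rightarrow> bool" where
  "partially_decreasing N \<phi> \<longleftrightarrow>
     (\<forall>i\<in>{1..N}. \<forall>x\<in>states {1..N}. \<forall>y\<in>states {1..N}.
        (\<forall>j\<in>{1..N}. x j \<le> y j) \<and> x i = y i \<longrightarrow> \<phi> i x \<ge> \<phi> i y)"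

text \<open>Suprema are taken in \<open>ereal\<close>, so that they are meaningful for unbounded sets.\<close>

definition uniform_limits_at_infinity :: "nat \<Rightarrow> ((nat \<Rightarrow> nat) \<Rightarrow> real) \<Rightarrow> bool" where
  "uniform_limits_at_infinity N f \<longleftrightarrow>
     (\<exists>c. (\<lambda>r::nat. SUP x\<in>{x \<in> states {1..N}. \<forall>j\<in>{1..N}. x j > r}. ereal \<bar>f x - c\<bar>)
            \<longlonglongrightarrow> 0) \<and>
     (\<forall>n\<in>{1..<N}. \<forall>\<sigma>. \<sigma> permutes {1..N} \<longrightarrow>
        (\<exists>g :: (nat \<Rightarrow> nat) \<Rightarrow> real.
           (\<lambda>r::nat. SUP x\<in>{x \<in> states {1..N}. \<forall>j\<in>{n+1..N}. x (\<sigma> j) > r}.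
              ereal \<bar>f x - g (\<lambda>j\<in>{1..n}. x (\<sigma> j))\<bar>) \<longlonglongrightarrow> 0))"

definition lower_partial_limit ::
  "nat \<Rightarrow> nat \<Rightarrow> ((nat \<Rightarrow> nat) \<Rightarrow> real) \<Rightarrow> (nat \<Rightarrow> nat) \<Rightarrow> real" where
  "lower_partial_limit N n f x =
     lim (\<lambda>r::nat. INF y\<in>{y \<in> states {1..N}. (\<forall>j\<in>{1..n}. y j = x j) \<and> (\<forall>j\<in>{n+1..N}. y j > r)}. f y)"

text \<open>For \<open>n = 0\<close> the lower partial limit is a constant: it does not depend on its argument.\<close>

definition limiting_service_rate ::
  "nat \<Rightarrow> (nat \<Rightarrow> real) \<Rightarrow> (nat \<Rightarrow> (nat \<Rightarrow> nat) \<Rightarrow> real) \<Rightarrow> nat \<Rightarrow> nat \<Rightarrow> real" where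
  "limiting_service_rate N lam \<phi> n i =
     (let \<psi> = (\<lambda>j. lower_partial_limit N n (\<phi> j));
          stat = stationary_distribution (states {1..n}) (queue_rate {1..n} lam \<psi>)
      in if n = 0 then \<psi> i (\<lambda>_. undefined)
         else if \<exists>!\<pi>. stat \<pi> then \<Sum>\<^sub>\<infinity>x\<in>states {1..n}. \<psi> i x * pmf (THE \<pi>. stat \<pi>) x
         else 0)"

end

theory Submission
  imports Defs
begin

text \<open>
  The rates are bounded, so the processes are uniformized: \<open>K\<close> is the jump kernel at rate \<open>L\<close>, and
  \<open>P\<^sub>h f = f + L h (K f - f) + O(h\<^sup>2)\<close> uniformly in the starting state. Everything is then done with
  the discrete kernels.

  Partial decrease makes the kernels of \<open>Y\<^sup>n\<close> stochastically monotone. Hence the law of \<open>Y\<^sup>n\<close> started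
  at \<open>0\<close> increases and converges pointwise, to \<open>0\<close> or to a multiple of the unique stationary
  distribution. The first alternative is impossible under the \<open>n\<close>-th stability condition: the coordinates
  below \<open>n\<close> are dominated by \<open>Y\<^sup>n\<^sup>-\<^sup>1\<close> and stay tight, so coordinate \<open>n\<close> would have to be large most of
  the time, where its drift is negative. So \<open>Y\<^sup>n\<close> has a stationary distribution \<open>\<pi>\<^sup>n\<close>.

  As long as \<open>X\<^sub>n\<^sub>+\<^sub>1, \<dots>, X\<^sub>N\<close> are large, \<open>(X\<^sub>1, \<dots>, X\<^sub>n)\<close> moves almost like \<open>Y\<^sup>n\<close>, and for \<open>i > n\<close> the mean
  service of queue \<open>i\<close> is largest when \<open>Y\<^sup>n\<close> starts at \<open>0\<close>, where it averages to the
  limiting service rate, which is below \<open>\<lambda>\<^sub>i\<close>. So over \<open>m\<close> steps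
  \<open>\<Sum>\<^sub>i\<^sub>>\<^sub>n exp(-\<alpha> x\<^sub>i)\<close> contracts, uniformly in \<open>x\<^sub>1, \<dots>, x\<^sub>n\<close>, and \<open>W = max(0, 1 - s \<Sum>\<^sub>i\<^sub>>\<^sub>n exp(-\<alpha> x\<^sub>i))\<close> satisfies
  \<open>K\<^sup>m W \<ge> W\<close>, strictly when \<open>x\<^sub>n\<^sub>+\<^sub>1, \<dots>, x\<^sub>N\<close> are large. For \<open>G = \<Sum>\<^sub>k\<^sub><\<^sub>m K\<^sup>k W\<close> we have \<open>K G - G = K\<^sup>m W - W\<close>.
  If \<open>(X\<^sub>n\<^sub>+\<^sub>1, \<dots>, X\<^sub>N)\<close> were stable, it would keep visiting large states with probability bounded below,
  and the expectation of the bounded function \<open>G\<close> would grow without bound.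
\<close>

section \<open>Expectations under probability mass functions\<close>

abbreviation expect :: "'a pmf \<Rightarrow> ('a \<Rightarrow> real) \<Rightarrow> real" where
  "expect p f \<equiv> measure_pmf.expectation p f"

lemma integrable_pmf_bounded:
  fixes f :: "'a \<Rightarrow> real"
  assumes "\<And>x. \<bar>f x\<bar> \<le> F"
  shows "integrable (measure_pmf p) f"
  by (rule measure_pmf.integrable_const_bound[where B=F]) (use assms in auto)

lemma expect_count_space:
  "expect p f = (\<integral>x. pmf p x * f x \<partial>count_space UNIV)"
  by (simp add: measure_pmf_eq_density integral_density)

lemma integrable_count_space_bounded:
  fixes f :: "'a \<Rightarrow> real"
  assumes "\<And>x. \<bar>f x\<bar> \<le> F"
  shows "integrable (count_space UNIV) (\<lambda>x. pmf p x * f x)"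
  using integrable_pmf_bounded[OF assms, of p]
  by (simp add: measure_pmf_eq_density integrable_density)

lemma expect_bind:
  assumes "\<And>x. \<bar>f x\<bar> \<le> F"
  shows "expect (bind_pmf p k) f = expect p (\<lambda>x. expect (k x) f)"
proof -
  have "expect (bind_pmf p k) f = integral\<^sup>L (measure_pmf p \<bind> (\<lambda>x. measure_pmf (k x))) f"
    by (simp add: measure_pmf_bind)
  also have "\<dots> = (\<integral>x. integral\<^sup>L (k x) f \<partial>measure_pmf p)"
    by (rule integral_bind[where K="count_space UNIV" and B=F and B'=1])
       (use assms measurable_measure_pmf[of k] in
         \<open>auto simp: measure_pmf.emeasure_space_1 measure_pmf.finite_measure\<close>)
  finally show ?thesis .
qed

lemma abs_expect_le:
  assumes "\<And>x. \<bar>f x\<bar> \<le> F"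
  shows "\<bar>expect p f\<bar> \<le> F"
proof -
  have "\<bar>expect p f\<bar> \<le> expect p (\<lambda>x. \<bar>f x\<bar>)"
    by (rule integral_abs_bound)
  also have "\<dots> \<le> expect p (\<lambda>x. F)"
    by (rule integral_mono[OF integrable_pmf_bounded[where F=F] integrable_pmf_bounded[where F="\<bar>F\<bar>"]]) (use assms in auto)
  finally show ?thesis by simp
qed

lemma expect_mono:
  assumes "\<And>x. \<bar>f x\<bar> \<le> F" "\<And>x. \<bar>g x\<bar> \<le> G" "\<And>x. x \<in> set_pmf p \<Longrightarrow> f x \<le> g x"
  shows "expect p f \<le> expect p g"
  by (rule integral_mono_AE[OF integrable_pmf_bounded[OF assms(1)] integrable_pmf_bounded[OF assms(2)]])
     (use assms(3) in \<open>auto simp: AE_measure_pmf_iff\<close>)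

lemma expect_eqI:
  assumes "\<And>x. x \<in> set_pmf p \<Longrightarrow> f x = g x"
  shows "expect p f = expect p g"
  by (rule integral_cong_AE) (use assms in \<open>auto simp: AE_measure_pmf_iff\<close>)

lemma pmf_bind_ge:
  "pmf p y * pmf (k y) z \<le> pmf (bind_pmf p k) z"
proof -
  have "pmf p y * pmf (k y) z = expect p (\<lambda>x. indicator {y} x * pmf (k y) z)"
    by (simp add: pmf.rep_eq)
  also have "\<dots> \<le> expect p (\<lambda>x. pmf (k x) z)"
    by (rule expect_mono[where F=1 and G=1]) (auto simp: indicator_def pmf_le_1)
  finally show ?thesis by (simp add: pmf_bind)
qed

lemma pmf_bind_ge2:
  assumes "x \<noteq> y"
  shows "pmf p x * pmf (k x) z + pmf p y * pmf (k y) z \<le> pmf (bind_pmf p k) z"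
proof -
  have "pmf p x * pmf (k x) z + pmf p y * pmf (k y) z =
      expect p (\<lambda>w. indicator {x} w * pmf (k x) z) + expect p (\<lambda>w. indicator {y} w * pmf (k y) z)"
    by (simp add: pmf.rep_eq)
  also have "\<dots> = expect p (\<lambda>w. indicator {x} w * pmf (k x) z + indicator {y} w * pmf (k y) z)"
    by (rule Bochner_Integration.integral_add[symmetric]; rule integrable_pmf_bounded[where F=1])
       (auto simp: indicator_def pmf_le_1)
  also have "\<dots> \<le> expect p (\<lambda>w. pmf (k w) z)"
    by (rule expect_mono[where F=1 and G=1]) (use assms in \<open>auto simp: indicator_def pmf_le_1\<close>)
  finally show ?thesis by (simp add: pmf_bind)
qed

text \<open>What is left of \<open>p\<close> after removing the two weighted parts is a nonnegative
  measure of mass \<open>1 - \<alpha> - \<beta>\<close>. Testing the domination on the nonnegative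
  functions \<open>F + f\<close> and \<open>F - f\<close> bounds the integral of \<open>f\<close>
  against it from both sides.\<close>

lemma expect_two_point_approx:
  assumes dom: "\<And>y. \<alpha> * pmf a y + \<beta> * pmf b y \<le> pmf p y"
    and F: "\<And>x. \<bar>f x\<bar> \<le> F"
  shows "\<bar>expect p f - (\<alpha> * expect a f + \<beta> * expect b f)\<bar> \<le> (1 - \<alpha> - \<beta>) * F"
proof -
  have ge: "\<alpha> * expect a g + \<beta> * expect b g \<le> expect p g" if g: "\<And>x. 0 \<le> g x" "\<And>x. \<bar>g x\<bar> \<le> G" for g G
  proof -
    have "\<alpha> * expect a g + \<beta> * expect b g
       = (\<integral>x. \<alpha> * (pmf a x * g x) + \<beta> * (pmf b x * g x) \<partial>count_space UNIV)"
      using integrable_count_space_bounded[where f=g, OF g(2)] by (simp add: expect_count_space)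
    also have "\<dots> \<le> (\<integral>x. pmf p x * g x \<partial>count_space UNIV)"
    proof (rule integral_mono)
      fix x
      have "(\<alpha> * pmf a x + \<beta> * pmf b x) * g x \<le> pmf p x * g x"
        using dom g(1) by (rule mult_right_mono)
      then show "\<alpha> * (pmf a x * g x) + \<beta> * (pmf b x * g x) \<le> pmf p x * g x"
        by (simp add: algebra_simps)
    qed (use integrable_count_space_bounded[where f=g, OF g(2)] in auto)
    finally show ?thesis by (simp add: expect_count_space)
  qed
  have int: "integrable (measure_pmf q) f" for q using F by (rule integrable_pmf_bounded)
  have F0: "0 \<le> F + f x" "0 \<le> F - f x" "\<bar>F + f x\<bar> \<le> 2 * F" "\<bar>F - f x\<bar> \<le> 2 * F" for x
    using F[of x] by auto
  show ?thesis
    using ge[of "\<lambda>x. F + f x", OF F0(1,3)] ge[of "\<lambda>x. F - f x", OF F0(2,4)] int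
    by (simp add: algebra_simps abs_le_iff)
qed

section \<open>Uniformization of transition functions\<close>

text \<open>The generator is \<open>L (K - I)\<close>. Only off-diagonal entries are tied to
  \<open>q\<close>; the holding probability \<open>pmf (K x) x\<close> takes up the slack, so
  \<open>L\<close> may exceed the exit rates.\<close>

definition uniformized :: "'s set \<Rightarrow> ('s \<Rightarrow> 's \<Rightarrow> real) \<Rightarrow> real \<Rightarrow> ('s \<Rightarrow> 's pmf) \<Rightarrow> bool" where
  "uniformized S q L K \<longleftrightarrow> 0 < L \<and> (\<forall>x\<in>S. set_pmf (K x) \<subseteq> S) \<and>
     (\<forall>x\<in>S. \<forall>y\<in>S. y \<noteq> x \<longrightarrow> q x y = L * pmf (K x) y)"

lemma uniformized_has_sum:
  assumes "uniformized S q L K" "x \<in> S"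
  shows "(q x has_sum L * (1 - pmf (K x) x)) (S - {x})"
proof -
  have "set_pmf (K x) \<subseteq> S" using assms by (auto simp: uniformized_def)
  then have "infsum (pmf (K x)) S = 1"
    using infsetsum_pmf_eq_1[of "K x" S] by (simp add: infsetsum_infsum pmf_abs_summable)
  moreover have "pmf (K x) summable_on S"
    using pmf_abs_summable[of "K x" S] by (metis abs_summable_equivalent abs_summable_summable)
  ultimately have "(pmf (K x) has_sum 1) S" by (metis has_sum_infsum)
  then have "(pmf (K x) has_sum (1 - pmf (K x) x)) (S - {x})"
    using has_sum_Diff[of "pmf (K x)" S 1 "{x}" "pmf (K x) x"] assms by (simp add: has_sum_finiteI)
  then have "((\<lambda>y. L * pmf (K x) y) has_sum L * (1 - pmf (K x) x)) (S - {x})"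
    by (rule has_sum_cmult_right)
  then show ?thesis
    by (rule has_sum_cong[THEN iffD1, rotated]) (use assms in \<open>auto simp: uniformized_def\<close>)
qed

section \<open>Small-time expansion of an arbitrary transition function\<close>

context
  fixes S :: "'s set" and q L K P
  assumes unif: "uniformized S q L K" and trans: "transition_function S q P"
begin

lemma trans_0: "x \<in> S \<Longrightarrow> P 0 x = return_pmf x"
  and trans_add: "s \<ge> 0 \<Longrightarrow> t \<ge> 0 \<Longrightarrow> x \<in> S \<Longrightarrow> P (s + t) x = bind_pmf (P s x) (P t)"
  using trans unfolding transition_function_def by blast+

lemma trans_deriv:
  assumes "x \<in> S" "y \<in> S"
  shows "((\<lambda>t. pmf (P t x) y) has_real_derivative
           (L * (pmf (K x) y - indicator {x} y))) (at 0 within {0..})"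
proof -
  have "infsum (q x) (S - {x}) = L * (1 - pmf (K x) x)"
    using uniformized_has_sum[OF unif assms(1)] by (rule infsumI)
  moreover have "q x y = L * pmf (K x) y" if "y \<noteq> x"
    using unif assms that by (auto simp: uniformized_def)
  ultimately have "(if y = x then - infsum (q x) (S - {x}) else q x y) = L * (pmf (K x) y - indicator {x} y)"
    by (simp add: algebra_simps)
  moreover have "((\<lambda>t. pmf (P t x) y) has_real_derivative
      (if y = x then - infsum (q x) (S - {x}) else q x y)) (at 0 within {0..})"
    using trans assms unfolding transition_function_def by blast
  ultimately show ?thesis by simp
qed

text \<open>The derivative at 0 is sampled along \<open>t / n\<close>: cutting \<open>[0, t]\<close>
  into \<open>n\<close> equal slots and letting \<open>n\<close> grow turns it into bounds at the
  fixed time \<open>t\<close>.\<close>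

lemma trans_deriv_seq:
  assumes "x \<in> S" "y \<in> S" "t > 0"
  shows "(\<lambda>n. real n * (pmf (P (t / real n) x) y - indicator {x} y))
           \<longlonglongrightarrow> t * (L * (pmf (K x) y - indicator {x} y))"
proof -
  have "((\<lambda>h. (pmf (P h x) y - pmf (P 0 x) y) / (h - 0)) \<longlongrightarrow> L * (pmf (K x) y - indicator {x} y)) (at 0 within {0..})"
    using trans_deriv[OF assms(1,2)] by (simp add: has_field_derivative_iff)
  moreover have "filterlim (\<lambda>n. t / real n) (at 0 within {0..}) sequentially"
    unfolding filterlim_at
  proof (intro conjI)
    show "(\<lambda>n. t / real n) \<longlonglongrightarrow> 0" by (rule lim_const_over_n)
    show "\<forall>\<^sub>F n in sequentially. t / real n \<in> {0..} \<and> t / real n \<noteq> 0"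
      using eventually_gt_at_top[of 0] by eventually_elim (use assms in auto)
  qed
  ultimately have "(\<lambda>n. t * ((pmf (P (t / real n) x) y - pmf (P 0 x) y) / (t / real n - 0)))
      \<longlonglongrightarrow> t * (L * (pmf (K x) y - indicator {x} y))"
    by (intro tendsto_mult tendsto_const) (rule filterlim_compose[rotated])
  moreover have "t * ((pmf (P (t / real n) x) y - pmf (P 0 x) y) / (t / real n - 0))
      = real n * (pmf (P (t / real n) x) y - indicator {x} y)" if "n > 0" for n
    using that assms trans_0[of x] by (simp add: indicator_def)
  ultimately show ?thesis
    by (rule Lim_transform_eventually[OF _ eventually_mono[OF eventually_gt_at_top[of 0]]])
qed

lemma trans_pow_diag: "s \<ge> 0 \<Longrightarrow> x \<in> S \<Longrightarrow> pmf (P s x) x ^ n \<le> pmf (P (real n * s) x) x"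
proof (induction n)
  case 0
  then show ?case by (simp add: trans_0)
next
  case (Suc n)
  have "pmf (P s x) x ^ Suc n \<le> pmf (P s x) x * pmf (P (real n * s) x) x"
    using Suc by (simp add: mult_left_mono)
  also have "\<dots> \<le> pmf (bind_pmf (P s x) (P (real n * s))) x" by (rule pmf_bind_ge)
  also have "\<dots> = pmf (P (real (Suc n) * s) x) x"
    using Suc trans_add[of s "real n * s" x] by (simp add: algebra_simps)
  finally show ?case .
qed

text \<open>With \<open>p\<close> the diagonal entry for one of \<open>n\<close> slots, staying put
  in all of them has probability at least \<open>1 + n (p - 1)\<close> by Bernoulli's inequality;
  the limit in \<open>n\<close> brings in the derivative at 0.\<close>

lemma trans_diag_ge:
  assumes "t \<ge> 0" "x \<in> S"
  shows "1 - L * t * (1 - pmf (K x) x) \<le> pmf (P t x) x"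
proof (cases "t = 0")
  case True
  then show ?thesis using assms trans_0 by simp
next
  case False
  then have t: "t > 0" using assms by simp
  have lim: "(\<lambda>n. 1 + real n * (pmf (P (t / real n) x) x - indicator {x} x)) \<longlonglongrightarrow>
          1 + t * (L * (pmf (K x) x - indicator {x} x))"
    by (intro tendsto_add tendsto_const trans_deriv_seq assms t)
  have "1 + real n * (pmf (P (t / real n) x) x - indicator {x} x) \<le> pmf (P t x) x" if "n \<ge> 1" for n
  proof -
    have "1 + real n * (pmf (P (t / real n) x) x - 1) \<le> (1 + (pmf (P (t / real n) x) x - 1)) ^ n"
      by (rule Bernoulli_inequality) simp
    also have "\<dots> \<le> pmf (P (real n * (t / real n)) x) x"
      using trans_pow_diag[of "t / real n" x n] assms by simp
    finally show ?thesis using that by simp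
  qed
  then have "1 + t * (L * (pmf (K x) x - indicator {x} x)) \<le> pmf (P t x) x"
    by (intro LIMSEQ_le_const2[OF lim]) blast
  then show ?thesis by (simp add: algebra_simps)
qed

lemma trans_diag_ge': "t \<ge> 0 \<Longrightarrow> x \<in> S \<Longrightarrow> 1 - L * t \<le> pmf (P t x) x"
proof -
  assume a: "t \<ge> 0" "x \<in> S"
  have "L * t * (1 - pmf (K x) x) \<le> L * t * 1"
    using unif a by (intro mult_left_mono) (auto simp: uniformized_def)
  then show ?thesis using trans_diag_ge[OF a] by simp
qed

text \<open>Sums over the time step at which the only jump, from \<open>x\<close> to \<open>y\<close>, takes place.\<close>

lemma trans_offdiag_ge:
  assumes "t \<ge> 0" "L * t \<le> 1" "x \<in> S" "y \<in> S" "y \<noteq> x"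
  shows "L * t * pmf (K x) y * (1 - 2 * (L * t)) \<le> pmf (P t x) y"
proof (cases "t = 0")
  case True
  then show ?thesis by simp
next
  case False
  then have t: "t > 0" using assms by simp
  have L: "L > 0" using unif by (simp add: uniformized_def)
  have step: "real n * (pmf (P (t / real N) x) y * (1 - L * t) * pmf (P (t / real N) y) y ^ n)
      \<le> pmf (P (real n * (t / real N)) x) y"
    if "n \<le> N" "N \<ge> 1" for n N
    using that
  proof (induction n)
    case 0
    then show ?case by simp
  next
    case (Suc n)
    let ?s = "t / real N" and ?r = "real n * (t / real N)"
    let ?p = "pmf (P ?s x) y" and ?b = "pmf (P ?s y) y"
    have le: "?r \<le> t" using Suc t by (auto simp: field_simps)
    have s0: "?s \<ge> 0" "?r \<ge> 0" using t by auto
    have "1 - L * t \<le> 1 - L * ?r" using mult_left_mono[OF le, of L] L by simp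
    then have x: "1 - L * t \<le> pmf (P ?r x) x" using trans_diag_ge'[of ?r x] s0 assms by linarith
    have IH: "real n * (?p * (1 - L * t) * ?b ^ n) \<le> pmf (P ?r x) y" using Suc by simp
    \<comment> \<open>This summand is the jump in the newest slot, the path having been at
      \<open>x\<close> before it; its surplus powers of \<open>?b\<close> are bounded by 1. The
      older summands gain one factor for staying at \<open>y\<close>.\<close>
    have "?p * (1 - L * t) * ?b ^ Suc n \<le> ?p * (1 - L * t) * 1"
      by (rule mult_left_mono) (use assms in \<open>auto simp: power_le_one pmf_le_1 simp del: power_Suc\<close>)
    also have "\<dots> \<le> ?p * pmf (P ?r x) x" using x by (simp add: mult_left_mono)
    finally have 1: "?p * (1 - L * t) * ?b ^ Suc n \<le> pmf (P ?r x) x * ?p" by (simp add: mult.commute)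
    have 2: "real n * (?p * (1 - L * t) * ?b ^ n) * ?b \<le> pmf (P ?r x) y * ?b"
      using IH by (rule mult_right_mono) simp
    have "real (Suc n) * (?p * (1 - L * t) * ?b ^ Suc n)
        = ?p * (1 - L * t) * ?b ^ Suc n + real n * (?p * (1 - L * t) * ?b ^ n) * ?b"
      by (simp add: algebra_simps)
    also have "\<dots> \<le> pmf (P ?r x) x * ?p + pmf (P ?r x) y * ?b"
      using 1 2 by (rule add_mono)
    also have "\<dots> \<le> pmf (bind_pmf (P ?r x) (P ?s)) y"
      using pmf_bind_ge2[of x y "P ?r x" "P ?s" y] assms by simp
    also have "\<dots> = pmf (P (real (Suc n) * ?s) x) y"
    proof -
      have "real (Suc n) * ?s = ?r + ?s"
        by (simp only: of_nat_Suc distrib_right mult_1_left add.commute)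
      then show ?thesis using trans_add[OF s0(2,1) assms(3)] by simp
    qed
    finally show ?case .
  qed
  have bound: "real n * (pmf (P (t / real n) x) y - indicator {x} y) * (1 - L * t)^2 \<le> pmf (P t x) y"
    if n: "n \<ge> 1" for n
  proof -
    let ?s = "t / real n"
    have Ls: "L * ?s \<le> 1" "0 \<le> ?s"
      using assms L t n by (auto simp: field_simps intro: order_trans[of _ 1])
    have "1 - L * t = 1 + real n * (- (L * ?s))" using n by simp
    also have "\<dots> \<le> (1 + - (L * ?s)) ^ n" using Ls by (intro Bernoulli_inequality) simp
    also have "\<dots> \<le> pmf (P ?s y) y ^ n"
      using trans_diag_ge'[of ?s y] Ls assms by (intro power_mono) auto
    finally have b: "1 - L * t \<le> pmf (P ?s y) y ^ n" .
    have "real n * (pmf (P ?s x) y - indicator {x} y) * (1 - L * t)^2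
        = real n * (pmf (P ?s x) y * (1 - L * t) * (1 - L * t))"
      using assms by (simp add: power2_eq_square)
    also have "\<dots> \<le> real n * (pmf (P ?s x) y * (1 - L * t) * pmf (P ?s y) y ^ n)"
      using b assms by (intro mult_left_mono) auto
    also have "\<dots> \<le> pmf (P t x) y" using step[of n n] n by simp
    finally show ?thesis .
  qed
  have lim: "(\<lambda>n. real n * (pmf (P (t / real n) x) y - indicator {x} y) * (1 - L * t)^2)
      \<longlonglongrightarrow> t * (L * (pmf (K x) y - indicator {x} y)) * (1 - L * t)^2"
    by (intro tendsto_mult tendsto_const trans_deriv_seq assms t)
  have "t * (L * (pmf (K x) y - indicator {x} y)) * (1 - L * t)^2 \<le> pmf (P t x) y"
    by (rule LIMSEQ_le_const2[OF lim]) (use bound in blast)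
  moreover have "L * t * pmf (K x) y * (1 - 2 * (L * t)) \<le> L * t * pmf (K x) y * (1 - L * t)^2"
    using L t by (intro mult_left_mono) (auto simp: power2_eq_square algebra_simps)
  ultimately show ?thesis using assms by (simp add: algebra_simps)
qed

text \<open>The entrywise bounds say that \<open>P h x\<close> dominates the point mass at
  \<open>x\<close> with weight \<open>1 - L h\<close> plus \<open>K x\<close> with weight
  \<open>L h (1 - 2 L h)\<close>. The missing mass \<open>2 (L h)^2\<close> costs half of the error,
  and replacing the second weight by \<open>L h\<close> the other half.\<close>

lemma trans_approx:
  assumes "h \<ge> 0" "L * h \<le> 1" "x \<in> S" and F: "\<And>y. \<bar>f y\<bar> \<le> F"
  shows "\<bar>expect (P h x) f - f x - L * h * (expect (K x) f - f x)\<bar> \<le> 4 * (L * h)^2 * F"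
proof -
  have L: "L > 0" using unif by (simp add: uniformized_def)
  have Lh: "0 \<le> L * h" using L assms by simp
  have "(1 - L * h) * pmf (return_pmf x) y + L * h * (1 - 2 * (L * h)) * pmf (K x) y \<le> pmf (P h x) y" for y
  proof -
    consider "y = x" | "y \<noteq> x" "y \<in> S" | "y \<noteq> x" "y \<notin> S" by blast
    then show ?thesis
    proof cases
      case 1
      have "0 \<le> L * h * (L * h * pmf (K x) x)" using Lh by simp
      then show ?thesis using 1 trans_diag_ge[of h x] assms by (simp add: algebra_simps)
    next
      case 2
      then show ?thesis using trans_offdiag_ge[of h x y] assms by (simp add: algebra_simps)
    next
      case 3
      then have "pmf (K x) y = 0" using unif assms by (auto simp: uniformized_def set_pmf_eq)
      then show ?thesis using 3 by simp
    qed
  qed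
  from expect_two_point_approx[where f=f, OF this F]
  have 1: "\<bar>expect (P h x) f - ((1 - L * h) * f x + L * h * (1 - 2 * (L * h)) * expect (K x) f)\<bar>
      \<le> 2 * (L * h)^2 * F"
    by (simp add: power2_eq_square algebra_simps)
  have "\<bar>2 * (L * h)^2 * expect (K x) f\<bar> \<le> 2 * (L * h)^2 * F"
    using abs_expect_le[of f F "K x"] F by (simp add: abs_mult mult_left_mono)
  moreover have "expect (P h x) f - f x - L * h * (expect (K x) f - f x)
     = (expect (P h x) f - ((1 - L * h) * f x + L * h * (1 - 2 * (L * h)) * expect (K x) f))
       - 2 * (L * h)^2 * expect (K x) f"
    by (simp add: power2_eq_square algebra_simps)
  ultimately show ?thesis using 1 by linarith
qed

end

section \<open>Kernel powers and the Poisson construction of a transition function\<close>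

definition kpow :: "('s \<Rightarrow> 's pmf) \<Rightarrow> nat \<Rightarrow> 's \<Rightarrow> 's pmf" where
  "kpow K k x = ((\<lambda>p. bind_pmf p K) ^^ k) (return_pmf x)"

lemma kpow_0 [simp]: "kpow K 0 x = return_pmf x"
  and kpow_Suc: "kpow K (Suc k) x = bind_pmf (kpow K k x) K"
  by (simp_all add: kpow_def)

lemma kpow_1: "kpow K (Suc 0) x = K x"
  by (simp add: kpow_Suc bind_return_pmf)

lemma kpow_add: "kpow K (j + k) x = bind_pmf (kpow K j x) (kpow K k)"
proof (induction k)
  case 0
  have "kpow K 0 = return_pmf" by (rule ext) simp
  then show ?case by (simp add: bind_return_pmf')
next
  case (Suc k)
  have "bind_pmf (kpow K j x) (kpow K (Suc k)) = bind_pmf (kpow K j x) (\<lambda>y. bind_pmf (kpow K k y) K)"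
    by (rule arg_cong[of _ _ "bind_pmf _"], rule ext) (rule kpow_Suc)
  also have "\<dots> = bind_pmf (kpow K (j + k) x) K" unfolding Suc by (rule bind_assoc_pmf[symmetric])
  finally show ?case by (metis add_Suc_right kpow_Suc)
qed

lemma set_kpow:
  assumes "\<And>x. x \<in> S \<Longrightarrow> set_pmf (K x) \<subseteq> S" "x \<in> S"
  shows "set_pmf (kpow K k x) \<subseteq> S"
  by (induction k) (use assms in \<open>auto simp: kpow_Suc\<close>)

lemma kpow_invariant:
  assumes "bind_pmf p K = p"
  shows "bind_pmf p (kpow K k) = p"
proof (induction k)
  case 0
  have "kpow K 0 = return_pmf" by (rule ext) simp
  then show ?case by (simp add: bind_return_pmf')
next
  case (Suc k)
  have "bind_pmf p (kpow K (Suc k)) = bind_pmf (bind_pmf p (kpow K k)) K"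
    unfolding bind_assoc_pmf by (rule arg_cong[of _ _ "bind_pmf _"], rule ext) (rule kpow_Suc)
  then show ?case using Suc assms by simp
qed

text \<open>The Poisson law extended to rate 0, where it is the point mass at 0; this is the case of
  time 0.\<close>

definition poisson0 :: "real \<Rightarrow> nat pmf" where
  "poisson0 s = (if s = 0 then return_pmf 0 else poisson_pmf s)"

lemma pmf_poisson0: "s \<ge> 0 \<Longrightarrow> pmf (poisson0 s) k = s ^ k / fact k * exp (- s)"
  by (cases k) (auto simp: poisson0_def)

lemma poisson0_add:
  assumes "a \<ge> 0" "b \<ge> 0"
  shows "bind_pmf (poisson0 a) (\<lambda>k. map_pmf ((+) k) (poisson0 b)) = poisson0 (a + b)"
proof (rule pmf_eqI)
  fix n
  have *: "pmf (map_pmf ((+) k) (poisson0 b)) n = (if k \<le> n then pmf (poisson0 b) (n - k) else 0)" for k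
  proof (cases "k \<le> n")
    case True
    then show ?thesis using pmf_map_inj'[of "(+) k" "poisson0 b" "n - k"] by simp
  next
    case False
    then have "n \<notin> (+) k ` set_pmf (poisson0 b)" by auto
    then show ?thesis using False by (simp add: pmf_eq_0_set_pmf)
  qed
  have "pmf (bind_pmf (poisson0 a) (\<lambda>k. map_pmf ((+) k) (poisson0 b))) n
      = expect (poisson0 a) (\<lambda>k. if k \<le> n then pmf (poisson0 b) (n - k) else 0)"
    by (simp add: pmf_bind *)
  also have "\<dots> = (\<Sum>k\<le>n. pmf (poisson0 a) k * pmf (poisson0 b) (n - k))"
    by (subst integral_measure_pmf[of "{..n}"]) (auto split: if_splits)
  also have "\<dots> = (\<Sum>k\<le>n. of_nat (n choose k) * a ^ k * b ^ (n - k)) / fact n * exp (- (a + b))"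
    unfolding sum_divide_distrib sum_distrib_right
    by (rule sum.cong) (use assms in \<open>auto simp: pmf_poisson0 binomial_fact exp_add[symmetric] field_simps\<close>)
  also have "\<dots> = pmf (poisson0 (a + b)) n"
    using assms by (simp add: pmf_poisson0 binomial_ring)
  finally show "pmf (bind_pmf (poisson0 a) (\<lambda>k. map_pmf ((+) k) (poisson0 b))) n = pmf (poisson0 (a + b)) n" .
qed

text \<open>The jump chain \<open>K\<close> run for a Poisson number of steps with mean
  \<open>L t\<close>, that is, the exponential of \<open>t L (K - I)\<close>.\<close>

definition uniformization :: "real \<Rightarrow> ('s \<Rightarrow> 's pmf) \<Rightarrow> real \<Rightarrow> 's \<Rightarrow> 's pmf" where
  "uniformization L K t x = bind_pmf (poisson0 (L * t)) (\<lambda>k. kpow K k x)"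

lemma uniformization_add:
  assumes "L \<ge> 0" "s \<ge> 0" "t \<ge> 0"
  shows "uniformization L K (s + t) x = bind_pmf (uniformization L K s x) (uniformization L K t)"
proof -
  have "uniformization L K (s + t) x
      = bind_pmf (bind_pmf (poisson0 (L * s)) (\<lambda>k. map_pmf ((+) k) (poisson0 (L * t)))) (\<lambda>k. kpow K k x)"
    using assms by (subst poisson0_add) (auto simp: uniformization_def algebra_simps)
  also have "\<dots> = bind_pmf (poisson0 (L * s)) (\<lambda>k. bind_pmf (poisson0 (L * t)) (\<lambda>l. kpow K (k + l) x))"
    by (simp add: bind_assoc_pmf bind_map_pmf)
  also have "\<dots> = bind_pmf (poisson0 (L * s)) (\<lambda>k. bind_pmf (kpow K k x) (\<lambda>y. bind_pmf (poisson0 (L * t)) (\<lambda>l. kpow K l y)))"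
    by (subst bind_commute_pmf) (simp add: kpow_add)
  finally show ?thesis by (simp add: uniformization_def[abs_def] bind_assoc_pmf)
qed

text \<open>An entry is \<open>exp (- L t)\<close> times a power series in \<open>L t\<close> with
  coefficients at most \<open>1 / k!\<close>. The series converges everywhere, so only its terms of
  order 0 and 1 enter the derivative at 0.\<close>

lemma pmf_uniformization_deriv:
  assumes "L > 0"
  shows "((\<lambda>t. pmf (uniformization L K t x) y) has_real_derivative
           L * (pmf (K x) y - indicator {x} y)) (at 0 within {0..})"
proof -
  define a where "a k = pmf (kpow K k x) y" for k
  define c where "c k = a k / fact k" for k
  have c_le: "norm (c k * s ^ k) \<le> norm (s ^ k / fact k)" for k and s :: real
    unfolding c_def a_def by (simp add: abs_mult divide_right_mono mult_left_le_one_le pmf_le_1)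
  have summ: "summable (\<lambda>k. norm (s ^ k / fact k))" for s :: real
    using summable_norm_exp[of s] by (simp add: divide_inverse mult.commute)
  have sc: "summable (\<lambda>k. c k * s ^ k)" and sc': "summable (\<lambda>k. norm (c k * s ^ k))" for s
    using summable_comparison_test'[OF summ[of s], of 0 "\<lambda>k. c k * s ^ k"]
      summable_comparison_test'[OF summ[of s], of 0 "\<lambda>k. norm (c k * s ^ k)"] c_le by auto
  have eq: "pmf (uniformization L K t x) y = exp (- (L * t)) * (\<Sum>k. c k * (L * t) ^ k)" if "t \<ge> 0" for t
  proof -
    have "pmf (uniformization L K t x) y = expect (poisson0 (L * t)) a"
      by (simp add: uniformization_def pmf_bind a_def[abs_def])
    also have "\<dots> = (\<integral>k. exp (- (L * t)) * (c k * (L * t) ^ k) \<partial>count_space UNIV)"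
      using assms that by (simp add: expect_count_space pmf_poisson0 c_def mult_ac)
    also have "\<dots> = (\<Sum>k. exp (- (L * t)) * (c k * (L * t) ^ k))"
      using summable_mult[OF sc'[of "L * t"], of "exp (- (L * t))"]
      by (intro integral_count_space_nat) (simp add: integrable_count_space_nat_iff abs_mult)
    also have "\<dots> = exp (- (L * t)) * (\<Sum>k. c k * (L * t) ^ k)"
      by (rule suminf_mult[OF sc])
    finally show ?thesis .
  qed
  have "DERIV (\<lambda>s. \<Sum>k. c k * s ^ k) 0 :> (\<Sum>k. diffs c k * 0 ^ k)"
    by (rule termdiffs_strong[of c 1]) (use sc[of 1] in auto)
  then have D: "DERIV (\<lambda>s. \<Sum>k. c k * s ^ k) (L * 0) :> c 1"
    by (simp add: diffs_def)
  have "DERIV (\<lambda>t. exp (- (L * t)) * (\<Sum>k. c k * (L * t) ^ k)) 0 :>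
      exp (- (L * 0)) * (c 1 * L) + (exp (- (L * 0)) * (- L)) * (\<Sum>k. c k * (L * 0) ^ k)"
    by (rule derivative_eq_intros DERIV_chain'[of "\<lambda>t. L * t", OF _ D] refl | simp)+
  then have "DERIV (\<lambda>t. exp (- (L * t)) * (\<Sum>k. c k * (L * t) ^ k)) 0 :> L * (pmf (K x) y - indicator {x} y)"
    unfolding mult_zero_right powser_zero
    by (simp add: c_def a_def kpow_1 algebra_simps indicator_def eq_commute)
  then have "((\<lambda>t. exp (- (L * t)) * (\<Sum>k. c k * (L * t) ^ k)) has_real_derivative
      L * (pmf (K x) y - indicator {x} y)) (at 0 within {0..})"
    by (rule has_field_derivative_at_within)
  then show ?thesis
    by (rule has_field_derivative_transform_within[OF _ zero_less_one]) (auto simp: eq)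
qed

text \<open>Supplies the transition function whose existence \<open>stationary_distribution\<close>
  demands once an invariant law of \<open>K\<close> is known.\<close>

lemma transition_function_uniformization:
  assumes unif: "uniformized S q L K"
  shows "transition_function S q (uniformization L K)"
  unfolding transition_function_def
proof (intro conjI ballI allI impI)
  have L: "L > 0" and KS: "\<And>x. x \<in> S \<Longrightarrow> set_pmf (K x) \<subseteq> S"
    using unif by (auto simp: uniformized_def)
  show "set_pmf (uniformization L K t x) \<subseteq> S" if "x \<in> S" for t x
    using set_kpow[where K=K and S=S, OF KS that] by (auto simp: uniformization_def)
  show "uniformization L K 0 x = return_pmf x" for x
    by (simp add: uniformization_def poisson0_def bind_return_pmf)
  show "uniformization L K (s + t) x = bind_pmf (uniformization L K s x) (uniformization L K t)"
    if "s \<ge> 0" "t \<ge> 0" for s t x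
    using that L by (simp add: uniformization_add)
  show "q x summable_on S - {x}" if "x \<in> S" for x
    using uniformized_has_sum[OF unif that] by (rule has_sum_imp_summable)
  show "((\<lambda>t. pmf (uniformization L K t x) y) has_real_derivative
      (if y = x then - infsum (q x) (S - {x}) else q x y)) (at 0 within {0..})"
    if "x \<in> S" "y \<in> S" for x y
  proof -
    have "infsum (q x) (S - {x}) = L * (1 - pmf (K x) x)"
      using uniformized_has_sum[OF unif that(1)] by (rule infsumI)
    moreover have "q x y = L * pmf (K x) y" if "y \<noteq> x"
      using unif \<open>x \<in> S\<close> \<open>y \<in> S\<close> that by (auto simp: uniformized_def)
    ultimately have "(if y = x then - infsum (q x) (S - {x}) else q x y) = L * (pmf (K x) y - indicator {x} y)"
      by (simp add: algebra_simps)
    then show ?thesis using pmf_uniformization_deriv[OF L, of K x y] by simp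
  qed
qed

text \<open>If every \<open>P h\<close> preserves \<open>\<pi>\<close>, integrating
  \<open>trans_approx\<close> gives \<open>L h d = O((L h)^2)\<close> for the defect
  \<open>d\<close> of \<open>K\<close>, so \<open>d = 0\<close>. Conversely, a law preserved by
  \<open>K\<close> is preserved by each power of \<open>K\<close>, hence by their Poisson
  mixture.\<close>

lemma stationary_distribution_iff:
  assumes unif: "uniformized S q L K"
  shows "stationary_distribution S q \<pi> \<longleftrightarrow> set_pmf \<pi> \<subseteq> S \<and> bind_pmf \<pi> K = \<pi>"
proof (intro iffI conjI)
  assume "stationary_distribution S q \<pi>"
  then obtain P where S: "set_pmf \<pi> \<subseteq> S" and P: "transition_function S q P"
    and inv: "\<And>t. t \<ge> 0 \<Longrightarrow> bind_pmf \<pi> (P t) = \<pi>"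
    by (auto simp: stationary_distribution_def)
  have L: "L > 0" using unif by (simp add: uniformized_def)
  show "set_pmf \<pi> \<subseteq> S" by fact
  show "bind_pmf \<pi> K = \<pi>"
  proof (rule pmf_eqI)
    fix y
    define f :: "'a \<Rightarrow> real" where "f = indicator {y}"
    have f: "\<bar>f x\<bar> \<le> 1" for x by (simp add: f_def indicator_def)
    define d where "d = expect (bind_pmf \<pi> K) f - expect \<pi> f"
    have bd: "\<bar>expect p f\<bar> \<le> 1" for p using f by (rule abs_expect_le)
    have int: "integrable (measure_pmf \<pi>) f" "integrable (measure_pmf \<pi>) (\<lambda>x. expect (K x) f)"
      "integrable (measure_pmf \<pi>) (\<lambda>x. expect (P h x) f)" for h
      using f bd by (auto intro: integrable_pmf_bounded)
    have le: "\<bar>L * h * d\<bar> \<le> 4 * (L * h)^2" if h: "h \<ge> 0" "L * h \<le> 1" for h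
    proof -
      have "\<bar>expect \<pi> (\<lambda>x. expect (P h x) f - f x - L * h * (expect (K x) f - f x))\<bar>
          \<le> expect \<pi> (\<lambda>x. \<bar>expect (P h x) f - f x - L * h * (expect (K x) f - f x)\<bar>)"
        by (rule integral_abs_bound)
      also have "\<dots> \<le> expect \<pi> (\<lambda>x. 4 * (L * h)^2 * 1)"
      proof (rule integral_mono_AE)
        show "AE x in measure_pmf \<pi>. \<bar>expect (P h x) f - f x - L * h * (expect (K x) f - f x)\<bar> \<le> 4 * (L * h)^2 * 1"
          using trans_approx[OF unif P h, where f=f and F=1] S f by (auto simp: AE_measure_pmf_iff)
      qed (use int in auto)
      finally have "\<bar>expect \<pi> (\<lambda>x. expect (P h x) f - f x - L * h * (expect (K x) f - f x))\<bar> \<le> 4 * (L * h)^2"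
        by simp
      moreover have "expect \<pi> (\<lambda>x. expect (P h x) f - f x - L * h * (expect (K x) f - f x))
         = expect (bind_pmf \<pi> (P h)) f - expect \<pi> f - L * h * d"
        using int by (simp add: d_def expect_bind[OF f])
      ultimately show ?thesis using inv[OF h(1)] by simp
    qed
    have "\<bar>d\<bar> \<le> e" if "e > 0" for e
    proof -
      \<comment> \<open>Keeps \<open>L h\<close> at most 1, as \<open>trans_approx\<close> requires,
        and makes the bound \<open>4 L h\<close> at most \<open>e\<close>.\<close>
      define h where "h = min 1 (e / 4) / L"
      have h: "h > 0" "L * h \<le> 1" "L * h \<le> e / 4" using L that by (auto simp: h_def)
      have "L * h * \<bar>d\<bar> \<le> L * h * (4 * (L * h))"
        using le[of h] h L by (simp add: abs_mult power2_eq_square mult_ac)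
      then have "\<bar>d\<bar> \<le> 4 * (L * h)" using h L by (simp add: mult_le_cancel_left_pos)
      then show ?thesis using h by simp
    qed
    then have "d = 0" by (metis abs_le_zero_iff dense_ge)
    then show "pmf (bind_pmf \<pi> K) y = pmf \<pi> y" by (simp add: d_def f_def pmf.rep_eq)
  qed
next
  assume *: "set_pmf \<pi> \<subseteq> S \<and> bind_pmf \<pi> K = \<pi>"
  have "bind_pmf \<pi> (uniformization L K t) = \<pi>" for t
    unfolding uniformization_def[abs_def]
    by (subst bind_commute_pmf) (use * in \<open>simp add: kpow_invariant\<close>)
  then show "stationary_distribution S q \<pi>"
    using * transition_function_uniformization[OF unif] by (auto simp: stationary_distribution_def)
qed

section \<open>The uniformized queue length chain\<close>

text \<open>
  The factor \<open>1(x\<^sub>i > 0)\<close> is implicit: for \<open>x\<^sub>i = 0\<close> truncated subtraction makes \<open>x(i := x i - 1) = x\<close>.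
\<close>

definition qstep ::
  "nat set \<Rightarrow> (nat \<Rightarrow> real) \<Rightarrow> (nat \<Rightarrow> (nat \<Rightarrow> nat) \<Rightarrow> real) \<Rightarrow> real \<Rightarrow>
   ((nat \<Rightarrow> nat) \<Rightarrow> real) \<Rightarrow> (nat \<Rightarrow> nat) \<Rightarrow> real" where
  "qstep I lam \<psi> L f x = f x +
     (\<Sum>i\<in>I. lam i * (f (x(i := x i + 1)) - f x) + \<psi> i x * (f (x(i := x i - 1)) - f x)) / L"

text \<open>The operator \<open>qstep\<close> comes first and the kernel is read off from its values
  on indicators. That these form a probability vector is checked where \<open>pmf_K\<close> is
  proved.\<close>

definition qker ::
  "nat set \<Rightarrow> (nat \<Rightarrow> real) \<Rightarrow> (nat \<Rightarrow> (nat \<Rightarrow> nat) \<Rightarrow> real) \<Rightarrow> real \<Rightarrow> (nat \<Rightarrow> nat) \<Rightarrow> (nat \<Rightarrow> nat) pmf" where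
  "qker I lam \<psi> L x = embed_pmf (\<lambda>y. qstep I lam \<psi> L (indicator {y}) x)"

definition nbh :: "nat set \<Rightarrow> (nat \<Rightarrow> nat) \<Rightarrow> (nat \<Rightarrow> nat) set" where
  "nbh I x = insert x ((\<lambda>i. x(i := x i + 1)) ` I \<union> (\<lambda>i. x(i := x i - 1)) ` I)"

lemma nbhI [simp]: "x \<in> nbh I x" "i \<in> I \<Longrightarrow> x(i := x i + 1) \<in> nbh I x" "i \<in> I \<Longrightarrow> x(i := Suc (x i)) \<in> nbh I x"
    "i \<in> I \<Longrightarrow> x(i := x i - 1) \<in> nbh I x" "i \<in> I \<Longrightarrow> x(i := x i - Suc 0) \<in> nbh I x"
  by (auto simp: nbh_def)

text \<open>By symmetry the states that can jump to a given \<open>y\<close> lie in the finite set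
  \<open>nbh I y\<close>, so balance equations become finite sums.\<close>

lemma nbh_sym:
  assumes "y \<in> nbh I x"
  shows "x \<in> nbh I y"
proof -
  consider "y = x" | i where "i \<in> I" "y = x(i := x i + 1)" | i where "i \<in> I" "y = x(i := x i - 1)" "x i > 0"
    using assms by (cases "y = x") (auto simp: nbh_def fun_upd_idem_iff)
  then show ?thesis
  proof cases
    case (2 i)
    then have "x = y(i := y i - 1)" by simp
    then show ?thesis using 2 by (metis nbhI(4))
  next
    case (3 i)
    then have "x = y(i := y i + 1)" by simp
    then show ?thesis using 3 by (metis nbhI(2))
  qed simp
qed

lemma nbh_states: "x \<in> states I \<Longrightarrow> y \<in> nbh I x \<Longrightarrow> y \<in> states I"
  by (auto simp: nbh_def PiE_def extensional_def)

lemma nbh_le: "y \<in> nbh I x \<Longrightarrow> y i \<le> x i + 1 \<and> x i \<le> y i + 1"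
  by (auto simp: nbh_def)

text \<open>The rate bounds are imposed at every function, not only on \<open>states I\<close>, so
  that monotonicity of the operator has no side conditions. With common \<open>B\<close> and
  \<open>L\<close>, chains on different index sets can be compared step by step.\<close>

locale queue_chain =
  fixes I :: "nat set" and lam :: "nat \<Rightarrow> real" and \<psi> :: "nat \<Rightarrow> (nat \<Rightarrow> nat) \<Rightarrow> real" and B L :: real
  assumes fin: "finite I"
    and lam_pos: "i \<in> I \<Longrightarrow> 0 < lam i"
    and \<psi>_nonneg: "i \<in> I \<Longrightarrow> 0 \<le> \<psi> i x"
    and \<psi>_le: "i \<in> I \<Longrightarrow> \<psi> i x \<le> B"
    and L_pos: "0 < L"
    and L_ge: "(\<Sum>i\<in>I. lam i + B) \<le> L"
begin

abbreviation "T \<equiv> qstep I lam \<psi> L"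
abbreviation "K \<equiv> qker I lam \<psi> L"

lemma finite_nbh [simp]: "finite (nbh I x)"
  using fin by (simp add: nbh_def)

text \<open>Each server gets a clock of rate \<open>B\<close>, used at rate
  \<open>\<psi> i x\<close> and idle otherwise. All coefficients are then nonnegative and sum to
  \<open>L\<close>, which makes the operator monotone.\<close>

lemma T_mult: "L * T f x =
    (\<Sum>i\<in>I. lam i * f (x(i := x i + 1)) + (\<psi> i x * f (x(i := x i - 1)) + (B - \<psi> i x) * f x))
     + (L - (\<Sum>i\<in>I. lam i + B)) * f x"
proof -
  have "(\<Sum>i\<in>I. lam i * f (x(i := x i + 1)) + (\<psi> i x * f (x(i := x i - 1)) + (B - \<psi> i x) * f x))
     - (\<Sum>i\<in>I. lam i + B) * f x
     = (\<Sum>i\<in>I. lam i * (f (x(i := x i + 1)) - f x) + \<psi> i x * (f (x(i := x i - 1)) - f x))"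
    unfolding sum_distrib_right sum_subtractf[symmetric] by (rule sum.cong) (auto simp: algebra_simps)
  then show ?thesis using L_pos by (simp add: qstep_def algebra_simps)
qed

lemma T_mono:
  assumes "\<And>y. y \<in> nbh I x \<Longrightarrow> f y \<le> g y"
  shows "T f x \<le> T g x"
proof -
  have "L * T f x \<le> L * T g x"
    unfolding T_mult using \<psi>_nonneg \<psi>_le lam_pos L_ge assms
    by (intro add_mono sum_mono mult_left_mono) (auto intro: less_imp_le)
  then show ?thesis using L_pos by simp
qed

lemma T_cong: "(\<And>y. y \<in> nbh I x \<Longrightarrow> f y = g y) \<Longrightarrow> T f x = T g x"
  by (intro antisym T_mono) auto

lemma T_const [simp]: "T (\<lambda>x. c) = (\<lambda>x. c)"
  by (simp add: qstep_def fun_eq_iff)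

lemma T_add: "T (\<lambda>x. f x + g x) = (\<lambda>x. T f x + T g x)"
proof
  fix x
  have "(\<Sum>i\<in>I. lam i * (f (x(i := x i + 1)) + g (x(i := x i + 1)) - (f x + g x)) +
            \<psi> i x * (f (x(i := x i - 1)) + g (x(i := x i - 1)) - (f x + g x)))
      = (\<Sum>i\<in>I. lam i * (f (x(i := x i + 1)) - f x) + \<psi> i x * (f (x(i := x i - 1)) - f x))
      + (\<Sum>i\<in>I. lam i * (g (x(i := x i + 1)) - g x) + \<psi> i x * (g (x(i := x i - 1)) - g x))"
    unfolding sum.distrib[symmetric] by (rule sum.cong) (simp_all add: algebra_simps)
  then show "T (\<lambda>x. f x + g x) x = T f x + T g x"
    by (simp add: qstep_def add_divide_distrib)
qed

lemma T_cmult: "T (\<lambda>x. c * f x) = (\<lambda>x. c * T f x)"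
  by (simp add: qstep_def fun_eq_iff sum_distrib_left algebra_simps)

lemma T_sum: "finite A \<Longrightarrow> T (\<lambda>x. \<Sum>a\<in>A. f a x) = (\<lambda>x. \<Sum>a\<in>A. T (f a) x)"
  by (induction A rule: finite_induct) (simp_all add: T_add)

lemma T_bounded: "(\<And>x. \<bar>f x\<bar> \<le> F) \<Longrightarrow> \<bar>T f x\<bar> \<le> F"
  using T_mono[of x f "\<lambda>_. F"] T_mono[of x "\<lambda>_. - F" f] by (simp add: abs_le_iff minus_le_iff)

lemma
  shows pmf_K: "pmf (K x) y = T (indicator {y}) x"
    and set_K: "set_pmf (K x) \<subseteq> nbh I x"
proof -
  let ?f = "\<lambda>y. T (indicator {y}) x"
  have nonneg: "0 \<le> ?f y" for y using T_mono[of x "\<lambda>_. 0" "indicator {y}"] by simp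
  have 0: "?f y = 0" if "y \<notin> nbh I x" for y
    using T_cong[of x "indicator {y}" "\<lambda>_. 0"] that by (auto simp: indicator_def)
  have "(\<Sum>y\<in>nbh I x. ?f y) = T (\<lambda>z. \<Sum>y\<in>nbh I x. indicator {y} z) x"
    by (simp add: T_sum)
  also have "\<dots> = T (\<lambda>_. 1) x"
    by (rule T_cong) (simp add: indicator_def)
  finally have 1: "(\<Sum>y\<in>nbh I x. ?f y) = 1" by simp
  have "(\<integral>\<^sup>+y. ennreal (?f y) \<partial>count_space UNIV) = (\<Sum>y\<in>nbh I x. ennreal (?f y))"
    by (rule nn_integral_count_space') (auto simp: 0)
  also have "\<dots> = 1" using 1 nonneg by (simp add: sum_ennreal)
  finally have prob: "(\<integral>\<^sup>+y. ennreal (?f y) \<partial>count_space UNIV) = 1" .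
  show "pmf (K x) y = ?f y" for y unfolding qker_def by (rule pmf_embed_pmf[OF nonneg prob])
  show "set_pmf (K x) \<subseteq> nbh I x"
    unfolding qker_def set_embed_pmf[OF nonneg prob] using 0 by blast
qed

lemma expect_K: "expect (K x) f = T f x"
proof -
  have "expect (K x) f = (\<Sum>y\<in>nbh I x. f y * T (indicator {y}) x)"
    by (subst integral_measure_pmf[of "nbh I x"]) (use set_K in \<open>auto simp: pmf_K mult.commute\<close>)
  also have "\<dots> = T (\<lambda>z. \<Sum>y\<in>nbh I x. f y * indicator {y} z) x"
    by (simp only: T_sum[OF finite_nbh] T_cmult)
  also have "\<dots> = T f x"
    by (rule T_cong) (simp add: indicator_def sum.delta if_distrib cong: if_cong)
  finally show ?thesis .
qed

lemma set_K_states: "x \<in> states I \<Longrightarrow> set_pmf (K x) \<subseteq> states I"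
  using set_K nbh_states by blast

lemma uniformized_queue: "uniformized (states I) (queue_rate I lam \<psi>) L K"
  unfolding uniformized_def
proof (intro conjI ballI impI)
  fix x y :: "nat \<Rightarrow> nat" assume "y \<noteq> x"
  have "L * T (indicator {y}) x = (\<Sum>i\<in>I. lam i * indicator {y} (x(i := x i + 1)) + \<psi> i x * indicator {y} (x(i := x i - 1)))"
    using L_pos \<open>y \<noteq> x\<close> by (simp add: qstep_def)
  also have "\<dots> = queue_rate I lam \<psi> x y"
    unfolding queue_rate_def
  proof (rule sum.cong)
    fix i
    have "x(i := x i - 1) \<noteq> y" if "x i = 0" using that \<open>y \<noteq> x\<close> by (simp add: fun_upd_idem)
    then show "lam i * indicator {y} (x(i := x i + 1)) + \<psi> i x * indicator {y} (x(i := x i - 1)) =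
        (if y = x(i := x i + 1) then lam i else 0) + (if 0 < x i \<and> y = x(i := x i - 1) then \<psi> i x else 0)"
      by (cases "x i = 0") (simp_all add: indicator_def eq_commute[of y])
  qed simp
  finally show "queue_rate I lam \<psi> x y = L * pmf (K x) y" by (simp add: pmf_K)
qed (use L_pos set_K_states in auto)

text \<open>One step changes a coordinate by at most 1, so only states within distance
  \<open>k\<close> of \<open>x\<close> matter after \<open>k\<close> steps.\<close>

lemma T_pow_mono:
  assumes "\<And>y. (\<And>i. y i \<le> x i + k \<and> x i \<le> y i + k) \<Longrightarrow> f y \<le> g y"
  shows "(T ^^ k) f x \<le> (T ^^ k) g x"
  using assms
proof (induction k arbitrary: f g)
  case 0
  then show ?case by simp
next
  case (Suc k)
  have "(T ^^ k) (T f) x \<le> (T ^^ k) (T g) x"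
  proof (rule Suc.IH)
    fix y assume y: "\<And>i. y i \<le> x i + k \<and> x i \<le> y i + k"
    show "T f y \<le> T g y"
    proof (rule T_mono)
      fix z assume z: "z \<in> nbh I y"
      show "f z \<le> g z"
      proof (rule Suc.prems)
        fix i show "z i \<le> x i + Suc k \<and> x i \<le> z i + Suc k"
          using y[of i] nbh_le[OF z, of i] by linarith
      qed
    qed
  qed
  then show ?case by (simp add: funpow_swap1)
qed

lemma T_pow_const [simp]: "(T ^^ k) (\<lambda>x. c) = (\<lambda>x. c)"
  by (induction k) simp_all

lemma T_pow_add: "(T ^^ k) (\<lambda>x. f x + g x) = (\<lambda>x. (T ^^ k) f x + (T ^^ k) g x)"
  by (induction k) (simp_all add: T_add)

lemma T_pow_cmult: "(T ^^ k) (\<lambda>x. c * f x) = (\<lambda>x. c * (T ^^ k) f x)"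
  by (induction k) (simp_all add: T_cmult)

lemma T_pow_minus: "(T ^^ k) (\<lambda>x. - f x) = (\<lambda>x. - (T ^^ k) f x)"
  using T_pow_cmult[of k "-1" f] by simp

lemma T_pow_diff: "(T ^^ k) (\<lambda>x. f x - g x) = (\<lambda>x. (T ^^ k) f x - (T ^^ k) g x)"
  using T_pow_add[of k f "\<lambda>x. - g x"] by (simp add: T_pow_minus)

lemma T_pow_sum: "finite A \<Longrightarrow> (T ^^ k) (\<lambda>x. \<Sum>a\<in>A. f a x) = (\<lambda>x. \<Sum>a\<in>A. (T ^^ k) (f a) x)"
  by (induction A rule: finite_induct) (simp_all add: T_pow_add)

lemma T_pow_bounded: "(\<And>x. \<bar>f x\<bar> \<le> F) \<Longrightarrow> \<bar>(T ^^ k) f x\<bar> \<le> F"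
  by (induction k arbitrary: x) (simp_all add: T_bounded)

lemma expect_kpow:
  assumes "\<And>x. \<bar>f x\<bar> \<le> F"
  shows "expect (kpow K k x) f = (T ^^ k) f x"
  using assms
proof (induction k arbitrary: f)
  case 0
  then show ?case by simp
next
  case (Suc k)
  have "expect (kpow K (Suc k) x) f = expect (kpow K k x) (T f)"
    unfolding kpow_Suc using Suc.prems by (subst expect_bind) (auto simp: expect_K)
  also have "\<dots> = (T ^^ k) (T f) x" using Suc T_bounded by blast
  finally show ?case by (simp add: funpow_swap1)
qed

lemma expect_invariant:
  assumes "bind_pmf p K = p" "\<And>x. \<bar>f x\<bar> \<le> F"
  shows "expect p ((T ^^ k) f) = expect p f"
proof -
  have "expect p f = expect (bind_pmf p (kpow K k)) f"
    using kpow_invariant[OF assms(1)] by simp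
  also have "\<dots> = expect p ((T ^^ k) f)"
    by (subst expect_bind[OF assms(2)]) (simp add: expect_kpow[OF assms(2)])
  finally show ?thesis by simp
qed

lemma pmf_K_up: "i \<in> I \<Longrightarrow> lam i / L \<le> pmf (K x) (x(i := x i + 1))"
proof -
  assume i: "i \<in> I"
  have ne: "x(i := x i + 1) \<noteq> x" by (metis fun_upd_same n_not_Suc_n Suc_eq_plus1)
  have "lam i = (\<Sum>j\<in>{i}. lam j * indicator {x(i := x i + 1)} (x(j := x j + 1)))" by simp
  also have "\<dots> \<le> (\<Sum>j\<in>I. lam j * indicator {x(i := x i + 1)} (x(j := x j + 1)))"
    by (rule sum_mono2) (use fin i lam_pos in \<open>auto intro!: mult_nonneg_nonneg intro: less_imp_le\<close>)
  also have "\<dots> \<le> (\<Sum>j\<in>I. lam j * indicator {x(i := x i + 1)} (x(j := x j + 1)) + \<psi> j x * indicator {x(i := x i + 1)} (x(j := x j - 1)))"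
    by (rule sum_mono) (use \<psi>_nonneg in auto)
  also have "\<dots> = L * pmf (K x) (x(i := x i + 1))"
    using L_pos ne by (simp add: pmf_K qstep_def)
  finally show ?thesis using L_pos by (simp add: field_simps)
qed

end

section \<open>Order on states and stochastic comparison of two queue chains\<close>

lemma up_induct:
  assumes "finite I" "x \<in> states I" "y \<in> states I" "\<And>i. i \<in> I \<Longrightarrow> x i \<le> y i" "P x"
    and step: "\<And>z i. z \<in> states I \<Longrightarrow> P z \<Longrightarrow> i \<in> I \<Longrightarrow> P (z(i := z i + 1))"
  shows "P y"
  using assms(2,4,5)
proof (induction "\<Sum>i\<in>I. y i - x i" arbitrary: x)
  case 0
  then have "x i = y i" if "i \<in> I" for i using assms(1) that by force
  then have "x = y" using 0 assms(3) by (auto intro: PiE_ext)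
  then show ?case using 0 by simp
next
  case (Suc k)
  have "(\<Sum>i\<in>I. y i - x i) \<noteq> 0" using Suc(2) by simp
  then obtain i where i: "i \<in> I" "y i - x i \<noteq> 0" by (rule sum.not_neutral_contains_not_neutral)
  then have i: "i \<in> I" "x i < y i" by auto
  let ?x = "x(i := x i + 1)"
  have "(\<Sum>j\<in>I. y j - x j) = (y i - x i) + (\<Sum>j\<in>I - {i}. y j - x j)"
    using assms(1) i by (simp add: sum.remove)
  moreover have "(\<Sum>j\<in>I. y j - ?x j) = (y i - ?x i) + (\<Sum>j\<in>I - {i}. y j - ?x j)"
    using assms(1) i by (subst sum.remove[of I i]) auto
  moreover have "(\<Sum>j\<in>I - {i}. y j - ?x j) = (\<Sum>j\<in>I - {i}. y j - x j)"
    by (rule sum.cong) auto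
  ultimately have "k = (\<Sum>j\<in>I. y j - ?x j)" using Suc(2) i by simp
  moreover have "?x \<in> states I" using Suc i by (auto simp: PiE_def extensional_def)
  moreover have "?x j \<le> y j" if "j \<in> I" for j using Suc i that by auto
  moreover have "P ?x" using step Suc i by blast
  ultimately show ?case using Suc by blast
qed

text \<open>The analytic form of a coupling that keeps the \<open>J\<close>-chain below the
  \<open>I\<close>-chain on \<open>I\<close>. The condition \<open>fg\<close> on the pair, rather
  than monotonicity of one function, is what passes through a step of two different chains.\<close>

lemma qstep_compare:
  assumes X: "queue_chain J lam \<phi> B L" and Y: "queue_chain I lam \<psi> B L" and "I \<subseteq> J"
    and rates: "\<And>i x y. i \<in> I \<Longrightarrow> (\<And>j. j \<in> I \<Longrightarrow> x j \<le> y j) \<Longrightarrow> x i = y i \<Longrightarrow> \<psi> i y \<le> \<phi> i x"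
    and fg: "\<And>x y. (\<And>j. j \<in> I \<Longrightarrow> x j \<le> y j) \<Longrightarrow> f x \<le> g y"
    and xy: "\<And>j. j \<in> I \<Longrightarrow> x j \<le> y j"
  shows "qstep J lam \<phi> L f x \<le> qstep I lam \<psi> L g y"
proof -
  interpret X: queue_chain J lam \<phi> B L by fact
  interpret Y: queue_chain I lam \<psi> B L by fact
  let ?G = "\<lambda>i. lam i * g (y(i := y i + 1)) + (\<psi> i y * g (y(i := y i - 1)) + (B - \<psi> i y) * g y)"
  have "L * X.T f x =
    (\<Sum>i\<in>J. lam i * f (x(i := x i + 1)) + (\<phi> i x * f (x(i := x i - 1)) + (B - \<phi> i x) * f x))
     + (L - (\<Sum>i\<in>J. lam i + B)) * f x" by (rule X.T_mult)
  also have "\<dots> \<le> (\<Sum>i\<in>J. if i \<in> I then ?G i else (lam i + B) * g y) + (L - (\<Sum>i\<in>J. lam i + B)) * g y"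
  proof (intro add_mono sum_mono)
    show "(L - (\<Sum>i\<in>J. lam i + B)) * f x \<le> (L - (\<Sum>i\<in>J. lam i + B)) * g y"
      using X.L_ge fg[of x y] xy by (intro mult_left_mono) auto
    fix i assume i: "i \<in> J"
    note \<phi> = X.\<psi>_nonneg[OF i, of x] X.\<psi>_le[OF i, of x] and lam = X.lam_pos[OF i]
    have fxgy: "f x \<le> g y" using fg xy by blast
    show "lam i * f (x(i := x i + 1)) + (\<phi> i x * f (x(i := x i - 1)) + (B - \<phi> i x) * f x)
        \<le> (if i \<in> I then ?G i else (lam i + B) * g y)"
    proof (cases "i \<in> I")
      case False
      \<comment> \<open>A move outside \<open>I\<close> is invisible on \<open>I\<close>, so the
        moved state is still below the unmoved \<open>y\<close>.\<close>
      have 1: "f (x(i := x i + 1)) \<le> g y" "f (x(i := x i - 1)) \<le> g y"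
        using False xy by (auto intro!: fg)
      have "lam i * f (x(i := x i + 1)) + (\<phi> i x * f (x(i := x i - 1)) + (B - \<phi> i x) * f x)
        \<le> lam i * g y + (\<phi> i x * g y + (B - \<phi> i x) * g y)"
        using 1 fxgy \<phi> lam by (intro add_mono mult_left_mono) auto
      then show ?thesis using False by (simp add: algebra_simps)
    next
      case True
      note \<psi> = Y.\<psi>_nonneg[OF True, of y] Y.\<psi>_le[OF True, of y]
      have up: "f (x(i := x i + 1)) \<le> g (y(i := y i + 1))" using xy True by (auto intro!: fg)
      have "\<phi> i x * f (x(i := x i - 1)) + (B - \<phi> i x) * f x \<le> \<psi> i y * g (y(i := y i - 1)) + (B - \<psi> i y) * g y"
      proof (cases "x i = y i")
        case eq: True
        have le: "\<psi> i y \<le> \<phi> i x" using rates[of i x y, OF True xy eq] by simp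
        have dn: "f (x(i := x i - 1)) \<le> g (y(i := y i - 1))" using xy True eq by (auto intro!: fg)
        have dx: "f (x(i := x i - 1)) \<le> g y" using xy True eq by (auto intro!: fg) 
        \<comment> \<open>Both states are served together at rate \<open>\<psi> i y\<close>; the
          excess \<open>\<phi> i x - \<psi> i y\<close>, nonnegative by \<open>rates\<close>, serves
          the lower state alone.\<close>
        have "\<phi> i x * f (x(i := x i - 1)) + (B - \<phi> i x) * f x
          = \<psi> i y * f (x(i := x i - 1)) + (\<phi> i x - \<psi> i y) * f (x(i := x i - 1)) + (B - \<phi> i x) * f x"
          by (simp add: algebra_simps)
        also have "\<dots> \<le> \<psi> i y * g (y(i := y i - 1)) + (\<phi> i x - \<psi> i y) * g y + (B - \<phi> i x) * g y"
          using dn dx fxgy le \<phi> \<psi> by (intro add_mono mult_left_mono) auto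
        finally show ?thesis by (simp add: algebra_simps)
      next
        case ne: False
        then have lt: "x i < y i" using xy[OF True] by simp
        have dn: "f (x(i := x i - 1)) \<le> g (y(i := y i - 1))" using xy True lt by (auto intro!: fg)
        have dx: "f x \<le> g (y(i := y i - 1))" using xy True lt by (auto intro!: fg)
        have "(x(i := x i - 1)) j \<le> y j" if "j \<in> I" for j using xy[OF that] by auto
        then have dy: "f (x(i := x i - 1)) \<le> g y" by (rule fg)
        \<comment> \<open>Here the two service rates are unrelated, but the order survives a service
          of either state, of both or of none. So every value of \<open>f\<close> is at most both
          values of \<open>g\<close>, and with equal total weight \<open>B\<close> the mixtures can
          be compared through \<open>m\<close>.\<close>
        define m where "m = min (g (y(i := y i - 1))) (g y)"
        have dxm: "f (x(i := x i - 1)) \<le> m" "f x \<le> m"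
          using dn dx dy fxgy by (auto simp: m_def)
        have "\<phi> i x * f (x(i := x i - 1)) + (B - \<phi> i x) * f x \<le> \<phi> i x * m + (B - \<phi> i x) * m"
          using dxm \<phi> by (intro add_mono mult_left_mono) auto
        also have "\<dots> = \<psi> i y * m + (B - \<psi> i y) * m" by (simp add: algebra_simps)
        also have "\<dots> \<le> \<psi> i y * g (y(i := y i - 1)) + (B - \<psi> i y) * g y"
          using \<psi> by (intro add_mono mult_left_mono) (auto simp: m_def)
        finally show ?thesis .
      qed
      with up lam True show ?thesis by (simp add: add_mono mult_left_mono)
    qed
  qed
  also have "\<dots> = (\<Sum>i\<in>I. ?G i) + (L - (\<Sum>i\<in>I. lam i + B)) * g y"
  proof -
    have split: "(\<Sum>i\<in>J. h i) = (\<Sum>i\<in>I. h i) + (\<Sum>i\<in>J - I. h i)" for h :: "nat \<Rightarrow> real"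
      using sum.subset_diff[OF \<open>I \<subseteq> J\<close> X.fin, of h] by simp
    have "(\<Sum>i\<in>J. if i \<in> I then ?G i else (lam i + B) * g y) = (\<Sum>i\<in>I. ?G i) + (\<Sum>i\<in>J - I. (lam i + B) * g y)"
      unfolding split by (intro arg_cong2[where f="(+)"] sum.cong) auto
    moreover have "(\<Sum>i\<in>J - I. (lam i + B) * g y) = (\<Sum>i\<in>J - I. lam i + B) * g y"
      by (rule sum_distrib_right[symmetric])
    ultimately show ?thesis unfolding split[of "\<lambda>i. lam i + B"] left_diff_distrib distrib_right by linarith
  qed
  also have "\<dots> = L * Y.T g y" by (rule Y.T_mult[symmetric])
  finally show ?thesis using X.L_pos by simp
qed

lemma qstep_pow_compare:
  assumes X: "queue_chain J lam \<phi> B L" and Y: "queue_chain I lam \<psi> B L" and "I \<subseteq> J"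
    and rates: "\<And>i x y. i \<in> I \<Longrightarrow> (\<And>j. j \<in> I \<Longrightarrow> x j \<le> y j) \<Longrightarrow> x i = y i \<Longrightarrow> \<psi> i y \<le> \<phi> i x"
    and fg: "\<And>x y. (\<And>j. j \<in> I \<Longrightarrow> x j \<le> y j) \<Longrightarrow> f x \<le> g y"
    and xy: "\<And>j. j \<in> I \<Longrightarrow> x j \<le> y j"
  shows "(qstep J lam \<phi> L ^^ k) f x \<le> (qstep I lam \<psi> L ^^ k) g y"
  using xy
proof (induction k arbitrary: x y)
  case 0
  then show ?case using fg by simp
next
  case (Suc k)
  have "qstep J lam \<phi> L ((qstep J lam \<phi> L ^^ k) f) x \<le> qstep I lam \<psi> L ((qstep I lam \<psi> L ^^ k) g) y"
    by (rule qstep_compare[OF X Y \<open>I \<subseteq> J\<close>]) (use rates Suc in blast)+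
  then show ?case by simp
qed

section \<open>Attractive chains\<close>

text \<open>Quantifying over all functions makes \<open>f\<close> depend on the coordinates in
  \<open>I\<close> only.\<close>

definition increasing_on :: "nat set \<Rightarrow> ((nat \<Rightarrow> nat) \<Rightarrow> real) \<Rightarrow> bool" where
  "increasing_on I f \<longleftrightarrow> (\<forall>x y. (\<forall>j\<in>I. x j \<le> y j) \<longrightarrow> f x \<le> f y)"

lemma increasing_onD: "increasing_on I f \<Longrightarrow> (\<And>j. j \<in> I \<Longrightarrow> x j \<le> y j) \<Longrightarrow> f x \<le> f y"
  by (auto simp: increasing_on_def)

definition downbox :: "nat set \<Rightarrow> nat \<Rightarrow> (nat \<Rightarrow> nat) set" where
  "downbox I m = {x. \<forall>j\<in>I. x j \<le> m}"

lemma box_mono: "m \<le> m' \<Longrightarrow> downbox I m \<subseteq> downbox I m'"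
  by (auto simp: downbox_def)

lemma finite_states_box: "finite I \<Longrightarrow> finite (states I \<inter> downbox I m)"
  by (rule finite_subset[OF _ finite_PiE[of I "\<lambda>_. {..m}"]]) (auto simp: downbox_def)

lemma increasing_on_outside_box: "increasing_on I (indicator (- downbox I m))"
  unfolding increasing_on_def downbox_def by (auto simp: indicator_def) (meson order_trans)

lemma prob_box_tendsto:
  assumes "finite I"
  shows "(\<lambda>m. measure_pmf.prob p (downbox I m)) \<longlonglongrightarrow> 1"
proof -
  have "(\<Union>m. downbox I m) = UNIV"
  proof -
    have "x \<in> downbox I (\<Sum>j\<in>I. x j)" for x
      using assms by (auto simp: downbox_def intro: member_le_sum)
    then show ?thesis by blast
  qed
  moreover have "incseq (downbox I)" using box_mono by (auto simp: incseq_def)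
  ultimately show ?thesis
    using measure_pmf.finite_Lim_measure_incseq[of "downbox I" p] by (simp add: measure_pmf.prob_space[simplified])
qed

lemma prob_box_ge:
  assumes "finite I" "e > 0"
  obtains m where "measure_pmf.prob p (- downbox I m) < e"
proof -
  have "\<forall>\<^sub>F m in sequentially. 1 - e < measure_pmf.prob p (downbox I m)"
    using prob_box_tendsto[OF assms(1), of p] assms(2) by (intro order_tendstoD) auto
  then obtain m where "1 - e < measure_pmf.prob p (downbox I m)" by (auto simp: eventually_sequentially)
  then have "measure_pmf.prob p (- downbox I m) < e"
    using measure_pmf.prob_compl[of "downbox I m" p] by (simp add: Compl_eq_Diff_UNIV)
  then show ?thesis by (rule that)
qed

text \<open>The hypothesis \<open>attr\<close> is the condition on rates under which
  \<open>qstep_compare\<close> compares the chain with itself.\<close>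

locale attractive_chain = queue_chain +
  assumes attr: "\<And>i x y. i \<in> I \<Longrightarrow> (\<And>j. j \<in> I \<Longrightarrow> x j \<le> y j) \<Longrightarrow> x i = y i \<Longrightarrow> \<psi> i y \<le> \<psi> i x"
begin

definition z0 :: "nat \<Rightarrow> nat" where "z0 = restrict (\<lambda>_. 0) I"

lemma z0_states: "z0 \<in> states I" and z0_le: "j \<in> I \<Longrightarrow> z0 j \<le> x j"
  by (auto simp: z0_def)

lemma T_pow_increasing:
  assumes "increasing_on I f"
  shows "increasing_on I ((T ^^ k) f)"
  unfolding increasing_on_def
proof (intro allI impI)
  fix x y :: "nat \<Rightarrow> nat" assume "\<forall>j\<in>I. x j \<le> y j"
  then show "(T ^^ k) f x \<le> (T ^^ k) f y"
    by (intro qstep_pow_compare[OF queue_chain_axioms queue_chain_axioms])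
       (use attr assms in \<open>auto simp: increasing_on_def\<close>)
qed

text \<open>The empty state is the least one, so an increasing function is at least its value at
  \<open>z0\<close> after the first step as well.\<close>

lemma T_pow_incseq:
  assumes "increasing_on I f"
  shows "incseq (\<lambda>k. (T ^^ k) f z0)"
proof (rule incseq_SucI)
  fix k
  let ?g = "(T ^^ k) f"
  have "T (\<lambda>_. ?g z0) z0 \<le> T ?g z0"
    by (rule T_mono) (rule increasing_onD[OF T_pow_increasing[OF assms]], rule z0_le)
  then show "(T ^^ k) f z0 \<le> (T ^^ Suc k) f z0" by simp
qed

lemma T_pow_convergent:
  assumes "increasing_on I f" "\<And>x. \<bar>f x\<bar> \<le> F"
  shows "convergent (\<lambda>k. (T ^^ k) f z0)"
proof (rule Bseq_monoseq_convergent)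
  show "Bseq (\<lambda>k. (T ^^ k) f z0)"
    by (rule BseqI'[of _ F]) (use T_pow_bounded[OF assms(2)] in auto)
  show "monoseq (\<lambda>k. (T ^^ k) f z0)"
    using T_pow_incseq[OF assms(1)] by (simp add: mono_def incseq_def monoseq_def)
qed

section \<open>Laws of the chain started empty, their limit and invariant laws\<close>

definition law :: "nat \<Rightarrow> (nat \<Rightarrow> nat) pmf" where "law k = kpow K k z0"

lemma law_Suc: "law (Suc k) = bind_pmf (law k) K"
  by (simp add: law_def kpow_Suc)

lemma set_law: "set_pmf (law k) \<subseteq> states I"
  unfolding law_def by (rule set_kpow[OF set_K_states z0_states])

lemma expect_law: "(\<And>x. \<bar>f x\<bar> \<le> F) \<Longrightarrow> expect (law k) f = (T ^^ k) f z0"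
  unfolding law_def by (rule expect_kpow)

text \<open>
  A singleton is the difference of two upper sets, and the probability of an upper set increases in \<open>k\<close>.
\<close>

lemma pmf_law_convergent: "convergent (\<lambda>k. pmf (law k) y)"
proof (cases "y \<in> states I")
  case False
  then have "pmf (law k) y = 0" for k using set_law by (auto simp: pmf_eq_0_set_pmf)
  then show ?thesis by (simp add: convergent_const)
next
  case True
  define f :: "(nat \<Rightarrow> nat) \<Rightarrow> real" where "f x = of_bool (\<forall>j\<in>I. y j \<le> x j)" for x
  define g :: "(nat \<Rightarrow> nat) \<Rightarrow> real" where "g x = of_bool ((\<forall>j\<in>I. y j \<le> x j) \<and> (\<exists>j\<in>I. y j < x j))" for x
  have b: "\<bar>f x\<bar> \<le> 1" "\<bar>g x\<bar> \<le> 1" for x by (auto simp: f_def g_def)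
  have "increasing_on I f" "increasing_on I g"
    unfolding increasing_on_def f_def g_def of_bool_def
    by (auto split: if_splits) (meson order_trans order_less_le_trans)+
  then have "convergent (\<lambda>k. (T ^^ k) f z0 - (T ^^ k) g z0)"
    using b by (intro convergent_diff T_pow_convergent)
  moreover have "(T ^^ k) f z0 - (T ^^ k) g z0 = pmf (law k) y" for k
  proof -
    have "(T ^^ k) f z0 - (T ^^ k) g z0 = expect (law k) f - expect (law k) g"
      by (simp only: expect_law[of f 1, OF b(1)] expect_law[of g 1, OF b(2)])
    also have "\<dots> = expect (law k) (\<lambda>x. f x - g x)"
      using integrable_pmf_bounded[of f 1] integrable_pmf_bounded[of g 1] b by simp
    also have "\<dots> = expect (law k) (indicator {y})"
    proof (rule expect_eqI)
      fix x assume "x \<in> set_pmf (law k)"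
      then have x: "x \<in> states I" using set_law by blast
      have "x = y" if "\<forall>j\<in>I. y j \<le> x j" "\<not> (\<exists>j\<in>I. y j < x j)"
        using that x True by (intro PiE_ext[of x I _ y]) (auto simp: antisym not_less)
      then show "f x - g x = indicator {y} x" by (auto simp: f_def g_def indicator_def)
    qed
    finally show ?thesis by (simp add: pmf.rep_eq)
  qed
  ultimately show ?thesis by simp
qed

text \<open>Mass may escape to infinity, so this limit is only a subprobability vector and can
  vanish identically.\<close>

definition \<rho> :: "(nat \<Rightarrow> nat) \<Rightarrow> real" where "\<rho> y = lim (\<lambda>k. pmf (law k) y)"

lemma pmf_law_tendsto: "(\<lambda>k. pmf (law k) y) \<longlonglongrightarrow> \<rho> y"
  unfolding \<rho>_def using pmf_law_convergent by (simp add: convergent_LIMSEQ_iff)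

lemma \<rho>_nonneg: "0 \<le> \<rho> y"
  by (rule LIMSEQ_le_const[OF pmf_law_tendsto]) auto

lemma \<rho>_outside: "y \<notin> states I \<Longrightarrow> \<rho> y = 0"
proof -
  assume "y \<notin> states I"
  then have "pmf (law k) y = 0" for k using set_law by (meson pmf_eq_0_set_pmf subsetD)
  then show ?thesis using LIMSEQ_unique[OF pmf_law_tendsto[of y], of 0] by simp
qed

lemma \<rho>_mass_le: "(\<integral>\<^sup>+y. ennreal (\<rho> y) \<partial>count_space UNIV) \<le> 1"
proof -
  have "(\<integral>\<^sup>+y. ennreal (\<rho> y) \<partial>count_space UNIV)
      = (\<integral>\<^sup>+y. liminf (\<lambda>k. ennreal (pmf (law k) y)) \<partial>count_space UNIV)"
    by (intro nn_integral_cong lim_imp_Liminf[symmetric] tendsto_ennrealI pmf_law_tendsto) simp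
  also have "\<dots> \<le> liminf (\<lambda>k. \<integral>\<^sup>+y. ennreal (pmf (law k) y) \<partial>count_space UNIV)"
    by (rule nn_integral_liminf) simp
  also have "\<dots> = 1" by (simp add: nn_integral_pmf' Liminf_const)
  finally show ?thesis .
qed

lemma expect_pmf_K: "expect p (\<lambda>x. pmf (K x) y) = (\<Sum>x\<in>nbh I y. pmf p x * pmf (K x) y)"
proof (subst integral_measure_pmf[of "nbh I y"])
  fix x assume "pmf (K x) y \<noteq> 0"
  then have "y \<in> set_pmf (K x)" by (simp add: set_pmf_iff)
  then show "x \<in> nbh I y" using set_K nbh_sym by blast
qed simp_all

text \<open>Only neighbours lead to \<open>y\<close>, so the balance equation is a finite sum and
  survives the pointwise limit.\<close>

lemma \<rho>_invariant: "(\<Sum>x\<in>nbh I y. \<rho> x * pmf (K x) y) = \<rho> y"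
proof -
  have "(\<lambda>k. \<Sum>x\<in>nbh I y. pmf (law k) x * pmf (K x) y) \<longlonglongrightarrow> (\<Sum>x\<in>nbh I y. \<rho> x * pmf (K x) y)"
    by (intro tendsto_sum tendsto_mult tendsto_const pmf_law_tendsto)
  moreover have "(\<Sum>x\<in>nbh I y. pmf (law k) x * pmf (K x) y) = pmf (law (Suc k)) y" for k
    by (simp add: law_Suc pmf_bind expect_pmf_K)
  moreover have "(\<lambda>k. pmf (law (Suc k)) y) \<longlonglongrightarrow> \<rho> y"
    using pmf_law_tendsto by (rule LIMSEQ_Suc)
  ultimately show ?thesis using LIMSEQ_unique by simp
qed

definition invariant :: "(nat \<Rightarrow> nat) pmf \<Rightarrow> bool" where
  "invariant p \<longleftrightarrow> set_pmf p \<subseteq> states I \<and> bind_pmf p K = p"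

text \<open>Gives the dichotomy: either the limit vanishes everywhere or its normalization is an
  invariant law.\<close>

lemma \<rho>_normalize:
  assumes "\<rho> y0 > 0"
  obtains p m where "invariant p" "0 < m" "m \<le> 1" "\<And>y. \<rho> y = m * pmf p y"
proof -
  define m where "m = enn2real (\<integral>\<^sup>+y. ennreal (\<rho> y) \<partial>count_space UNIV)"
  have m_eq: "ennreal m = (\<integral>\<^sup>+y. ennreal (\<rho> y) \<partial>count_space UNIV)"
    unfolding m_def using \<rho>_mass_le by (intro ennreal_enn2real) (auto simp: top_unique intro: le_less_trans)
  have "ennreal (\<rho> y0) \<le> (\<integral>\<^sup>+y. ennreal (\<rho> y) * indicator {y0} y \<partial>count_space UNIV)"
    by (simp add: nn_integral_indicator_singleton)
  also have "\<dots> \<le> ennreal m" unfolding m_eq by (rule nn_integral_mono) (simp add: indicator_def)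
  finally have m0: "m > 0" using assms by (metis ennreal_le_iff2 less_le_trans not_le)
  have m1: "m \<le> 1" using \<rho>_mass_le m0 by (simp add: m_eq[symmetric])
  define p where "p = embed_pmf (\<lambda>y. \<rho> y / m)"
  have nonneg: "0 \<le> \<rho> y / m" for y using \<rho>_nonneg m0 by simp
  have "(\<integral>\<^sup>+y. ennreal (\<rho> y / m) \<partial>count_space UNIV) = (\<integral>\<^sup>+y. ennreal (\<rho> y) / ennreal m \<partial>count_space UNIV)"
    using \<rho>_nonneg m0 by (simp add: divide_ennreal)
  also have "\<dots> = ennreal m / ennreal m"
    unfolding m_eq by (rule nn_integral_divide) simp
  also have "\<dots> = 1" using m0 by (simp add: ennreal_divide_self)
  finally have prob: "(\<integral>\<^sup>+y. ennreal (\<rho> y / m) \<partial>count_space UNIV) = 1" .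
  have pmf_p: "pmf p y = \<rho> y / m" for y
    unfolding p_def by (rule pmf_embed_pmf[OF nonneg prob])
  have "bind_pmf p K = p"
  proof (rule pmf_eqI)
    fix y
    have "pmf (bind_pmf p K) y = (\<Sum>x\<in>nbh I y. \<rho> x * pmf (K x) y) / m"
      by (simp add: pmf_bind expect_pmf_K pmf_p sum_divide_distrib)
    then show "pmf (bind_pmf p K) y = pmf p y" by (simp add: \<rho>_invariant pmf_p)
  qed
  moreover have "set_pmf p \<subseteq> states I"
  proof
    fix y assume "y \<in> set_pmf p"
    then have "\<rho> y \<noteq> 0" by (auto simp: set_pmf_iff pmf_p)
    then show "y \<in> states I" using \<rho>_outside by blast
  qed
  ultimately show ?thesis using that[of p m] m0 m1 pmf_p by (simp add: invariant_def)
qed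

text \<open>
  The set where one invariant law exceeds another is closed under jumps, in particular under arrivals.
  Points of this set and of the set with the roles exchanged have a common upper bound.
\<close>

lemma invariant_unique:
  assumes p: "invariant p" and q: "invariant q"
  shows "p = q"
proof -
  have closed: "pmf b (x(i := x i + 1)) < pmf a (x(i := x i + 1))"
    if ab: "invariant a" "invariant b" and lt: "pmf b x < pmf a x" and i: "i \<in> I" for a b x i
  proof -
    define A where "A = {x. pmf b x < pmf a x}"
    \<comment> \<open>Both factors change sign exactly at the border of \<open>A\<close>, so
      \<open>?d\<close> is nonnegative, while invariance of \<open>a\<close> and \<open>b\<close>
      makes its integral 0. Hence it vanishes at every point, and at a point of \<open>A\<close>
      this says that \<open>K\<close> cannot leave \<open>A\<close>.\<close>
    let ?d = "\<lambda>x. (pmf a x - pmf b x) * (indicator A x - measure_pmf.prob (K x) A)"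
    have int: "integrable (count_space UNIV) (\<lambda>x. pmf c x * (indicator A x - measure_pmf.prob (K x) A))" for c
      by (rule integrable_count_space_bounded[where F=1]) (auto simp: indicator_def)
    have inv: "(\<integral>x. pmf c x * (indicator A x - measure_pmf.prob (K x) A) \<partial>count_space UNIV) = 0"
      if "invariant c" for c
    proof -
      have "expect c (\<lambda>x. expect (K x) (indicator A)) = expect (bind_pmf c K) (indicator A)"
        by (rule expect_bind[symmetric, where F=1]) (simp add: indicator_def)
      also have "\<dots> = expect c (indicator A)" using that by (simp add: invariant_def)
      finally have "expect c (\<lambda>x. indicator A x - measure_pmf.prob (K x) A) = 0"
        by (subst Bochner_Integration.integral_diff)
           (auto intro!: integrable_pmf_bounded[where F=1] simp: indicator_def)
      then show ?thesis by (simp add: expect_count_space)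
    qed
    have nonneg: "0 \<le> ?d x" for x
    proof (cases "x \<in> A")
      case True
      then show ?thesis by (intro mult_nonneg_nonneg) (auto simp: A_def)
    next
      case False
      then show ?thesis by (intro mult_nonpos_nonpos) (auto simp: A_def)
    qed
    have "integrable (count_space UNIV) ?d" "(\<integral>x. ?d x \<partial>count_space UNIV) = 0"
      using int[of a] int[of b] inv[OF ab(1)] inv[OF ab(2)] by (simp_all add: left_diff_distrib)
    then have "AE x in count_space UNIV. ?d x = 0"
      using nonneg by (subst integral_nonneg_eq_0_iff_AE[symmetric]) auto
    then have "?d x = 0" by (simp add: AE_count_space)
    then have "measure_pmf.prob (K x) A = 1" using lt by (simp add: A_def)
    then have "set_pmf (K x) \<subseteq> A"
      by (subst (asm) measure_pmf.prob_eq_1) (auto simp: AE_measure_pmf_iff)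
    moreover have "x(i := x i + 1) \<in> set_pmf (K x)"
      using pmf_K_up[OF i, of x] lam_pos[OF i] L_pos
      by (auto simp: set_pmf_iff simp del: fun_upd_apply) (smt (verit) divide_pos_pos)
    ultimately show ?thesis by (auto simp: A_def)
  qed
  have False if "pmf b x < pmf a x" "invariant a" "invariant b" for a b x
  proof -
    \<comment> \<open>The total masses agree, so an excess of \<open>a\<close> at one state is
      balanced by an excess of \<open>b\<close> at another.\<close>
    have "\<exists>y. pmf a y < pmf b y"
    proof (rule ccontr)
      assume "\<not> ?thesis"
      then have "pmf b y \<le> pmf a y" for y by (simp add: not_less)
      moreover have "(\<integral>y. pmf a y - pmf b y \<partial>count_space UNIV) = 0"
        by (simp add: integral_pmf integrable_pmf)
      ultimately have "AE y in count_space UNIV. pmf a y - pmf b y = 0"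
        by (subst integral_nonneg_eq_0_iff_AE[symmetric]) (auto simp: integrable_pmf)
      then show False using that(1) by (auto simp: AE_count_space)
    qed
    then obtain y where y: "pmf a y < pmf b y" ..
    have "0 < pmf a x" "0 < pmf b y"
      using that(1) y pmf_nonneg[of b x] pmf_nonneg[of a y] by linarith+
    then have "x \<in> set_pmf a" "y \<in> set_pmf b" by (simp_all add: set_pmf_iff)
    then have "x \<in> states I" "y \<in> states I" using that by (auto simp only: invariant_def)
    moreover define z where "z = restrict (\<lambda>i. max (x i) (y i)) I"
    ultimately have "pmf b z < pmf a z" "pmf a z < pmf b z"
      using up_induct[OF fin, of x z "\<lambda>z. pmf b z < pmf a z"] up_induct[OF fin, of y z "\<lambda>z. pmf a z < pmf b z"]
        closed[OF that(2,3)] closed[OF that(3,2)] that(1) y by (auto simp: z_def)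
    then show False by simp
  qed
  then show ?thesis using p q by (intro pmf_eqI) (meson linorder_neqE)
qed

text \<open>The chain started empty lies below the chain started from \<open>p\<close>, for which
  the mean of \<open>f\<close> does not change with time.\<close>

lemma expect_law_le:
  assumes "increasing_on I f" "\<And>x. \<bar>f x\<bar> \<le> F" "invariant p"
  shows "(T ^^ k) f z0 \<le> expect p f"
proof -
  have "expect p (\<lambda>_. (T ^^ k) f z0) \<le> expect p ((T ^^ k) f)"
  proof (rule expect_mono)
    show "\<bar>(T ^^ k) f z0\<bar> \<le> F" "\<bar>(T ^^ k) f x\<bar> \<le> F" for x using assms(2) by (auto intro: T_pow_bounded)
    show "(T ^^ k) f z0 \<le> (T ^^ k) f x" for x
      by (rule increasing_onD[OF T_pow_increasing[OF assms(1)]]) (rule z0_le)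
  qed
  then show ?thesis using expect_invariant[OF _ assms(2)] assms(3) by (simp add: invariant_def)
qed

text \<open>Tightness of the laws: the bound by the invariant law is uniform in
  \<open>k\<close>.\<close>

lemma prob_law_outside_box:
  assumes "invariant p"
  shows "measure_pmf.prob (law k) (- downbox I m) \<le> measure_pmf.prob p (- downbox I m)"
proof -
  have "(T ^^ k) (indicator (- downbox I m)) z0 \<le> expect p (indicator (- downbox I m))"
    by (rule expect_law_le[where F=1]) (use assms increasing_on_outside_box in \<open>auto simp: indicator_def\<close>)
  moreover have "expect (law k) (indicator (- downbox I m)) = (T ^^ k) (indicator (- downbox I m)) z0"
    by (rule expect_law[where F=1]) (auto simp: indicator_def)
  ultimately show ?thesis by simp
qed

lemma prob_box_sum:
  assumes "set_pmf p \<subseteq> states I"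
  shows "measure_pmf.prob p (downbox I m) = (\<Sum>x\<in>states I \<inter> downbox I m. pmf p x)"
proof -
  have "measure_pmf.prob p (downbox I m) = measure_pmf.prob p (states I \<inter> downbox I m)"
    by (rule measure_prob_cong_0) (use assms in \<open>auto simp: set_pmf_iff\<close>)
  then show ?thesis by (simp add: measure_measure_pmf_finite finite_states_box fin)
qed

text \<open>Domination by \<open>p\<close> keeps the laws tight, so some mass stays in a box and the
  limit is not zero. By uniqueness it is a multiple of \<open>p\<close>.\<close>

lemma \<rho>_eq_invariant:
  assumes p: "invariant p"
  shows "\<rho> y = pmf p y"
proof -
  have le: "measure_pmf.prob p (downbox I m) \<le> (\<Sum>x\<in>states I \<inter> downbox I m. \<rho> x)" for m
  proof (rule LIMSEQ_le_const)
    show "(\<lambda>k. \<Sum>x\<in>states I \<inter> downbox I m. pmf (law k) x) \<longlonglongrightarrow> (\<Sum>x\<in>states I \<inter> downbox I m. \<rho> x)"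
      by (intro tendsto_sum pmf_law_tendsto)
    have "measure_pmf.prob p (downbox I m) \<le> (\<Sum>x\<in>states I \<inter> downbox I m. pmf (law k) x)" for k
    proof -
      have "1 - measure_pmf.prob p (- downbox I m) \<le> 1 - measure_pmf.prob (law k) (- downbox I m)"
        using prob_law_outside_box[OF p] by simp
      then show ?thesis
        using measure_pmf.prob_compl[of "downbox I m" p] measure_pmf.prob_compl[of "downbox I m" "law k"]
          prob_box_sum[OF set_law] by (simp add: Compl_eq_Diff_UNIV)
    qed
    then show "\<exists>N. \<forall>k\<ge>N. measure_pmf.prob p (downbox I m) \<le> (\<Sum>x\<in>states I \<inter> downbox I m. pmf (law k) x)" by blast
  qed
  obtain m where "measure_pmf.prob p (- downbox I m) < 1" using prob_box_ge[OF fin, of 1] by auto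
  then have pos: "0 < measure_pmf.prob p (downbox I m)"
    using measure_pmf.prob_compl[of "downbox I m" p] by (simp add: Compl_eq_Diff_UNIV)
  then have "0 < (\<Sum>x\<in>states I \<inter> downbox I m. \<rho> x)" using le by (rule less_le_trans)
  then obtain y0 where "\<rho> y0 > 0" by (meson \<rho>_nonneg not_le sum_nonpos)
  then obtain p' c where p': "invariant p'" "0 < c" "c \<le> 1" "\<And>y. \<rho> y = c * pmf p' y"
    by (rule \<rho>_normalize) blast
  have "p' = p" using p' p by (blast intro: invariant_unique)
  with p' have eq: "\<rho> y = c * pmf p y" for y by simp
  \<comment> \<open>A box of positive probability under \<open>p\<close> loses no mass in the limit,
    which excludes \<open>c < 1\<close>.\<close>
  have "measure_pmf.prob p (downbox I m) \<le> c * measure_pmf.prob p (downbox I m)"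
    using le[of m] p by (simp add: eq sum_distrib_left[symmetric] prob_box_sum invariant_def)
  then have "c = 1" using pos p' by (simp add: mult_le_cancel_right1)
  then show ?thesis by (simp add: eq)
qed

text \<open>Pointwise convergence controls a finite box, and tightness controls the rest:
  \<open>e / 4\<close> for the box and \<open>e / 4\<close> for each of the two tails.\<close>

lemma expect_law_tendsto:
  assumes p: "invariant p" and F: "\<And>x. \<bar>f x\<bar> \<le> F"
  shows "(\<lambda>k. (T ^^ k) f z0) \<longlonglongrightarrow> expect p f"
proof (rule LIMSEQ_I)
  fix e :: real assume e: "e > 0"
  have F0: "F \<ge> 0" using F[of undefined] by linarith
  \<comment> \<open>The summand 1 keeps the denominator positive when \<open>F = 0\<close>.\<close>
  obtain m where m: "measure_pmf.prob p (- downbox I m) < e / (4 * (F + 1))"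
    using prob_box_ge[OF fin, of "e / (4 * (F + 1))" p] e F0 by auto
  let ?D = "states I \<inter> downbox I m"
  have split: "\<bar>expect q f - (\<Sum>x\<in>?D. f x * pmf q x)\<bar> \<le> F * measure_pmf.prob q (- downbox I m)"
    if q: "set_pmf q \<subseteq> states I" for q
  proof -
    have "(\<Sum>x\<in>?D. f x * pmf q x) = expect q (\<lambda>x. f x * indicator ?D x)"
    proof -
      have "finite ?D" using fin by (rule finite_states_box)
      then have "expect q (\<lambda>x. f x * indicator ?D x) = (\<Sum>x\<in>?D. pmf q x * (f x * indicator ?D x))"
        by (subst integral_measure_pmf[of ?D]) (simp_all add: indicator_def split: if_splits)
      also have "\<dots> = (\<Sum>x\<in>?D. f x * pmf q x)"
        by (rule sum.cong) (simp_all add: indicator_def)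
      finally show ?thesis ..
    qed
    then have "expect q f - (\<Sum>x\<in>?D. f x * pmf q x) = expect q (\<lambda>x. f x - f x * indicator ?D x)"
      by (subst Bochner_Integration.integral_diff)
         (use F F0 in \<open>auto intro!: integrable_pmf_bounded[where F=F] simp: indicator_def\<close>)
    also have "\<dots> = expect q (\<lambda>x. f x * indicator (- downbox I m) x)"
      by (rule expect_eqI) (use q in \<open>auto simp: indicator_def\<close>)
    also have "\<bar>\<dots>\<bar> \<le> expect q (\<lambda>x. \<bar>f x * indicator (- downbox I m) x\<bar>)"
      by (rule integral_abs_bound)
    also have "\<dots> \<le> expect q (\<lambda>x. F * indicator (- downbox I m) x)"
      by (rule expect_mono[where F=F and G=F]) (use F F0 in \<open>auto simp: indicator_def\<close>)
    finally show ?thesis by simp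
  qed
  have Fe: "F * (e / (4 * (F + 1))) \<le> e / 4" using F0 e by (simp add: field_simps)
  have tail: "F * measure_pmf.prob p (- downbox I m) \<le> e / 4"
    using mult_left_mono[OF less_imp_le[OF m] F0] Fe by linarith
  have tail': "F * measure_pmf.prob (law k) (- downbox I m) \<le> e / 4" for k
    using mult_left_mono[OF prob_law_outside_box[OF p] F0, of k m] tail by linarith
  have "(\<lambda>k. \<Sum>x\<in>?D. f x * pmf (law k) x) \<longlonglongrightarrow> (\<Sum>x\<in>?D. f x * pmf p x)"
    using pmf_law_tendsto \<rho>_eq_invariant[OF p] by (intro tendsto_sum tendsto_mult tendsto_const) simp
  from LIMSEQ_D[OF this, of "e / 4"] e obtain k0 where k0: "\<And>k. k \<ge> k0 \<Longrightarrow>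
      \<bar>(\<Sum>x\<in>?D. f x * pmf (law k) x) - (\<Sum>x\<in>?D. f x * pmf p x)\<bar> < e / 4"
    by auto
  have "\<bar>(T ^^ k) f z0 - expect p f\<bar> < e" if "k \<ge> k0" for k
  proof -
    have "set_pmf p \<subseteq> states I" using p by (simp add: invariant_def)
    moreover have "(T ^^ k) f z0 = expect (law k) f" by (rule expect_law[symmetric]) (rule F)
    ultimately show ?thesis
      using k0[OF that] split[OF set_law, of k] split[of p] tail tail'[of k] by linarith
  qed
  then show "\<exists>k0. \<forall>k\<ge>k0. norm ((T ^^ k) f z0 - expect p f) < e" by auto
qed

lemma stationary_iff_invariant:
  "stationary_distribution (states I) (queue_rate I lam \<psi>) p \<longleftrightarrow> invariant p"
  unfolding invariant_def by (rule stationary_distribution_iff[OF uniformized_queue])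

end

section \<open>Lower partial limits\<close>

text \<open>A representative of the states with prescribed first \<open>n\<close> coordinates and
  large remaining ones; along it the lower partial limit becomes a limit of values.\<close>

definition pad :: "nat \<Rightarrow> nat \<Rightarrow> nat \<Rightarrow> (nat \<Rightarrow> nat) \<Rightarrow> nat \<Rightarrow> nat" where
  "pad N n r x = restrict (\<lambda>j. if j \<le> n then x j else r) {1..N}"

lemma pad_states: "pad N n r x \<in> states {1..N}"
  by (simp add: pad_def)

lemma lower_partial_limit_cong:
  "(\<And>j. j \<in> {1..n} \<Longrightarrow> x j = y j) \<Longrightarrow> lower_partial_limit N n f x = lower_partial_limit N n f y"
  unfolding lower_partial_limit_def by (simp cong: conj_cong)

lemma SUP_ereal_limD:
  assumes "(\<lambda>r::nat. SUP x\<in>A r. ereal (h x)) \<longlonglongrightarrow> 0" "e > 0"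
  obtains r where "\<And>x. x \<in> A r \<Longrightarrow> h x \<le> e"
proof -
  have "\<forall>\<^sub>F r in sequentially. (SUP x\<in>A r. ereal (h x)) < ereal e"
    using assms by (intro order_tendstoD) auto
  then obtain r where r: "(SUP x\<in>A r. ereal (h x)) < ereal e" by (auto simp: eventually_sequentially)
  have "h x \<le> e" if "x \<in> A r" for x
  proof -
    have "ereal (h x) \<le> (SUP x\<in>A r. ereal (h x))" using that by (rule SUP_upper)
    also note r
    finally show ?thesis by simp
  qed
  then show ?thesis by (rule that)
qed

text \<open>One form for both clauses: the constant limit is the case \<open>n = 0\<close>, and the
  identity permutation gives the other cases.\<close>

lemma uniform_limitsE:
  assumes "uniform_limits_at_infinity N f" "n < N"
  obtains g :: "(nat \<Rightarrow> nat) \<Rightarrow> real" where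
    "\<And>e. e > 0 \<Longrightarrow> \<exists>r. \<forall>x\<in>states {1..N}. (\<forall>j\<in>{n+1..N}. r < x j) \<longrightarrow> \<bar>f x - g (restrict x {1..n})\<bar> \<le> e"
proof (cases "n = 0")
  case True
  obtain c where c: "(\<lambda>r::nat. SUP x\<in>{x \<in> states {1..N}. \<forall>j\<in>{1..N}. x j > r}. ereal \<bar>f x - c\<bar>) \<longlonglongrightarrow> 0"
    using assms unfolding uniform_limits_at_infinity_def by blast
  have "\<exists>r. \<forall>x\<in>states {1..N}. (\<forall>j\<in>{n+1..N}. r < x j) \<longrightarrow> \<bar>f x - c\<bar> \<le> e" if "e > 0" for e
    by (rule SUP_ereal_limD[OF c that]) (use True in auto)
  then show ?thesis by (rule that)
next
  case False
  then have "n \<in> {1..<N}" using assms by auto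
  moreover have "id permutes {1..N}" by (rule permutes_id)
  ultimately obtain g where g: "(\<lambda>r::nat. SUP x\<in>{x \<in> states {1..N}. \<forall>j\<in>{n+1..N}. x (id j) > r}.
      ereal \<bar>f x - g (\<lambda>j\<in>{1..n}. x (id j))\<bar>) \<longlonglongrightarrow> 0"
    using assms(1) unfolding uniform_limits_at_infinity_def by blast
  have "\<exists>r. \<forall>x\<in>states {1..N}. (\<forall>j\<in>{n+1..N}. r < x j) \<longrightarrow> \<bar>f x - g (restrict x {1..n})\<bar> \<le> e" if e: "e > 0" for e
  proof -
    obtain r where "\<And>x. x \<in> {x \<in> states {1..N}. \<forall>j\<in>{n+1..N}. x (id j) > r} \<Longrightarrow> \<bar>f x - g (\<lambda>j\<in>{1..n}. x (id j))\<bar> \<le> e"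
      using SUP_ereal_limD[OF g e] by blast
    then show ?thesis by (intro exI[of _ r]) simp
  qed
  then show ?thesis by (rule that)
qed

text \<open>Far out all values of \<open>f\<close> with the same first \<open>n\<close> coordinates
  are close to \<open>g\<close>, hence so is their infimum. The lower partial limit therefore equals
  \<open>g\<close> and inherits its uniformity.\<close>

lemma lower_partial_limit_uniform:
  assumes unif: "uniform_limits_at_infinity N f" and n: "n < N" and e: "e > 0"
  obtains r where "\<And>x. x \<in> states {1..N} \<Longrightarrow> (\<And>j. j \<in> {n+1..N} \<Longrightarrow> r < x j) \<Longrightarrow>
    \<bar>f x - lower_partial_limit N n f x\<bar> \<le> e"
proof -
  obtain g :: "(nat \<Rightarrow> nat) \<Rightarrow> real" where
    g: "\<And>e. e > 0 \<Longrightarrow> \<exists>r. \<forall>x\<in>states {1..N}. (\<forall>j\<in>{n+1..N}. r < x j) \<longrightarrow> \<bar>f x - g (restrict x {1..n})\<bar> \<le> e"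
    using uniform_limitsE[OF unif n] by blast
  have "lower_partial_limit N n f x = g (restrict x {1..n})" for x
    unfolding lower_partial_limit_def
  proof (rule limI, rule LIMSEQ_I)
    fix e :: real assume "e > 0"
    then obtain r where r: "\<And>y. y \<in> states {1..N} \<Longrightarrow> (\<forall>j\<in>{n+1..N}. r < y j) \<Longrightarrow> \<bar>f y - g (restrict y {1..n})\<bar> \<le> e / 2"
      using g[of "e / 2"] by auto
    have "norm ((INF y\<in>{y \<in> states {1..N}. (\<forall>j\<in>{1..n}. y j = x j) \<and> (\<forall>j\<in>{n+1..N}. y j > s)}. f y) - g (restrict x {1..n})) < e"
      if s: "s \<ge> r" for s
    proof -
      let ?A = "{y \<in> states {1..N}. (\<forall>j\<in>{1..n}. y j = x j) \<and> (\<forall>j\<in>{n+1..N}. y j > s)}"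
      \<comment> \<open>An infimum of reals is meaningful only over a nonempty set bounded below;
        this point gives nonemptiness and also the upper bound.\<close>
      have ne: "pad N n (Suc s) x \<in> ?A" using n by (auto simp: pad_def)
      have "\<bar>f y - g (restrict x {1..n})\<bar> \<le> e / 2" if y: "y \<in> ?A" for y
      proof -
        have "restrict y {1..n} = restrict x {1..n}" using y by (intro restrict_ext) auto
        moreover have "\<forall>j\<in>{n+1..N}. r < y j"
        proof
          fix j assume "j \<in> {n+1..N}"
          then have "s < y j" using y by blast
          then show "r < y j" using s by simp
        qed
        moreover have "y \<in> states {1..N}" using y by blast
        ultimately show ?thesis using r[of y] by simp
      qed
      then have b: "g (restrict x {1..n}) - e / 2 \<le> f y" "f y \<le> g (restrict x {1..n}) + e / 2" if "y \<in> ?A" for y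
        using that unfolding abs_le_iff by (smt (verit))+
      have "g (restrict x {1..n}) - e / 2 \<le> (INF y\<in>?A. f y)"
        by (rule cINF_greatest) (use ne b in blast)+
      moreover have "(INF y\<in>?A. f y) \<le> f (pad N n (Suc s) x)"
        by (rule cINF_lower[OF bdd_belowI2 ne]) (use b in blast)
      ultimately show ?thesis using b(2)[OF ne] \<open>e > 0\<close> by (simp add: abs_less_iff)
    qed
    then show "\<exists>r. \<forall>s\<ge>r. norm ((INF y\<in>{y \<in> states {1..N}. (\<forall>j\<in>{1..n}. y j = x j) \<and> (\<forall>j\<in>{n+1..N}. y j > s)}. f y) - g (restrict x {1..n})) < e"
      by blast
  qed
  moreover obtain r where "\<forall>x\<in>states {1..N}. (\<forall>j\<in>{n+1..N}. r < x j) \<longrightarrow> \<bar>f x - g (restrict x {1..n})\<bar> \<le> e"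
    using g[OF e] by blast
  ultimately have "\<bar>f x - lower_partial_limit N n f x\<bar> \<le> e"
    if "x \<in> states {1..N}" "\<And>j. j \<in> {n+1..N} \<Longrightarrow> r < x j" for x
    using that by metis
  then show ?thesis by (rule that)
qed

text \<open>Transfers bounds and inequalities from \<open>\<phi>\<close> to its lower partial
  limits.\<close>

lemma lower_partial_limit_tendsto:
  assumes "uniform_limits_at_infinity N f" "n < N"
  shows "(\<lambda>r. f (pad N n r x)) \<longlonglongrightarrow> lower_partial_limit N n f x"
proof (rule LIMSEQ_I)
  fix e :: real assume "e > 0"
  then obtain r where r: "\<And>x. x \<in> states {1..N} \<Longrightarrow> (\<And>j. j \<in> {n+1..N} \<Longrightarrow> r < x j) \<Longrightarrow>
    \<bar>f x - lower_partial_limit N n f x\<bar> \<le> e / 2"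
    using lower_partial_limit_uniform[OF assms, of "e / 2"] by auto
  have "norm (f (pad N n s x) - lower_partial_limit N n f x) < e" if "s \<ge> Suc r" for s
  proof -
    have "lower_partial_limit N n f (pad N n s x) = lower_partial_limit N n f x"
      by (rule lower_partial_limit_cong) (use assms in \<open>auto simp: pad_def\<close>)
    moreover have "\<bar>f (pad N n s x) - lower_partial_limit N n f (pad N n s x)\<bar> \<le> e / 2"
      by (rule r[OF pad_states]) (use that in \<open>auto simp: pad_def\<close>)
    ultimately show ?thesis using \<open>e > 0\<close> by simp
  qed
  then show "\<exists>r. \<forall>s\<ge>r. norm (f (pad N n s x) - lower_partial_limit N n f x) < e" by blast
qed

section \<open>The network, its limit chains and their invariant laws\<close>

locale queue_network =
  fixes N :: nat and lam :: "nat \<Rightarrow> real" and \<phi> :: "nat \<Rightarrow> (nat \<Rightarrow> nat) \<Rightarrow> real" and B :: real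
  assumes lam_pos: "i \<in> {1..N} \<Longrightarrow> 0 < lam i"
    and \<phi>_nonneg: "i \<in> {1..N} \<Longrightarrow> x \<in> states {1..N} \<Longrightarrow> 0 \<le> \<phi> i x"
    and \<phi>_le: "i \<in> {1..N} \<Longrightarrow> x \<in> states {1..N} \<Longrightarrow> \<phi> i x \<le> B"
    and decr: "partially_decreasing N \<phi>"
    and unif: "i \<in> {1..N} \<Longrightarrow> uniform_limits_at_infinity N (\<phi> i)"
    and B_nonneg: "0 \<le> B"
begin

declare One_nat_def [simp del]

text \<open>One rate serves \<open>X\<close> and all limit chains, so that their steps can be
  compared. The summand 1 makes it positive even if the sum is empty.\<close>

definition L :: real where "L = (\<Sum>i\<in>{1..N}. lam i + B) + 1"

lemma L_pos: "0 < L"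
  unfolding L_def using lam_pos B_nonneg by (intro add_nonneg_pos sum_nonneg) (auto intro: less_imp_le add_nonneg_nonneg)

lemma L_ge:
  assumes "n \<le> N"
  shows "(\<Sum>i\<in>{1..n}. lam i + B) \<le> L"
proof -
  have "(\<Sum>i\<in>{1..n}. lam i + B) \<le> (\<Sum>i\<in>{1..N}. lam i + B)"
    by (rule sum_mono2) (use assms lam_pos B_nonneg in \<open>auto intro: less_imp_le add_nonneg_nonneg\<close>)
  then show ?thesis by (simp add: L_def)
qed

text \<open>The allocation extended from states to all functions, as the bounds of
  \<open>queue_chain\<close> require.\<close>

definition \<Phi> :: "nat \<Rightarrow> (nat \<Rightarrow> nat) \<Rightarrow> real" where "\<Phi> i x = \<phi> i (restrict x {1..N})"

definition \<psi> :: "nat \<Rightarrow> nat \<Rightarrow> (nat \<Rightarrow> nat) \<Rightarrow> real" where "\<psi> n i = lower_partial_limit N n (\<phi> i)"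

lemma \<psi>_tendsto: "i \<in> {1..N} \<Longrightarrow> n < N \<Longrightarrow> (\<lambda>r. \<phi> i (pad N n r x)) \<longlonglongrightarrow> \<psi> n i x"
  unfolding \<psi>_def by (rule lower_partial_limit_tendsto[OF unif])

lemma \<psi>_cong: "(\<And>j. j \<in> {1..n} \<Longrightarrow> x j = y j) \<Longrightarrow> \<psi> n i x = \<psi> n i y"
  unfolding \<psi>_def by (rule lower_partial_limit_cong)

lemma \<psi>_nonneg: "i \<in> {1..N} \<Longrightarrow> n < N \<Longrightarrow> 0 \<le> \<psi> n i x"
  using \<phi>_nonneg[OF _ pad_states] by (blast intro: LIMSEQ_le_const[OF \<psi>_tendsto])

lemma \<psi>_le: "i \<in> {1..N} \<Longrightarrow> n < N \<Longrightarrow> \<psi> n i x \<le> B"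
  using \<phi>_le[OF _ pad_states] by (blast intro: LIMSEQ_le_const2[OF \<psi>_tendsto])

lemma \<psi>_bounded: "i \<in> {1..N} \<Longrightarrow> n < N \<Longrightarrow> \<bar>\<psi> n i x\<bar> \<le> B"
  using \<psi>_nonneg[of i n x] \<psi>_le[of i n x] by simp

text \<open>Partial decrease applies to the padded states as soon as \<open>r\<close> exceeds
  \<open>x\<close>: the coordinates between \<open>m\<close> and \<open>n\<close> are raised to
  \<open>r\<close>, and coordinate \<open>i\<close> agrees, either by hypothesis or because it is
  \<open>r\<close> in both. The case \<open>m = n\<close> gives attractiveness, \<open>m < n\<close>
  compares different limit chains, and \<open>i > n\<close> treats the queues outside the
  chain.\<close>

lemma \<psi>_anti:
  assumes mn: "m \<le> n" "n < N" and i: "i \<in> {1..N}" and le: "\<And>j. j \<in> {1..m} \<Longrightarrow> x j \<le> y j"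
    and eq: "i \<in> {1..m} \<and> x i = y i \<or> i \<in> {n+1..N}"
  shows "\<psi> m i y \<le> \<psi> n i x"
proof (rule LIMSEQ_le)
  show "(\<lambda>r. \<phi> i (pad N m r y)) \<longlonglongrightarrow> \<psi> m i y" "(\<lambda>r. \<phi> i (pad N n r x)) \<longlonglongrightarrow> \<psi> n i x"
    using \<psi>_tendsto mn i by auto
  have "\<phi> i (pad N m r y) \<le> \<phi> i (pad N n r x)" if r: "r \<ge> (\<Sum>j\<in>{1..n}. x j)" for r
  proof -
    have xr: "x j \<le> r" if "j \<in> {1..n}" for j
    proof -
      have "x j \<le> (\<Sum>j\<in>{1..n}. x j)" using that by (intro member_le_sum) auto
      with r show ?thesis by simp
    qed
    have "pad N n r x j \<le> pad N m r y j" if "j \<in> {1..N}" for j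
      using le[of j] xr[of j] that mn by (auto simp: pad_def)
    moreover have "pad N n r x i = pad N m r y i"
      using eq mn by (auto simp: pad_def)
    ultimately show ?thesis
      using decr[unfolded partially_decreasing_def, rule_format, OF i pad_states pad_states] by simp
  qed
  then show "\<exists>r0. \<forall>r\<ge>r0. \<phi> i (pad N m r y) \<le> \<phi> i (pad N n r x)" by blast
qed

lemma full_chain: "queue_chain {1..N} lam \<Phi> B L"
proof
  fix i x assume "i \<in> {1..N}"
  moreover have "restrict x {1..N} \<in> states {1..N}" by simp
  ultimately show "0 < lam i" "0 \<le> \<Phi> i x" "\<Phi> i x \<le> B"
    unfolding \<Phi>_def by (blast intro: lam_pos \<phi>_nonneg \<phi>_le)+
qed (use L_pos L_ge[of N] in simp_all)

lemma limit_chain: "n < N \<Longrightarrow> attractive_chain {1..n} lam (\<psi> n) B L"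
proof (intro attractive_chain.intro attractive_chain_axioms.intro)
  assume n: "n < N"
  then have iN: "i \<in> {1..N}" if "i \<in> {1..n}" for i using that by simp
  show "queue_chain {1..n} lam (\<psi> n) B L"
  proof
    fix i x assume "i \<in> {1..n}"
    then show "0 < lam i" "0 \<le> \<psi> n i x" "\<psi> n i x \<le> B"
      using iN lam_pos \<psi>_nonneg \<psi>_le n by simp_all
  qed (use L_pos L_ge[of n] n in simp_all)
  fix i and x y :: "nat \<Rightarrow> nat"
  assume "i \<in> {1..n}" "\<And>j. j \<in> {1..n} \<Longrightarrow> x j \<le> y j" "x i = y i"
  then show "\<psi> n i y \<le> \<psi> n i x" using n iN by (intro \<psi>_anti) simp_all
qed

abbreviation "limit_invariant n \<equiv> attractive_chain.invariant {1..n} lam (\<psi> n) L"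

lemma limiting_service_rate_eq:
  assumes n: "n < N" and i: "i \<in> {1..N}" and p: "limit_invariant n p"
  shows "limiting_service_rate N lam \<phi> n i = expect p (\<psi> n i)"
proof -
  interpret Y: attractive_chain "{1..n}" lam "\<psi> n" B L using n by (rule limit_chain)
  have pS: "set_pmf p \<subseteq> states {1..n}" using p by (simp add: Y.invariant_def)
  show ?thesis
  proof (cases "n = 0")
    case True
    \<comment> \<open>The only state over an empty index set is the function that
      \<open>limiting_service_rate\<close> uses as argument when \<open>n = 0\<close>.\<close>
    then have "set_pmf p = {\<lambda>_. undefined}" using pS set_pmf_not_empty[of p] by auto
    then have "p = return_pmf (\<lambda>_. undefined)" by (simp add: set_pmf_subset_singleton[symmetric])
    then show ?thesis using True by (simp add: limiting_service_rate_def \<psi>_def Let_def)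
  next
    case False
    let ?st = "stationary_distribution (states {1..n}) (queue_rate {1..n} lam (\<psi> n))"
    have st: "?st = Y.invariant" by (rule ext) (rule Y.stationary_iff_invariant)
    have ex1: "\<exists>!\<pi>. Y.invariant \<pi>" using p Y.invariant_unique by blast
    then have the: "(THE \<pi>. Y.invariant \<pi>) = p" using p by (rule the1_equality)
    have "limiting_service_rate N lam \<phi> n i = (\<Sum>\<^sub>\<infinity>x\<in>states {1..n}. \<psi> n i x * pmf p x)"
      using False ex1 unfolding limiting_service_rate_def Let_def \<psi>_def[symmetric] st the by simp
    also have "\<dots> = expect p (\<psi> n i)"
    proof (cases "i \<in> {1..N}")
      case True
      let ?h = "\<lambda>x. pmf p x * \<psi> n i x"
      have "Infinite_Set_Sum.abs_summable_on ?h UNIV"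
        unfolding abs_summable_on_def by (rule integrable_count_space_bounded) (rule \<psi>_bounded[OF True n])
      then have "infsetsum ?h (states {1..n}) = infsum ?h (states {1..n})"
        by (intro infsetsum_infsum) (rule abs_summable_on_subset, auto)
      moreover have "infsetsum ?h UNIV = infsetsum ?h (states {1..n})"
        by (rule infsetsum_cong_neutral) (use pS in \<open>auto simp: set_pmf_iff\<close>)
      ultimately show ?thesis by (simp add: pmf_expectation_eq_infsetsum mult.commute)
    qed (use i in blast)
    finally show ?thesis .
  qed
qed

lemma limit_invariant_0:
  assumes "0 < N"
  shows "limit_invariant 0 (return_pmf (\<lambda>_. undefined))"
proof -
  interpret Y: attractive_chain "{1..0}" lam "\<psi> 0" B L using assms by (rule limit_chain)
  have "Y.K x = return_pmf x" for x
    using Y.set_K[of x] by (simp add: nbh_def set_pmf_subset_singleton)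
  then have "bind_pmf (return_pmf (\<lambda>_. undefined)) Y.K = return_pmf (\<lambda>_. undefined)"
    by (simp add: bind_return_pmf)
  moreover have "set_pmf (return_pmf (\<lambda>_. undefined)) \<subseteq> states {1..0}" by simp
  ultimately show ?thesis unfolding Y.invariant_def by blast
qed

text \<open>For \<open>n > 0\<close> the default value 0 without a unique stationary distribution
  turns positivity into a proof of existence.\<close>

lemma limiting_service_rate_posD:
  assumes n: "n < N" and pos: "0 < limiting_service_rate N lam \<phi> n i"
  obtains p where "limit_invariant n p"
proof (cases "n = 0")
  case True
  then show ?thesis using limit_invariant_0 n that by blast
next
  case False
  interpret Y: attractive_chain "{1..n}" lam "\<psi> n" B L using n by (rule limit_chain)
  have "\<exists>\<pi>. stationary_distribution (states {1..n}) (queue_rate {1..n} lam (\<psi> n)) \<pi>"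
    using pos False unfolding limiting_service_rate_def Let_def \<psi>_def[symmetric]
    by (auto split: if_splits)
  then show ?thesis using that Y.stationary_iff_invariant by blast
qed

text \<open>Without an invariant law the chain \<open>Z\<close> on \<open>n + 1\<close> queues
  leaves every finite set. The first \<open>n\<close> queues stay tight, so the last one is rarely
  short, and its mean length eventually drops by a fixed amount per step although it is
  nonnegative.\<close>

lemma limit_invariant_Suc:
  assumes n: "Suc n < N" and p: "limit_invariant n p" and drift: "lam (Suc n) < expect p (\<psi> n (Suc n))"
  shows "\<exists>q. limit_invariant (Suc n) q"
proof (rule ccontr)
  assume none: "\<nexists>q. limit_invariant (Suc n) q"
  have n': "n < N" using n by simp
  interpret Y: attractive_chain "{1..n}" lam "\<psi> n" B L using n' by (rule limit_chain)
  interpret Z: attractive_chain "{1..Suc n}" lam "\<psi> (Suc n)" B L using n by (rule limit_chain)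
  have \<rho>0: "Z.\<rho> y = 0" for y
    using Z.\<rho>_normalize[of y] none Z.\<rho>_nonneg[of y] by (metis less_eq_real_def)
  let ?f = "\<psi> n (Suc n)"
  have iN: "Suc n \<in> {1..N}" using n by auto
  \<comment> \<open>A third of the gap: one third pays for the approximation in \<open>near\<close>,
    one for the times when the queue is short, and one remains as drift.\<close>
  define d where "d = (expect p ?f - lam (Suc n)) / 3"
  have d: "d > 0" using drift by (simp add: d_def)
  obtain r where r: "\<And>x. x \<in> states {1..N} \<Longrightarrow> (\<And>j. j \<in> {n+1..N} \<Longrightarrow> r < x j) \<Longrightarrow>
      \<bar>\<phi> (Suc n) x - ?f x\<bar> \<le> d"
    using lower_partial_limit_uniform[OF unif[OF iN] n' d] unfolding \<psi>_def by blast
  \<comment> \<open>Only queue \<open>n + 1\<close> has to be long here, since the queues beyond it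
    are sent to infinity in the limit defining \<open>\<psi> (Suc n)\<close>.\<close>
  have near: "?f x - d \<le> \<psi> (Suc n) (Suc n) x" if x: "r < x (Suc n)" for x
  proof (rule LIMSEQ_le_const[OF \<psi>_tendsto[OF iN n]])
    have "?f x - d \<le> \<phi> (Suc n) (pad N (Suc n) s x)" if s: "s \<ge> Suc r" for s
    proof -
      have "?f (pad N (Suc n) s x) = ?f x"
        by (rule \<psi>_cong) (use n in \<open>auto simp: pad_def\<close>)
      moreover have "\<bar>\<phi> (Suc n) (pad N (Suc n) s x) - ?f (pad N (Suc n) s x)\<bar> \<le> d"
      proof (rule r[OF pad_states])
        fix j assume "j \<in> {n+1..N}"
        then show "r < pad N (Suc n) s x j" using x s by (cases "j = Suc n") (auto simp: pad_def)
      qed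
      ultimately show ?thesis by (simp add: abs_le_iff)
    qed
    then show "\<exists>s0. \<forall>s\<ge>s0. ?f x - d \<le> \<phi> (Suc n) (pad N (Suc n) s x)" by blast
  qed
  define v where "v x = real (x (Suc n))" for x :: "nat \<Rightarrow> nat"
  define g :: "(nat \<Rightarrow> nat) \<Rightarrow> real" where "g x = of_bool (x (Suc n) \<le> r)" for x
  have Tv: "Z.T v x \<le> v x + ((lam (Suc n) + d) / L + ((- 1 / L) * ?f x + (B / L) * g x))" for x
  proof -
    have "(\<Sum>i\<in>{1..Suc n}. lam i * (v (x(i := x i + 1)) - v x) + \<psi> (Suc n) i x * (v (x(i := x i - 1)) - v x))
       = (\<Sum>i\<in>{1..Suc n}. if i = Suc n then lam (Suc n) + \<psi> (Suc n) (Suc n) x * (real (x (Suc n) - 1) - real (x (Suc n))) else 0)"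
      by (rule sum.cong) (auto simp: v_def)
    also have "\<dots> = lam (Suc n) + \<psi> (Suc n) (Suc n) x * (real (x (Suc n) - 1) - real (x (Suc n)))" by simp
    also have "\<dots> \<le> lam (Suc n) + d + (- ?f x + B * g x)"
    proof (cases "r < x (Suc n)")
      case True
      then have "real (x (Suc n) - 1) - real (x (Suc n)) = - 1" by (simp add: of_nat_diff)
      then show ?thesis using near[of x, OF True] True by (simp add: g_def)
    \<comment> \<open>For a short queue the departure term is merely nonpositive; the term
      \<open>B * g x\<close> offsets \<open>- ?f x\<close>, because \<open>?f\<close> is at most
      \<open>B\<close>.\<close>
    next
      case False
      have "\<psi> (Suc n) (Suc n) x * (real (x (Suc n) - 1) - real (x (Suc n))) \<le> 0"
        using \<psi>_nonneg[OF iN n] by (intro mult_nonneg_nonpos) auto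
      then show ?thesis using False \<psi>_le[OF iN n', of x] d by (simp add: g_def)
    qed
    finally have "Z.T v x \<le> v x + (lam (Suc n) + d + (- ?f x + B * g x)) / L"
      unfolding qstep_def using L_pos by (simp add: divide_right_mono)
    then show ?thesis by (simp add: add_divide_distrib diff_divide_distrib)
  qed
  \<comment> \<open>\<open>- ?f\<close> is increasing in the first \<open>n\<close> coordinates, on
    which \<open>Z\<close> lies below the chain \<open>Y\<close> started empty, which in turn lies
    below its stationary version.\<close>
  have f_ge: "expect p ?f \<le> (Z.T ^^ k) ?f Z.z0" for k
  proof -
    have anti: "?f y \<le> ?f x" if "\<And>j. j \<in> {1..n} \<Longrightarrow> x j \<le> y j" for x y
      by (rule \<psi>_anti) (use that n in auto)
    have "(Z.T ^^ k) (\<lambda>x. - ?f x) Z.z0 \<le> (Y.T ^^ k) (\<lambda>x. - ?f x) Y.z0"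
    proof (rule qstep_pow_compare[OF Z.queue_chain_axioms Y.queue_chain_axioms])
      show "Z.z0 j \<le> Y.z0 j" if "j \<in> {1..n}" for j using that by (auto simp: Z.z0_def Y.z0_def)
      show "\<psi> n i y \<le> \<psi> (Suc n) i x" if "i \<in> {1..n}" "\<And>j. j \<in> {1..n} \<Longrightarrow> x j \<le> y j" "x i = y i" for i x y
        by (rule \<psi>_anti) (use that n in auto)
    qed (use anti in auto)
    also have "\<dots> \<le> expect p (\<lambda>x. - ?f x)"
      by (rule Y.expect_law_le[where F=B]) (use anti p \<psi>_bounded[OF iN n'] in \<open>auto simp: increasing_on_def\<close>)
    finally show ?thesis by (simp add: Z.T_pow_minus)
  qed
  \<comment> \<open>If queue \<open>n + 1\<close> is short, then either the first \<open>n\<close>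
    queues lie outside a box, which is improbable uniformly in \<open>k\<close>, or the state lies
    in the finite set \<open>D\<close>, whose mass tends to 0 by \<open>\<rho>0\<close>.\<close>
  have g_small: "\<exists>k0. \<forall>k\<ge>k0. (Z.T ^^ k) g Z.z0 \<le> e" if e: "e > 0" for e
  proof -
    obtain m where m: "measure_pmf.prob p (- downbox {1..n} m) < e / 2"
      using prob_box_ge[of "{1..n}" "e / 2" p] e by auto
    define D where "D = states {1..Suc n} \<inter> downbox {1..Suc n} (max m r)"
    have finD: "finite D" unfolding D_def by (rule finite_states_box) simp
    have u: "(Z.T ^^ k) (indicator (- downbox {1..n} m)) Z.z0 < e / 2" for k
    proof -
      have "(Z.T ^^ k) (indicator (- downbox {1..n} m)) Z.z0 \<le> (Y.T ^^ k) (indicator (- downbox {1..n} m)) Y.z0"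
      proof (rule qstep_pow_compare[OF Z.queue_chain_axioms Y.queue_chain_axioms])
        show "Z.z0 j \<le> Y.z0 j" if "j \<in> {1..n}" for j using that by (auto simp: Z.z0_def Y.z0_def)
        show "\<psi> n i y \<le> \<psi> (Suc n) i x" if "i \<in> {1..n}" "\<And>j. j \<in> {1..n} \<Longrightarrow> x j \<le> y j" "x i = y i" for i x y
          by (rule \<psi>_anti) (use that n in auto)
      qed (use increasing_on_outside_box in \<open>auto simp: increasing_on_def\<close>)
      also have "\<dots> \<le> expect p (indicator (- downbox {1..n} m))"
        by (rule Y.expect_law_le[where F=1]) (use p increasing_on_outside_box in \<open>auto simp: indicator_def\<close>)
      finally show ?thesis using m by simp
    qed
    have "(\<lambda>k. \<Sum>x\<in>D. pmf (Z.law k) x) \<longlonglongrightarrow> (\<Sum>x\<in>D. 0)"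
      by (intro tendsto_sum) (use Z.pmf_law_tendsto in \<open>simp add: \<rho>0\<close>)
    from LIMSEQ_D[OF this, of "e / 2"] e obtain k0 where k0: "\<And>k. k \<ge> k0 \<Longrightarrow> \<bar>\<Sum>x\<in>D. pmf (Z.law k) x\<bar> < e / 2"
      by auto
    have "(Z.T ^^ k) g Z.z0 \<le> e" if k: "k \<ge> k0" for k
    proof -
      have "(Z.T ^^ k) g Z.z0 = expect (Z.law k) g"
        by (rule Z.expect_law[symmetric, where F=1]) (simp add: g_def)
      also have "\<dots> \<le> expect (Z.law k) (\<lambda>x. indicator (- downbox {1..n} m) x + indicator D x)"
      proof (rule expect_mono[where F=1 and G=2])
        fix x assume "x \<in> set_pmf (Z.law k)"
        then have x: "x \<in> states {1..Suc n}" using Z.set_law by blast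
        have "x \<in> D" if "x (Suc n) \<le> r" "x \<in> downbox {1..n} m"
          using that x by (auto simp: D_def downbox_def le_Suc_eq max.coboundedI1 max.coboundedI2)
        then show "g x \<le> indicator (- downbox {1..n} m) x + indicator D x"
          by (auto simp: g_def indicator_def)
      qed (auto simp: g_def indicator_def)
      also have "\<dots> = expect (Z.law k) (indicator (- downbox {1..n} m)) + expect (Z.law k) (indicator D)"
        by (rule Bochner_Integration.integral_add; rule integrable_pmf_bounded[where F=1]) (simp_all add: indicator_def)
      also have "expect (Z.law k) (indicator (- downbox {1..n} m)) = (Z.T ^^ k) (indicator (- downbox {1..n} m)) Z.z0"
        by (rule Z.expect_law[where F=1]) (simp add: indicator_def)
      also have "expect (Z.law k) (indicator D) = (\<Sum>x\<in>D. pmf (Z.law k) x)"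
        using finD by (simp add: measure_measure_pmf_finite)
      finally show ?thesis using u[of k] k0[OF k] by linarith
    qed
    then show ?thesis by blast
  qed
  \<comment> \<open>The function \<open>v\<close> is unbounded; iterating the operator, a finite sum
    at each state, needs no integrability.\<close>
  define a where "a k = (Z.T ^^ k) v Z.z0" for k
  \<comment> \<open>The value is chosen so that \<open>B\<close> times it is at most
    \<open>d\<close>, also when \<open>B = 0\<close>.\<close>
  have "d / (B + 1) > 0" using d B_nonneg by simp
  then obtain k0 where k0: "\<And>k. k \<ge> k0 \<Longrightarrow> (Z.T ^^ k) g Z.z0 \<le> d / (B + 1)" using g_small by blast
  have dec: "a (Suc k) \<le> a k - d / L" if k: "k \<ge> k0" for k
  proof -
    have "a (Suc k) = (Z.T ^^ k) (Z.T v) Z.z0" by (simp add: a_def funpow_swap1)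
    also have "\<dots> \<le> (Z.T ^^ k) (\<lambda>x. v x + ((lam (Suc n) + d) / L + ((- 1 / L) * ?f x + (B / L) * g x))) Z.z0"
      by (rule Z.T_pow_mono) (rule Tv)
    also have "\<dots> = a k + ((lam (Suc n) + d) / L + ((- 1 / L) * (Z.T ^^ k) ?f Z.z0 + (B / L) * (Z.T ^^ k) g Z.z0))"
      by (simp only: Z.T_pow_add Z.T_pow_cmult Z.T_pow_const a_def)
    also have "\<dots> = a k + ((lam (Suc n) + d) - (Z.T ^^ k) ?f Z.z0 + B * (Z.T ^^ k) g Z.z0) / L"
      by (simp add: add_divide_distrib diff_divide_distrib)
    also have "\<dots> \<le> a k + (- d) / L"
    proof -
      have "B * (Z.T ^^ k) g Z.z0 \<le> B * (d / (B + 1))" using k0[OF k] B_nonneg by (rule mult_left_mono)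
      also have "\<dots> \<le> d" using d B_nonneg by (simp add: field_simps)
      finally have "(lam (Suc n) + d) - (Z.T ^^ k) ?f Z.z0 + B * (Z.T ^^ k) g Z.z0 \<le> - d"
        using f_ge[of k] by (simp add: d_def field_simps)
      then show ?thesis using L_pos by (intro add_left_mono divide_right_mono) auto
    qed
    finally show ?thesis by simp
  qed
  have "a (k0 + j) \<le> a k0 - real j * (d / L)" for j
  proof (induction j)
    case (Suc j)
    then show ?case using dec[of "k0 + j"] by (simp add: algebra_simps add_divide_distrib)
  qed simp
  moreover have "a k \<ge> 0" for k
    using Z.T_pow_mono[of Z.z0 k "\<lambda>_. 0" v] by (simp add: a_def v_def)
  ultimately have "real j * (d / L) \<le> a k0" for j by (smt (verit))
  moreover obtain j where "a k0 < real j * (d / L)"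
    using reals_Archimedean3[of "d / L"] d L_pos by (auto simp: divide_pos_pos)
  ultimately show False using not_le by blast
qed

end

section \<open>Instability\<close>

text \<open>Both \<open>exp z \<le> 1 / (1 - z)\<close> and
  \<open>1 / (1 - z) \<le> 1 + z + 2 z^2\<close> hold for \<open>z \<le> 1 / 2\<close>.\<close>

lemma exp_le_quadratic:
  fixes z :: real
  assumes "z \<le> 1 / 2"
  shows "exp z \<le> 1 + z + 2 * z^2"
proof -
  have "(1 + z + 2 * z^2) * (1 - z) - 1 = z^2 * (1 - 2 * z)"
    by (simp add: algebra_simps power2_eq_square)
  moreover have "0 \<le> z^2 * (1 - 2 * z)" using assms by (intro mult_nonneg_nonneg) auto
  ultimately have 1: "1 \<le> (1 + z + 2 * z^2) * (1 - z)" by linarith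
  have "1 - z \<le> exp (- z)" using exp_ge_add_one_self[of "- z"] by simp
  then have "exp z * (1 - z) \<le> exp z * exp (- z)" by (intro mult_left_mono) auto
  also have "\<dots> = 1" by (simp add: exp_minus)
  also note 1
  finally show ?thesis using assms by (simp add: mult_le_cancel_right_pos)
qed

text \<open>Over a fixed short time \<open>h\<close> the mean of \<open>G\<close> gains at least
  \<open>L h c\<close> up to the error of \<open>trans_approx\<close>, and repeating this exceeds
  the bound \<open>m\<close>.\<close>

lemma growth_contradiction:
  fixes G :: "'s \<Rightarrow> real"
  assumes unif: "uniformized S q L K" and trans: "transition_function S q P"
    and \<mu>S: "\<And>t. t \<ge> 0 \<Longrightarrow> set_pmf (\<mu> t) \<subseteq> S"
    and \<mu>: "\<And>s t. s \<ge> 0 \<Longrightarrow> t \<ge> 0 \<Longrightarrow> \<mu> (t + s) = bind_pmf (\<mu> t) (P s)"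
    and G: "\<And>x. \<bar>G x\<bar> \<le> m" and m: "0 < m"
    and c: "0 < c" "0 \<le> t0"
    and gain: "\<And>t. t \<ge> t0 \<Longrightarrow> c \<le> expect (\<mu> t) (\<lambda>x. expect (K x) G - G x)"
  shows False
proof -
  have L: "L > 0" using unif by (simp add: uniformized_def)
  \<comment> \<open>Makes the error \<open>4 (L h)^2 m\<close> at most half of the gain
    \<open>L h c\<close>.\<close>
  define h where "h = min 1 (c / (8 * m)) / L"
  have h: "0 < h" "L * h \<le> 1" "8 * m * (L * h) \<le> c"
    using L m c by (auto simp: h_def field_simps min_def)
  let ?g = "\<lambda>x. expect (K x) G - G x"
  have EK: "\<bar>expect (K x) G\<bar> \<le> m" "\<bar>expect (P h x) G\<bar> \<le> m" for x
    by (rule abs_expect_le, rule G)+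
  have int: "integrable (measure_pmf p) G" "integrable (measure_pmf p) (\<lambda>x. expect (K x) G)"
     "integrable (measure_pmf p) (\<lambda>x. expect (P h x) G)" for p
    using G EK by (auto intro: integrable_pmf_bounded)
  have step: "expect (\<mu> t) G + L * h * c / 2 \<le> expect (\<mu> (t + h)) G" if t: "t \<ge> t0" for t
  proof -
    have t': "t \<ge> 0" using t c by simp
    have "expect (\<mu> t) (\<lambda>x. G x + L * h * ?g x - 4 * (L * h)^2 * m) \<le> expect (\<mu> t) (\<lambda>x. expect (P h x) G)"
    proof (rule integral_mono_AE)
      show "AE x in measure_pmf (\<mu> t). G x + L * h * ?g x - 4 * (L * h)^2 * m \<le> expect (P h x) G"
      proof (simp only: AE_measure_pmf_iff, rule ballI)
        fix x assume "x \<in> set_pmf (\<mu> t)"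
        then have "x \<in> S" using \<mu>S t' by blast
        from trans_approx[OF unif trans less_imp_le[OF h(1)] h(2) this, of G m, OF G]
        show "G x + L * h * ?g x - 4 * (L * h)^2 * m \<le> expect (P h x) G" by (simp add: abs_le_iff)
      qed
    qed (use int in auto)
    also have "\<dots> = expect (\<mu> (t + h)) G"
      using \<mu>[of h t] h t' by (simp add: expect_bind[OF G])
    also have "expect (\<mu> t) (\<lambda>x. G x + L * h * ?g x - 4 * (L * h)^2 * m)
        = expect (\<mu> t) G + L * h * expect (\<mu> t) ?g - 4 * (L * h)^2 * m"
      using int by simp
    finally have 1: "expect (\<mu> t) G + L * h * expect (\<mu> t) ?g - 4 * (L * h)^2 * m \<le> expect (\<mu> (t + h)) G" .
    have "L * h * c \<le> L * h * expect (\<mu> t) ?g"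
      using gain[OF t] L h by (intro mult_left_mono) auto
    moreover have "L * h * (8 * m * (L * h)) \<le> L * h * c"
      using h L by (intro mult_left_mono) auto
    ultimately show ?thesis using 1 by (simp add: power2_eq_square algebra_simps)
  qed
  have "expect (\<mu> t0) G + real k * (L * h * c / 2) \<le> expect (\<mu> (t0 + real k * h)) G" for k
  proof (induction k)
    case (Suc k)
    have "t0 + real k * h \<ge> t0" using h by simp
    from step[OF this] have "expect (\<mu> (t0 + real k * h)) G + L * h * c / 2 \<le> expect (\<mu> (t0 + real (Suc k) * h)) G"
      by (simp add: distrib_right add_ac)
    with Suc show ?case by (simp add: distrib_right add_divide_distrib)
  qed simp
  moreover have "\<bar>expect (\<mu> t) G\<bar> \<le> m" for t by (rule abs_expect_le) (rule G)
  ultimately have "real k * (L * h * c / 2) \<le> 2 * m" for k by (smt (verit))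
  moreover obtain k where "2 * m < real k * (L * h * c / 2)"
  proof -
    have "0 < L * h * c / 2" using L h c by simp
    from reals_Archimedean3[OF this] show ?thesis using that by blast
  qed
  ultimately show False using not_le by blast
qed

section \<open>From a Markov process to its one-dimensional laws\<close>

lemma pmf_of_random_variable:
  assumes M: "prob_space M" and Y: "Y \<in> M \<rightarrow>\<^sub>M count_space S" and S: "countable S"
  obtains p where "set_pmf p \<subseteq> S" "\<And>A. measure_pmf.prob p A = \<P>(\<omega> in M. Y \<omega> \<in> A)"
    "measure_pmf p = distr M (count_space UNIV) Y"
proof -
  interpret prob_space M by fact
  have Y': "Y \<in> M \<rightarrow>\<^sub>M count_space UNIV"
    by (rule measurable_compose[OF Y, of "\<lambda>x. x"]) simp
  let ?D = "distr M (count_space UNIV) Y"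
  interpret D: prob_space ?D using Y' by (rule prob_space_distr)
  have YS: "Y \<omega> \<in> S" if "\<omega> \<in> space M" for \<omega> using measurable_space[OF Y that] by simp
  have "AE x in ?D. x \<in> S" using Y' YS by (subst AE_distr_iff) auto
  \<comment> \<open>Countability of \<open>S\<close> makes almost every point an atom, as a
    \<open>pmf\<close> must have.\<close>
  then have "AE x in ?D. measure ?D {x} \<noteq> 0"
    using S by (subst D.AE_support_countable) auto
  then have inv: "measure_pmf (Abs_pmf ?D) = ?D"
    using D.prob_space_axioms by (intro Abs_pmf_inverse) auto
  have prob: "measure_pmf.prob (Abs_pmf ?D) A = \<P>(\<omega> in M. Y \<omega> \<in> A)" for A
    using Y' by (simp add: inv measure_distr vimage_def Int_def conj_commute)
  have "set_pmf (Abs_pmf ?D) \<subseteq> S"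
  proof
    fix y assume "y \<in> set_pmf (Abs_pmf ?D)"
    then have "measure_pmf.prob (Abs_pmf ?D) {y} \<noteq> 0" by (simp add: measure_pmf_single set_pmf_iff)
    then have "{\<omega> \<in> space M. Y \<omega> \<in> {y}} \<noteq> {}" unfolding prob by (metis measure_empty)
    then show "y \<in> S" using YS by blast
  qed
  then show ?thesis using prob inv by (rule that)
qed

text \<open>The Markov property given the state at one time determines the joint law
  \<open>J\<close> at the times \<open>t\<close> and \<open>t + s\<close>; its second marginal
  yields the evolution equation.\<close>

lemma markov_process_pmf:
  assumes X: "markov_process M S q X" and S: "countable S"
  obtains P \<mu> where "transition_function S q P" "\<And>t. t \<ge> 0 \<Longrightarrow> set_pmf (\<mu> t) \<subseteq> S"
    "\<And>t A. t \<ge> 0 \<Longrightarrow> measure_pmf.prob (\<mu> t) A = \<P>(\<omega> in M. X t \<omega> \<in> A)"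
    "\<And>s t. s \<ge> 0 \<Longrightarrow> t \<ge> 0 \<Longrightarrow> \<mu> (t + s) = bind_pmf (\<mu> t) (P s)"
proof -
  have M: "prob_space M" and meas: "\<And>t. t \<ge> 0 \<Longrightarrow> X t \<in> M \<rightarrow>\<^sub>M count_space S"
    using X unfolding markov_process_def by simp_all
  obtain P where P: "transition_function S q P"
    and markov: "\<forall>F \<xi> s t y. finite F \<and> F \<subseteq> {0..s} \<and> s \<in> F \<and> s \<le> t \<and>
           \<P>(\<omega> in M. \<forall>r\<in>F. X r \<omega> = \<xi> r) > 0 \<longrightarrow>
           \<P>(\<omega> in M. X t \<omega> = y \<bar> \<forall>r\<in>F. X r \<omega> = \<xi> r) = pmf (P (t - s) (\<xi> s)) y"
    using X unfolding markov_process_def by (elim conjE exE)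
  define \<mu> where "\<mu> t = Abs_pmf (distr M (count_space UNIV) (X t))" for t
  have \<mu>: "set_pmf (\<mu> t) \<subseteq> S" "measure_pmf.prob (\<mu> t) A = \<P>(\<omega> in M. X t \<omega> \<in> A)"
    if t: "t \<ge> 0" for t A
  proof -
    obtain p where p: "set_pmf p \<subseteq> S" "\<And>A. measure_pmf.prob p A = \<P>(\<omega> in M. X t \<omega> \<in> A)"
      "measure_pmf p = distr M (count_space UNIV) (X t)"
      by (rule pmf_of_random_variable[OF M meas[OF t] S]) blast
    have "\<mu> t = p" unfolding \<mu>_def p(3)[symmetric] by (rule measure_pmf_inverse)
    with p show "set_pmf (\<mu> t) \<subseteq> S" "measure_pmf.prob (\<mu> t) A = \<P>(\<omega> in M. X t \<omega> \<in> A)" by auto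
  qed
  have "\<mu> (t + s) = bind_pmf (\<mu> t) (P s)" if st: "s \<ge> 0" "t \<ge> 0" for s t
  proof -
    interpret prob_space M by fact
    have "(\<lambda>\<omega>. (X t \<omega>, X (t + s) \<omega>)) \<in> M \<rightarrow>\<^sub>M count_space S \<Otimes>\<^sub>M count_space S"
      using meas[of t] meas[of "t + s"] st by (intro measurable_Pair) auto
    then have pm: "(\<lambda>\<omega>. (X t \<omega>, X (t + s) \<omega>)) \<in> M \<rightarrow>\<^sub>M count_space (S \<times> S)"
      by (simp add: pair_measure_countable S)
    obtain J where "set_pmf J \<subseteq> S \<times> S"
      and J: "\<And>A. measure_pmf.prob J A = \<P>(\<omega> in M. (X t \<omega>, X (t + s) \<omega>) \<in> A)"
      and "measure_pmf J = distr M (count_space UNIV) (\<lambda>\<omega>. (X t \<omega>, X (t + s) \<omega>))"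
      by (rule pmf_of_random_variable[OF M pm countable_SIGMA[OF S S]]) blast
    have pmf_\<mu>: "pmf (\<mu> u) y = \<P>(\<omega> in M. X u \<omega> = y)" if "u \<ge> 0" for u y
      using \<mu>(2)[OF that, of "{y}"] by (simp add: measure_pmf_single)
    have pmf_J: "pmf J (a, y) = \<P>(\<omega> in M. X (t + s) \<omega> = y \<and> X t \<omega> = a)" for a y
      using J[of "{(a, y)}"] by (simp add: measure_pmf_single conj_commute)
    have joint: "pmf J (a, y) = pmf (\<mu> t) a * pmf (P s a) y" for a y
    proof (cases "pmf (\<mu> t) a = 0")
      case True
      have "X t \<in> M \<rightarrow>\<^sub>M count_space UNIV"
        by (rule measurable_compose[OF meas[OF st(2)], of "\<lambda>x. x"]) simp
      from measurable_sets[OF this, of "{a}"] have "{\<omega> \<in> space M. X t \<omega> = a} \<in> events"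
        by (simp add: vimage_def Int_def conj_commute)
      then have "\<P>(\<omega> in M. X (t + s) \<omega> = y \<and> X t \<omega> = a) \<le> \<P>(\<omega> in M. X t \<omega> = a)"
        by (intro finite_measure_mono) auto
      then show ?thesis using True pmf_\<mu>[OF st(2), of a] pmf_J[of a y] by (simp add: antisym)
    next
      case False
      then have pos: "\<P>(\<omega> in M. X t \<omega> = a) > 0"
        using pmf_\<mu>[OF st(2), of a] pmf_nonneg[of "\<mu> t" a] by linarith
      then have "\<P>(\<omega> in M. X (t + s) \<omega> = y \<bar> X t \<omega> = a) = pmf (P s a) y"
        using markov[rule_format, of "{t}" t "t + s" "\<lambda>_. a" y] st by simp
      then show ?thesis using pos pmf_\<mu>[OF st(2), of a] pmf_J[of a y]
        by (simp add: cond_prob_def field_simps)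
    qed
    have "J = bind_pmf (\<mu> t) (\<lambda>a. map_pmf (Pair a) (P s a))"
    proof (rule pmf_eqI)
      fix z :: "'b \<times> 'b"
      obtain a y where z: "z = (a, y)" by (cases z)
      have "pmf (map_pmf (Pair x) (P s x)) (a, y) = indicator {a} x * pmf (P s a) y" for x
      proof (cases "x = a")
        case True
        then show ?thesis using pmf_map_inj'[of "Pair a" "P s a" y] by (simp add: inj_on_def)
      next
        case False
        then have "(a, y) \<notin> set_pmf (map_pmf (Pair x) (P s x))" by auto
        then show ?thesis using False by (simp add: pmf_eq_0_set_pmf)
      qed
      then have "pmf (bind_pmf (\<mu> t) (\<lambda>a. map_pmf (Pair a) (P s a))) (a, y) = pmf (\<mu> t) a * pmf (P s a) y"
        by (simp add: pmf_bind measure_pmf_single)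
      then show "pmf J z = pmf (bind_pmf (\<mu> t) (\<lambda>a. map_pmf (Pair a) (P s a))) z"
        using joint z by simp
    qed
    then have "map_pmf snd J = bind_pmf (\<mu> t) (P s)"
      by (simp add: map_bind_pmf map_pmf_comp)
    moreover have "map_pmf snd J = \<mu> (t + s)"
    proof (rule pmf_eqI)
      fix y
      have "pmf (map_pmf snd J) y = measure_pmf.prob J (snd -` {y})" by (rule pmf_map)
      also have "\<dots> = pmf (\<mu> (t + s)) y" using st by (simp add: J pmf_\<mu>)
      finally show "pmf (map_pmf snd J) y = pmf (\<mu> (t + s)) y" .
    qed
    ultimately show ?thesis by simp
  qed
  with P \<mu> show ?thesis by (rule that)
qed

section \<open>Comparison of the long queues with the limit chain\<close>

context queue_network
begin

abbreviation "XT \<equiv> qstep {1..N} lam \<Phi> L"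
abbreviation "XK \<equiv> qker {1..N} lam \<Phi> L"
abbreviation "YT n \<equiv> qstep {1..n} lam (\<psi> n) L"
abbreviation "origin n \<equiv> attractive_chain.z0 {1..n}"

text \<open>No induction over the conditions is needed: as arrival rates are positive, the last
  condition makes the preceding limiting rate positive, which already provides the invariant law one
  level below.\<close>

lemma exists_limit_invariant:
  assumes "n < N" "\<And>i. i \<in> {1..n} \<Longrightarrow> lam i < limiting_service_rate N lam \<phi> (i - 1) i"
  shows "\<exists>p. limit_invariant n p"
proof (cases n)
  case 0
  then show ?thesis using limit_invariant_0 assms by auto
next
  case (Suc m)
  have i: "Suc m \<in> {1..N}" and m: "m < N" using Suc assms by auto
  have lt: "lam (Suc m) < limiting_service_rate N lam \<phi> m (Suc m)"
    using assms(2)[of "Suc m"] Suc by simp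
  then have "0 < limiting_service_rate N lam \<phi> m (Suc m)" using lam_pos[OF i] by simp
  then obtain p where p: "limit_invariant m p" by (rule limiting_service_rate_posD[OF m])
  then show ?thesis
    using limit_invariant_Suc[of m p] lt limiting_service_rate_eq[OF m i p] Suc assms by simp
qed

lemma uniform_closeness:
  assumes "n < N" "e > 0"
  obtains r where "\<And>x i. (\<And>j. j \<in> {n+1..N} \<Longrightarrow> r < x j) \<Longrightarrow> i \<in> {1..N} \<Longrightarrow> \<bar>\<Phi> i x - \<psi> n i x\<bar> \<le> e"
proof -
  have "\<exists>r. \<forall>x. x \<in> states {1..N} \<longrightarrow> (\<forall>j\<in>{n+1..N}. r < x j) \<longrightarrow> \<bar>\<phi> i x - \<psi> n i x\<bar> \<le> e"
    if i: "i \<in> {1..N}" for i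
  proof -
    obtain r where "\<And>x. x \<in> states {1..N} \<Longrightarrow> (\<And>j. j \<in> {n+1..N} \<Longrightarrow> r < x j) \<Longrightarrow>
        \<bar>\<phi> i x - lower_partial_limit N n (\<phi> i) x\<bar> \<le> e"
      using lower_partial_limit_uniform[OF unif[OF i] assms] by blast
    then show ?thesis unfolding \<psi>_def by blast
  qed
  then obtain r where r: "\<And>i x. i \<in> {1..N} \<Longrightarrow> x \<in> states {1..N} \<Longrightarrow> (\<forall>j\<in>{n+1..N}. r i < x j) \<Longrightarrow> \<bar>\<phi> i x - \<psi> n i x\<bar> \<le> e"
    by metis
  show ?thesis
  proof (rule that)
    fix x :: "nat \<Rightarrow> nat" and i
    assume x: "\<And>j. j \<in> {n+1..N} \<Longrightarrow> (\<Sum>i\<in>{1..N}. r i) < x j" and i: "i \<in> {1..N}"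
    have "r i \<le> (\<Sum>i\<in>{1..N}. r i)" using i by (intro member_le_sum) auto
    then have "\<forall>j\<in>{n+1..N}. r i < restrict x {1..N} j" using x by (fastforce dest: le_less_trans)
    then have "\<bar>\<phi> i (restrict x {1..N}) - \<psi> n i (restrict x {1..N})\<bar> \<le> e" using r[OF i] by simp
    moreover have "\<psi> n i (restrict x {1..N}) = \<psi> n i x" by (rule \<psi>_cong) (use assms in auto)
    ultimately show "\<bar>\<Phi> i x - \<psi> n i x\<bar> \<le> e" by (simp add: \<Phi>_def)
  qed
qed

text \<open>Jumps of the queues beyond \<open>n\<close> do not change \<open>H\<close>. For the
  others the rates differ by at most \<open>e\<close> and the values of \<open>H\<close> by at most
  \<open>B\<close>, so the error is at most \<open>n e B / L\<close>, hence at most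
  \<open>e\<close>.\<close>

lemma XT_YT_close:
  assumes n: "n < N" and e: "0 \<le> e"
    and close: "\<And>i. i \<in> {1..N} \<Longrightarrow> \<bar>\<Phi> i x - \<psi> n i x\<bar> \<le> e"
    and local: "\<And>x y. (\<And>j. j \<in> {1..n} \<Longrightarrow> x j = y j) \<Longrightarrow> H x = H y"
    and bound: "\<And>x. 0 \<le> H x" "\<And>x. H x \<le> B"
  shows "XT H x \<le> YT n H x + e"
proof -
  let ?s = "\<lambda>\<theta> i. lam i * (H (x(i := x i + 1)) - H x) + \<theta> i x * (H (x(i := x i - 1)) - H x)"
  have "(\<Sum>i\<in>{1..N}. ?s \<Phi> i) = (\<Sum>i\<in>{1..n}. ?s \<Phi> i)"
  proof (rule sum.mono_neutral_right)
    show "\<forall>i\<in>{1..N} - {1..n}. ?s \<Phi> i = 0"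
    proof
      fix i assume i: "i \<in> {1..N} - {1..n}"
      have "H (x(i := x i + 1)) = H x" "H (x(i := x i - 1)) = H x"
        by (rule local; use i in auto)+
      then show "?s \<Phi> i = 0" by simp
    qed
  qed (use n in auto)
  also have "\<dots> \<le> (\<Sum>i\<in>{1..n}. ?s (\<psi> n) i + e * B)"
  proof (rule sum_mono)
    fix i assume i: "i \<in> {1..n}"
    have "(\<Phi> i x - \<psi> n i x) * (H (x(i := x i - 1)) - H x) \<le> \<bar>\<Phi> i x - \<psi> n i x\<bar> * \<bar>H (x(i := x i - 1)) - H x\<bar>"
      by (simp add: abs_mult[symmetric])
    also have "\<dots> \<le> e * B"
      using close[of i] i n e bound[of x] bound[of "x(i := x i - 1)"] by (intro mult_mono) auto
    finally show "?s \<Phi> i \<le> ?s (\<psi> n) i + e * B" by (simp add: algebra_simps)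
  qed
  also have "\<dots> = (\<Sum>i\<in>{1..n}. ?s (\<psi> n) i) + real n * (e * B)" by (simp add: sum.distrib)
  also have "\<dots> \<le> (\<Sum>i\<in>{1..n}. ?s (\<psi> n) i) + e * L"
  proof -
    have "real n * B = (\<Sum>i\<in>{1..n}. B)" by simp
    also have "\<dots> \<le> (\<Sum>i\<in>{1..n}. lam i + B)"
      by (rule sum_mono) (use lam_pos n in \<open>auto intro: less_imp_le\<close>)
    also have "\<dots> \<le> L" using n by (intro L_ge) simp
    finally have "e * (real n * B) \<le> e * L" using e by (rule mult_left_mono)
    then show ?thesis by (simp add: mult_ac)
  qed
  finally have "(\<Sum>i\<in>{1..N}. ?s \<Phi> i) / L \<le> ((\<Sum>i\<in>{1..n}. ?s (\<psi> n) i) + e * L) / L"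
    using L_pos by (intro divide_right_mono) auto
  then show ?thesis using L_pos by (simp add: qstep_def add_divide_distrib)
qed

lemma YT_pow_local:
  assumes local: "\<And>x y. (\<And>j. j \<in> {1..n} \<Longrightarrow> x j = y j) \<Longrightarrow> h x = h y"
    and xy: "\<And>j. j \<in> {1..n} \<Longrightarrow> x j = y j"
  shows "(YT n ^^ k) h x = (YT n ^^ k) h y"
  using xy
proof (induction k arbitrary: x y)
  case 0
  then show ?case using local[of x y] by simp
next
  case (Suc k)
  have eq: "(YT n ^^ k) h (x(i := x i + 1)) = (YT n ^^ k) h (y(i := y i + 1))"
    "(YT n ^^ k) h (x(i := x i - 1)) = (YT n ^^ k) h (y(i := y i - 1))" if "i \<in> {1..n}" for i
    using Suc.prems that by (auto intro!: Suc.IH)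
  have eq': "(YT n ^^ k) h x = (YT n ^^ k) h y" using Suc.prems by (rule Suc.IH)
  have \<psi>: "\<psi> n i x = \<psi> n i y" for i using Suc.prems by (rule \<psi>_cong)
  have "YT n ((YT n ^^ k) h) x = YT n ((YT n ^^ k) h) y"
    unfolding qstep_def[where f="(YT n ^^ k) h"] eq' \<psi>
    by (intro arg_cong2[where f="(+)"] arg_cong2[where f="(/)"] sum.cong refl) (simp_all only: eq)
  then show ?case by simp
qed

text \<open>The margin \<open>k\<close> keeps the queues beyond \<open>n\<close> longer than
  \<open>r\<close> at each of the \<open>k\<close> comparisons, and each comparison costs
  \<open>e\<close>.\<close>

lemma XT_YT_pow_close:
  assumes n: "n < N" and e: "0 \<le> e"
    and close: "\<And>x i. (\<And>j. j \<in> {n+1..N} \<Longrightarrow> r < x j) \<Longrightarrow> i \<in> {1..N} \<Longrightarrow> \<bar>\<Phi> i x - \<psi> n i x\<bar> \<le> e"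
    and local: "\<And>x y. (\<And>j. j \<in> {1..n} \<Longrightarrow> x j = y j) \<Longrightarrow> h x = h y"
    and bound: "\<And>x. 0 \<le> h x" "\<And>x. h x \<le> B"
    and x: "\<And>j. j \<in> {n+1..N} \<Longrightarrow> r + k < x j"
  shows "(XT ^^ k) h x \<le> (YT n ^^ k) h x + real k * e"
  using x
proof (induction k arbitrary: x)
  case 0
  then show ?case by simp
next
  case (Suc k)
  interpret X: queue_chain "{1..N}" lam \<Phi> B L by (rule full_chain)
  interpret Y: attractive_chain "{1..n}" lam "\<psi> n" B L using n by (rule limit_chain)
  let ?H = "(YT n ^^ k) h"
  have "XT ((XT ^^ k) h) x \<le> XT (\<lambda>y. ?H y + real k * e) x"
  proof (rule X.T_mono)
    fix y assume y: "y \<in> nbh {1..N} x"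
    show "(XT ^^ k) h y \<le> ?H y + real k * e"
    proof (rule Suc.IH)
      fix j assume "j \<in> {n+1..N}"
      then show "r + k < y j" using Suc.prems[of j] nbh_le[OF y, of j] by linarith
    qed
  qed
  also have "\<dots> = XT ?H x + real k * e" by (simp add: X.T_add)
  also have "XT ?H x \<le> YT n ?H x + e"
  proof (rule XT_YT_close[OF n e])
    show "\<bar>\<Phi> i x - \<psi> n i x\<bar> \<le> e" if "i \<in> {1..N}" for i
      by (rule close) (use Suc.prems that in fastforce)+
    show "(YT n ^^ k) h x = (YT n ^^ k) h y" if "\<And>j. j \<in> {1..n} \<Longrightarrow> x j = y j" for x y
      by (rule YT_pow_local) (use local that in blast)+
    show "0 \<le> (YT n ^^ k) h x" for x using Y.T_pow_mono[of x k "\<lambda>_. 0" h] bound by simp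
    show "(YT n ^^ k) h x \<le> B" for x using Y.T_pow_mono[of x k h "\<lambda>_. B"] bound by simp
  qed
  finally show ?case by (simp add: algebra_simps)
qed

text \<open>Replacing \<open>\<Phi> i\<close> by its limit costs \<open>e\<close>, and replacing
  \<open>X\<close> by the limit chain costs \<open>k e\<close>. For \<open>i > n\<close> the limit
  rate decreases in all of the first \<open>n\<close> coordinates, so the empty start is the worst
  case.\<close>

lemma service_bound:
  assumes n: "n < N" and e: "0 \<le> e" and i: "i \<in> {n+1..N}"
    and close: "\<And>x i. (\<And>j. j \<in> {n+1..N} \<Longrightarrow> r < x j) \<Longrightarrow> i \<in> {1..N} \<Longrightarrow> \<bar>\<Phi> i x - \<psi> n i x\<bar> \<le> e"
    and x: "\<And>j. j \<in> {n+1..N} \<Longrightarrow> r + k < x j"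
  shows "(XT ^^ k) (\<Phi> i) x \<le> (YT n ^^ k) (\<psi> n i) (origin n) + (real k + 1) * e"
proof -
  interpret X: queue_chain "{1..N}" lam \<Phi> B L by (rule full_chain)
  interpret Y: attractive_chain "{1..n}" lam "\<psi> n" B L using n by (rule limit_chain)
  have iN: "i \<in> {1..N}" using i by auto
  have "(XT ^^ k) (\<Phi> i) x \<le> (XT ^^ k) (\<lambda>y. \<psi> n i y + e) x"
  proof (rule X.T_pow_mono)
    fix y assume y: "\<And>j. y j \<le> x j + k \<and> x j \<le> y j + k"
    have "\<bar>\<Phi> i y - \<psi> n i y\<bar> \<le> e"
    proof (rule close[OF _ iN])
      fix j assume "j \<in> {n+1..N}"
      then show "r < y j" using x[of j] y[of j] by linarith
    qed
    then show "\<Phi> i y \<le> \<psi> n i y + e" by (simp add: abs_le_iff)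
  qed
  also have "\<dots> = (XT ^^ k) (\<psi> n i) x + e" by (simp add: X.T_pow_add)
  also have "(XT ^^ k) (\<psi> n i) x \<le> (YT n ^^ k) (\<psi> n i) x + real k * e"
    by (rule XT_YT_pow_close[OF n e close _ _ _ x])
       (auto intro: \<psi>_cong \<psi>_nonneg[OF iN n] \<psi>_le[OF iN n])
  also have "(YT n ^^ k) (\<psi> n i) x \<le> (YT n ^^ k) (\<psi> n i) (origin n)"
  proof -
    have "increasing_on {1..n} (\<lambda>x. - \<psi> n i x)"
      unfolding increasing_on_def using i n iN by (auto intro!: \<psi>_anti)
    then have "(YT n ^^ k) (\<lambda>x. - \<psi> n i x) (origin n) \<le> (YT n ^^ k) (\<lambda>x. - \<psi> n i x) x"
      by (rule increasing_onD[OF Y.T_pow_increasing]) (rule Y.z0_le)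
    then show ?thesis by (simp add: Y.T_pow_minus)
  qed
  finally show ?thesis by (simp add: algebra_simps)
qed

text \<open>Accumulates \<open>service_bound\<close> over the steps; the errors
  \<open>(k + 1) e\<close> stay below \<open>d\<close> for all \<open>k < m\<close>. Counting a
  departure also at an empty queue only lowers the bound.\<close>

lemma queue_growth:
  assumes n: "n < N" and e: "0 \<le> e" and i: "i \<in> {n+1..N}"
    and close: "\<And>x i. (\<And>j. j \<in> {n+1..N} \<Longrightarrow> r < x j) \<Longrightarrow> i \<in> {1..N} \<Longrightarrow> \<bar>\<Phi> i x - \<psi> n i x\<bar> \<le> e"
    and x: "\<And>j. j \<in> {n+1..N} \<Longrightarrow> r + m < x j"
    and me: "real m * e \<le> d"
    and k: "k \<le> m"
  shows "real (x i) + (real k * (lam i - d) - (\<Sum>l<k. (YT n ^^ l) (\<psi> n i) (origin n))) / L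
    \<le> (XT ^^ k) (\<lambda>y. real (y i)) x"
  using k
proof (induction k)
  case 0
  then show ?case by simp
next
  case (Suc k)
  interpret X: queue_chain "{1..N}" lam \<Phi> B L by (rule full_chain)
  have iN: "i \<in> {1..N}" using i by auto
  let ?v = "\<lambda>y. real (y i)"
  have Tv: "?v y + (lam i / L + (- 1 / L) * \<Phi> i y) \<le> XT ?v y" for y
  proof -
    have "(\<Sum>j\<in>{1..N}. lam j * (?v (y(j := y j + 1)) - ?v y) + \<Phi> j y * (?v (y(j := y j - 1)) - ?v y))
       = (\<Sum>j\<in>{1..N}. if j = i then lam i + \<Phi> i y * (real (y i - 1) - real (y i)) else 0)"
      by (rule sum.cong) auto
    also have "\<dots> = lam i + \<Phi> i y * (real (y i - 1) - real (y i))" using iN by simp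
    also have "\<dots> \<ge> lam i + \<Phi> i y * (- 1)"
      using X.\<psi>_nonneg[OF iN] by (intro add_left_mono mult_left_mono) auto
    finally have "(lam i - \<Phi> i y) / L \<le> (\<Sum>j\<in>{1..N}. lam j * (?v (y(j := y j + 1)) - ?v y) + \<Phi> j y * (?v (y(j := y j - 1)) - ?v y)) / L"
      using L_pos by (intro divide_right_mono) auto
    then show ?thesis by (simp add: qstep_def diff_divide_distrib)
  qed
  have "(real k + 1) * e \<le> real m * e" using Suc e by (intro mult_right_mono) auto
  moreover have "(XT ^^ k) (\<Phi> i) x \<le> (YT n ^^ k) (\<psi> n i) (origin n) + (real k + 1) * e"
  proof (rule service_bound[OF n e i close])
    show "r + k < x j" if "j \<in> {n+1..N}" for j using x[OF that] Suc.prems by simp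
  qed
  ultimately have sb: "(XT ^^ k) (\<Phi> i) x \<le> (YT n ^^ k) (\<psi> n i) (origin n) + d"
    using me by linarith
  have "real (x i) + (real (Suc k) * (lam i - d) - (\<Sum>l<Suc k. (YT n ^^ l) (\<psi> n i) (origin n))) / L
     = (real (x i) + (real k * (lam i - d) - (\<Sum>l<k. (YT n ^^ l) (\<psi> n i) (origin n))) / L)
       + (lam i - ((YT n ^^ k) (\<psi> n i) (origin n) + d)) / L"
    using L_pos by (simp add: field_simps)
  also have "\<dots> \<le> (XT ^^ k) ?v x + (lam i - (XT ^^ k) (\<Phi> i) x) / L"
    using Suc sb L_pos by (intro add_mono divide_right_mono) auto
  also have "\<dots> = (XT ^^ k) (\<lambda>y. ?v y + (lam i / L + (- 1 / L) * \<Phi> i y)) x"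
    unfolding X.T_pow_add X.T_pow_cmult X.T_pow_const by (simp add: diff_divide_distrib)
  also have "\<dots> \<le> (XT ^^ k) (XT ?v) x" by (rule X.T_pow_mono) (rule Tv)
  finally show ?case by (simp add: funpow_swap1)
qed

end

text \<open>The finitely many early terms contribute at most a constant, absorbed by the slack
  between \<open>b\<close> and \<open>c\<close> when \<open>m\<close> is large.\<close>

lemma average_eventually_le:
  fixes a :: "nat \<Rightarrow> real"
  assumes "a \<longlonglongrightarrow> A" "A < c"
  shows "\<exists>m0. \<forall>m\<ge>m0. (\<Sum>l<m. a l) \<le> real m * c"
proof -
  define b where "b = (A + c) / 2"
  have b: "A < b" "b < c" using assms by (auto simp: b_def)
  obtain k0 where k0: "\<And>l. l \<ge> k0 \<Longrightarrow> a l < b"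
    using order_tendstoD(2)[OF assms(1) b(1)] by (auto simp: eventually_sequentially)
  define C where "C = (\<Sum>l<k0. \<bar>a l - b\<bar>)"
  have le: "(\<Sum>l<m. a l) \<le> real m * b + C" for m
  proof -
    have "(\<Sum>l<m. a l - b) \<le> (\<Sum>l<m. if l < k0 then \<bar>a l - b\<bar> else 0)"
    proof (rule sum_mono)
      fix l
      show "a l - b \<le> (if l < k0 then \<bar>a l - b\<bar> else 0)" using k0[of l] by auto
    qed
    also have "\<dots> = (\<Sum>l\<in>{..<m} \<inter> {..<k0}. \<bar>a l - b\<bar>)"
      by (simp add: sum.inter_restrict)
    also have "\<dots> \<le> C" unfolding C_def by (rule sum_mono2) auto
    finally show ?thesis by (simp add: sum_subtractf)
  qed
  obtain m0 :: nat where "C / (c - b) \<le> real m0" using real_arch_simple by blast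
  then have m0: "C \<le> real m0 * (c - b)" using b by (simp add: field_simps)
  have "(\<Sum>l<m. a l) \<le> real m * c" if "m \<ge> m0" for m
  proof -
    have "real m0 * (c - b) \<le> real m * (c - b)" using that b by (intro mult_right_mono) auto
    with le[of m] m0 show ?thesis by (simp add: algebra_simps)
  qed
  then show ?thesis by blast
qed

text \<open>Each of the required arrivals is given a time slot of length \<open>1 / (4 L)\<close>.\<close>

lemma transition_pmf_reach_ge:
  assumes Q: "queue_chain I lam \<theta> B L"
    and unif: "uniformized (states I) q L (qker I lam \<theta> L)"
    and trans: "transition_function (states I) q P"
    and lam: "0 < c" "\<And>i. i \<in> I \<Longrightarrow> c \<le> lam i"
    and xy: "x \<in> states I" "y \<in> states I" "\<And>i. i \<in> I \<Longrightarrow> x i \<le> y i"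
  shows "(c / (8 * L)) ^ (\<Sum>i\<in>I. y i - x i) \<le> pmf (P (real (\<Sum>i\<in>I. y i - x i) / (4 * L)) x) y"
proof -
  interpret Q: queue_chain I lam \<theta> B L by fact
  let ?D = "\<lambda>z. \<Sum>i\<in>I. z i - x i" and ?h = "1 / (4 * L)"
  define R where "R z \<longleftrightarrow> (\<forall>i\<in>I. x i \<le> z i) \<and> (c / (8 * L)) ^ ?D z \<le> pmf (P (real (?D z) / (4 * L)) x) z" for z
  have "R y"
  proof (rule up_induct[OF Q.fin xy])
    show "R x" using trans_0[OF unif trans xy(1)] by (simp add: R_def)
    fix z i assume z: "z \<in> states I" "R z" and i: "i \<in> I"
    let ?z = "z(i := z i + 1)"
    have zI: "?z \<in> states I" using nbh_states[OF z(1) nbhI(2)[OF i]] .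
    have "?D ?z = (\<Sum>j\<in>I. (z j - x j) + (if j = i then 1 else 0))"
      by (rule sum.cong) (use z i in \<open>auto simp: R_def Suc_diff_le\<close>)
    also have "\<dots> = Suc (?D z)" using i Q.fin by (simp add: sum.distrib)
    finally have D: "?D ?z = Suc (?D z)" .
    have ne: "?z \<noteq> z" by (metis fun_upd_same n_not_Suc_n Suc_eq_plus1)
    \<comment> \<open>In one slot \<open>L * ?h = 1 / 4\<close>, so \<open>trans_offdiag_ge\<close>
      leaves the factors \<open>1 / 4\<close> and \<open>1 / 2\<close> beside the jump probability,
      which is at least \<open>c / L\<close>.\<close>
    have "c / (8 * L) = (L * ?h) * (c / L) * (1 - 2 * (L * ?h))" using Q.L_pos by simp
    also have "\<dots> \<le> (L * ?h) * pmf (Q.K z) ?z * (1 - 2 * (L * ?h))"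
    proof -
      have "c / L \<le> lam i / L" using lam(2)[OF i] Q.L_pos by (intro divide_right_mono) auto
      also have "\<dots> \<le> pmf (Q.K z) ?z" by (rule Q.pmf_K_up[OF i])
      finally show ?thesis using Q.L_pos by (intro mult_right_mono mult_left_mono) auto
    qed
    also have "\<dots> \<le> pmf (P ?h z) ?z"
      using Q.L_pos by (intro trans_offdiag_ge[OF unif trans _ _ z(1) zI ne]) auto
    finally have 1: "c / (8 * L) \<le> pmf (P ?h z) ?z" .
    have "(c / (8 * L)) ^ ?D ?z = (c / (8 * L)) ^ ?D z * (c / (8 * L))" unfolding D by simp
    also have "\<dots> \<le> pmf (P (real (?D z) / (4 * L)) x) z * pmf (P ?h z) ?z"
      using z 1 lam(1) Q.L_pos unfolding R_def by (intro mult_mono) auto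
    also have "\<dots> \<le> pmf (bind_pmf (P (real (?D z) / (4 * L)) x) (P ?h)) ?z" by (rule pmf_bind_ge)
    also have "\<dots> = pmf (P (real (?D ?z) / (4 * L)) x) ?z"
    proof -
      have "real (?D ?z) / (4 * L) = real (?D z) / (4 * L) + ?h"
        unfolding D by (simp add: add_divide_distrib)
      then show ?thesis
        using trans_add[OF unif trans _ _ xy(1), of "real (?D z) / (4 * L)" ?h] Q.L_pos by (simp del: of_nat_sum)
    qed
    finally show "R ?z" using z i unfolding R_def by auto
  qed
  then show ?thesis unfolding R_def by blast
qed

section \<open>The bounded escape function and the contradiction with stability\<close>

context queue_network
begin

lemma uniformized_full: "uniformized (states {1..N}) (queue_rate {1..N} lam \<phi>) L XK"
proof -
  interpret X: queue_chain "{1..N}" lam \<Phi> B L by (rule full_chain)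
  have "queue_rate {1..N} lam \<phi> x = queue_rate {1..N} lam \<Phi> x" if "x \<in> states {1..N}" for x
  proof -
    have "restrict x {1..N} = x" using that by (simp add: PiE_restrict)
    then have eq: "\<Phi> i x = \<phi> i x" for i by (simp add: \<Phi>_def)
    show ?thesis unfolding queue_rate_def eq ..
  qed
  then show ?thesis using X.uniformized_queue by (simp add: uniformized_def)
qed

text \<open>Of the margin \<open>2 d\<close>, one half absorbs the approximation error in
  \<open>queue_growth\<close> and the other is the remaining drift; \<open>d \<le> L\<close> keeps
  the exponents in \<open>exponential_decay\<close> small.\<close>

lemma drift_parameters:
  assumes n: "n < N" and p: "limit_invariant n p"
    and drift: "\<And>i. i \<in> {n+1..N} \<Longrightarrow> expect p (\<psi> n i) < lam i"
  obtains d m where "0 < d" "d \<le> L" "0 < m"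
    "\<And>i. i \<in> {n+1..N} \<Longrightarrow> (\<Sum>l<m. (YT n ^^ l) (\<psi> n i) (origin n)) \<le> real m * (lam i - 2 * d)"
proof -
  interpret Y: attractive_chain "{1..n}" lam "\<psi> n" B L using n by (rule limit_chain)
  let ?g = "\<lambda>i. (lam i - expect p (\<psi> n i)) / 3"
  define d where "d = min L (Min (?g ` {n+1..N}))"
  have d_le: "d \<le> L" "\<And>i. i \<in> {n+1..N} \<Longrightarrow> d \<le> ?g i" by (auto simp only: d_def intro!: min.coboundedI2 Min_le)
  have "?g i > 0" if "i \<in> {n+1..N}" for i using drift[OF that] by simp
  then have d: "0 < d" using L_pos n by (auto simp: d_def)
  have "\<exists>m0. \<forall>m\<ge>m0. (\<Sum>l<m. (YT n ^^ l) (\<psi> n i) (origin n)) \<le> real m * (lam i - 2 * d)" if i: "i \<in> {n+1..N}" for i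
  proof (rule average_eventually_le)
    have "i \<in> {1..N}" using i by auto
    then show "(\<lambda>l. (YT n ^^ l) (\<psi> n i) (origin n)) \<longlonglongrightarrow> expect p (\<psi> n i)"
      using n by (intro Y.expect_law_tendsto[OF p]) (rule \<psi>_bounded)
    show "expect p (\<psi> n i) < lam i - 2 * d" using d_le(2)[OF i] d by simp
  qed
  then obtain m0 where m0: "\<And>i m. i \<in> {n+1..N} \<Longrightarrow> m \<ge> m0 i \<Longrightarrow>
      (\<Sum>l<m. (YT n ^^ l) (\<psi> n i) (origin n)) \<le> real m * (lam i - 2 * d)" by metis
  have "m0 i \<le> Suc (\<Sum>i\<in>{n+1..N}. m0 i)" if "i \<in> {n+1..N}" for i
    using member_le_sum[OF that, of m0] by simp
  \<comment> \<open>The sum exceeds every threshold, and \<open>Suc\<close> makes \<open>m\<close>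
    positive.\<close>
  then show ?thesis using d d_le(1) m0 by (intro that[of d "Suc (\<Sum>i\<in>{n+1..N}. m0 i)"]) blast+
qed

text \<open>A second-order expansion over \<open>m\<close> steps: the drift contributes a decrease
  \<open>d^2 / (4 L^2)\<close>, and \<open>\<alpha>\<close> is chosen so that the quadratic term
  \<open>2 (\<alpha> m)^2\<close> takes back exactly half of it.\<close>

lemma exponential_decay:
  assumes n: "n < N" and e: "0 \<le> e" and i: "i \<in> {n+1..N}"
    and close: "\<And>x i. (\<And>j. j \<in> {n+1..N} \<Longrightarrow> r < x j) \<Longrightarrow> i \<in> {1..N} \<Longrightarrow> \<bar>\<Phi> i x - \<psi> n i x\<bar> \<le> e"
    and x: "\<And>j. j \<in> {n+1..N} \<Longrightarrow> r + m < x j"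
    and me: "real m * e \<le> d" and m: "0 < m" and d: "0 < d" "d \<le> L"
    and avg: "(\<Sum>l<m. (YT n ^^ l) (\<psi> n i) (origin n)) \<le> real m * (lam i - 2 * d)"
    and \<alpha>: "\<alpha> = d / (4 * L * real m)"
  shows "(XT ^^ m) (\<lambda>y. exp (- (\<alpha> * real (y i)))) x \<le> (1 - d^2 / (8 * L^2)) * exp (- (\<alpha> * real (x i)))"
proof -
  interpret X: queue_chain "{1..N}" lam \<Phi> B L by (rule full_chain)
  have \<alpha>0: "0 \<le> \<alpha>" and \<alpha>m: "\<alpha> * real m = d / (4 * L)" using \<alpha> m d L_pos by auto
  have \<alpha>m': "\<alpha> * real m \<le> 1 / 2" unfolding \<alpha>m using d L_pos by (simp add: field_simps)
  let ?E = "exp (- (\<alpha> * real (x i)))"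
  have "(XT ^^ m) (\<lambda>y. exp (- (\<alpha> * real (y i)))) x
      \<le> (XT ^^ m) (\<lambda>y. ?E * ((1 + \<alpha> * real (x i) + 2 * (\<alpha> * real m)^2) + (- \<alpha>) * real (y i))) x"
  proof (rule X.T_pow_mono)
    fix y assume y: "\<And>j. y j \<le> x j + m \<and> x j \<le> y j + m"
    define z where "z = \<alpha> * (real (x i) - real (y i))"
    have "\<bar>real (x i) - real (y i)\<bar> \<le> real m" using y[of i] by linarith
    then have "\<bar>z\<bar> \<le> \<alpha> * real m" using \<alpha>0 by (simp add: z_def abs_mult mult_left_mono)
    then have z: "z \<le> 1 / 2" "z^2 \<le> (\<alpha> * real m)^2"
      using \<alpha>m' by (simp, intro abs_le_square_iff[THEN iffD1]) simp
    have "exp (- (\<alpha> * real (y i))) = ?E * exp z"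
      by (simp add: z_def exp_add[symmetric] algebra_simps)
    also have "\<dots> \<le> ?E * (1 + z + 2 * z^2)"
      using exp_le_quadratic[OF z(1)] by (intro mult_left_mono) auto
    also have "\<dots> \<le> ?E * (1 + z + 2 * (\<alpha> * real m)^2)"
      using z(2) by (intro mult_left_mono) auto
    finally show "exp (- (\<alpha> * real (y i))) \<le> ?E * ((1 + \<alpha> * real (x i) + 2 * (\<alpha> * real m)^2) + (- \<alpha>) * real (y i))"
      by (simp add: z_def algebra_simps)
  qed
  also have "\<dots> = ?E * ((1 + \<alpha> * real (x i) + 2 * (\<alpha> * real m)^2) + (- \<alpha>) * (XT ^^ m) (\<lambda>y. real (y i)) x)"
    by (simp only: X.T_pow_add X.T_pow_cmult X.T_pow_const)
  also have "\<dots> \<le> ?E * (1 - d^2 / (8 * L^2))"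
  proof (rule mult_left_mono)
    have "real (x i) + real m * d / L
        \<le> real (x i) + (real m * (lam i - d) - (\<Sum>l<m. (YT n ^^ l) (\<psi> n i) (origin n))) / L"
      using avg L_pos by (intro add_left_mono divide_right_mono) (auto simp: algebra_simps)
    also have "\<dots> \<le> (XT ^^ m) (\<lambda>y. real (y i)) x"
      by (rule queue_growth[OF n e i close x me order_refl])
    finally have "\<alpha> * (real (x i) + real m * d / L) \<le> \<alpha> * (XT ^^ m) (\<lambda>y. real (y i)) x"
      using \<alpha>0 by (rule mult_left_mono)
    moreover have "\<alpha> * (real m * d / L) = d^2 / (4 * L^2)"
      using \<alpha>m L_pos by (simp add: power2_eq_square field_simps)
    moreover have "2 * (\<alpha> * real m)^2 = d^2 / (8 * L^2)"
      unfolding \<alpha>m by (simp add: power2_eq_square)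
    ultimately show "(1 + \<alpha> * real (x i) + 2 * (\<alpha> * real m)^2) + (- \<alpha>) * (XT ^^ m) (\<lambda>y. real (y i)) x \<le> 1 - d^2 / (8 * L^2)"
      by (simp add: distrib_left)
  qed simp
  finally show ?thesis by (simp add: mult.commute)
qed

text \<open>The gain of \<open>G\<close> is proportional to \<open>F\<close>, which fades as the
  queues grow; hence the gain is bounded below only where some coordinate, here \<open>x N\<close>,
  is bounded.\<close>

lemma escape_function:
  assumes n: "n < N" and p: "limit_invariant n p"
    and drift: "\<And>i. i \<in> {n+1..N} \<Longrightarrow> expect p (\<psi> n i) < lam i"
  obtains G b H where "0 < b" "\<And>x. \<bar>G x\<bar> \<le> b" "\<And>x. G x \<le> XT G x"
    "\<And>C. \<exists>c>0. \<forall>x. (\<forall>j\<in>{n+1..N}. H \<le> x j) \<longrightarrow> x N \<le> C \<longrightarrow> c \<le> XT G x - G x"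
proof -
  interpret X: queue_chain "{1..N}" lam \<Phi> B L by (rule full_chain)
  obtain d m where d: "0 < d" "d \<le> L" and m: "0 < m"
    and avg: "\<And>i. i \<in> {n+1..N} \<Longrightarrow> (\<Sum>l<m. (YT n ^^ l) (\<psi> n i) (origin n)) \<le> real m * (lam i - 2 * d)"
    using drift_parameters[OF n p drift] by blast
  define e where "e = d / real m"
  have e: "0 < e" "real m * e \<le> d" using d m by (auto simp: e_def)
  obtain r where r: "\<And>x i. (\<And>j. j \<in> {n+1..N} \<Longrightarrow> r < x j) \<Longrightarrow> i \<in> {1..N} \<Longrightarrow> \<bar>\<Phi> i x - \<psi> n i x\<bar> \<le> e"
    using uniform_closeness[OF n e(1)] by blast
  define \<alpha> where "\<alpha> = d / (4 * L * real m)"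
  have \<alpha>0: "0 < \<alpha>" using d L_pos m by (simp add: \<alpha>_def)
  define \<eta> where "\<eta> = d^2 / (8 * L^2)"
  have \<eta>: "0 < \<eta>" using d L_pos by (simp add: \<eta>_def)
  \<comment> \<open>With this factor a single queue of length at most \<open>r + m\<close> already
    gives \<open>F x \<ge> 1\<close>; so \<open>F x < 1\<close> leaves the margin that
    \<open>exponential_decay\<close> needs.\<close>
  define s where "s = exp (\<alpha> * real (r + m))"
  define F where "F x = (\<Sum>i\<in>{n+1..N}. s * exp (- (\<alpha> * real (x i))))" for x :: "nat \<Rightarrow> nat"
  define W where "W x = max 0 (1 - F x)" for x
  have F0: "0 \<le> F x" for x by (auto simp: F_def s_def intro: sum_nonneg)
  have W01: "0 \<le> W x" "W x \<le> 1" for x using F0[of x] by (auto simp: W_def)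
  have large: "r + m < x j" if Fx: "F x < 1" and j: "j \<in> {n+1..N}" for x j
  proof (rule ccontr)
    assume "\<not> r + m < x j"
    then have "\<alpha> * real (x j) \<le> \<alpha> * real (r + m)" using \<alpha>0 by (intro mult_left_mono) auto
    then have "1 \<le> exp (\<alpha> * real (r + m) + - (\<alpha> * real (x j)))" by simp
    also have "\<dots> = s * exp (- (\<alpha> * real (x j)))" by (simp only: s_def exp_add)
    also have "\<dots> \<le> F x" unfolding F_def by (rule member_le_sum[OF j]) (auto simp: s_def)
    finally show False using Fx by simp
  qed
  have F_decay: "(XT ^^ m) F x \<le> (1 - \<eta>) * F x" if Fx: "F x < 1" for x
  proof -
    have "(XT ^^ m) F x = (\<Sum>i\<in>{n+1..N}. s * (XT ^^ m) (\<lambda>x. exp (- (\<alpha> * real (x i)))) x)"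
      unfolding F_def[abs_def] by (simp only: X.T_pow_sum[OF finite_atLeastAtMost] X.T_pow_cmult)
    also have "\<dots> \<le> (\<Sum>i\<in>{n+1..N}. s * ((1 - \<eta>) * exp (- (\<alpha> * real (x i)))))"
    proof (intro sum_mono mult_left_mono)
      fix i assume i: "i \<in> {n+1..N}"
      show "(XT ^^ m) (\<lambda>x. exp (- (\<alpha> * real (x i)))) x \<le> (1 - \<eta>) * exp (- (\<alpha> * real (x i)))"
        unfolding \<eta>_def
        by (rule exponential_decay[OF n less_imp_le[OF e(1)] i r large[OF Fx] e(2) m d avg[OF i] \<alpha>_def])
    qed (simp add: s_def)
    also have "\<dots> = (1 - \<eta>) * F x" unfolding F_def sum_distrib_left by (simp add: mult_ac)
    finally show ?thesis .
  qed
  have W_gain: "W x + \<eta> * F x \<le> (XT ^^ m) W x" if Fx: "F x < 1" for x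
  proof -
    have "1 - (XT ^^ m) F x = (XT ^^ m) (\<lambda>x. 1 - F x) x" by (simp add: X.T_pow_diff)
    also have "\<dots> \<le> (XT ^^ m) W x" by (rule X.T_pow_mono) (simp add: W_def)
    finally show ?thesis using F_decay[OF Fx] Fx by (simp add: W_def algebra_simps)
  qed
  have W_sub: "W x \<le> (XT ^^ m) W x" for x
  proof (cases "F x < 1")
    case True
    have "0 \<le> \<eta> * F x" using \<eta> F0[of x] by simp
    then show ?thesis using W_gain[OF True] by linarith
  next
    case False
    then have "W x = 0" by (simp add: W_def)
    then show ?thesis using X.T_pow_mono[of x m "\<lambda>_. 0" W] W01 by simp
  qed
  \<comment> \<open>Summing over \<open>m\<close> steps telescopes, turning the
    \<open>m\<close>-step gain of \<open>W\<close> into a one-step gain.\<close>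
  define G where "G x = (\<Sum>k<m. (XT ^^ k) W x)" for x
  have G_gain: "XT G x - G x = (XT ^^ m) W x - W x" for x
  proof -
    have "XT G x = (\<Sum>k<m. (XT ^^ Suc k) W x)" unfolding G_def[abs_def] by (simp add: X.T_sum)
    then show ?thesis
      using sum_lessThan_telescope[of "\<lambda>k. (XT ^^ k) W x" m] by (simp add: G_def sum_subtractf)
  qed
  have "\<bar>G x\<bar> \<le> real m" for x
  proof -
    have "\<bar>(XT ^^ k) W x\<bar> \<le> 1" for k
      by (rule X.T_pow_bounded) (simp add: W01)
    then have "\<bar>G x\<bar> \<le> (\<Sum>k<m. 1)" unfolding G_def by (intro order_trans[OF sum_abs] sum_mono)
    then show ?thesis by simp
  qed
  moreover have "G x \<le> XT G x" for x using G_gain[of x] W_sub[of x] by simp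
  moreover obtain H :: nat where H: "F x < 1" if "\<And>j. j \<in> {n+1..N} \<Longrightarrow> H \<le> x j" for x
  proof -
    \<comment> \<open>At this height each of the at most \<open>N\<close> summands of
      \<open>F\<close> is at most \<open>1 / (N + 1)\<close>.\<close>
    obtain H :: nat where H: "ln (s * (real N + 1)) / \<alpha> \<le> real H" using real_arch_simple by blast
    have "F x < 1" if xH: "\<And>j. j \<in> {n+1..N} \<Longrightarrow> H \<le> x j" for x
    proof -
      have "F x \<le> (\<Sum>i\<in>{n+1..N}. 1 / (real N + 1))"
        unfolding F_def
      proof (rule sum_mono)
        fix i assume "i \<in> {n+1..N}"
        then have "real H \<le> real (x i)" using xH by simp
        then have "ln (s * (real N + 1)) / \<alpha> \<le> real (x i)" using H by linarith
        then have "ln (s * (real N + 1)) \<le> \<alpha> * real (x i)" using \<alpha>0 by (simp add: field_simps)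
        then have "exp (ln (s * (real N + 1))) \<le> exp (\<alpha> * real (x i))" by simp
        then have "s * (real N + 1) \<le> exp (\<alpha> * real (x i))" by (simp add: s_def)
        then show "s * exp (- (\<alpha> * real (x i))) \<le> 1 / (real N + 1)"
          by (simp add: exp_minus field_simps)
      qed
      also have "\<dots> < 1" by (simp add: field_simps)
      finally show ?thesis .
    qed
    then show ?thesis by (rule that)
  qed
  moreover have "\<exists>c>0. \<forall>x. (\<forall>j\<in>{n+1..N}. H \<le> x j) \<longrightarrow> x N \<le> C \<longrightarrow> c \<le> XT G x - G x" for C
  proof (intro exI[of _ "\<eta> * (s * exp (- (\<alpha> * real C)))"] conjI allI impI)
    show "0 < \<eta> * (s * exp (- (\<alpha> * real C)))" using \<eta> by (simp add: s_def)
    fix x :: "nat \<Rightarrow> nat" assume x: "\<forall>j\<in>{n+1..N}. H \<le> x j" "x N \<le> C"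
    have "s * exp (- (\<alpha> * real C)) \<le> s * exp (- (\<alpha> * real (x N)))"
      using x \<alpha>0 by (simp add: s_def)
    also have "\<dots> \<le> F x"
      unfolding F_def by (rule member_le_sum) (use n in \<open>auto simp: s_def\<close>)
    finally have "\<eta> * (s * exp (- (\<alpha> * real C))) \<le> \<eta> * F x" using \<eta> by (intro mult_left_mono) auto
    also have "\<dots> \<le> XT G x - G x" using W_gain[OF H, of x] x unfolding G_gain by simp
    finally show "\<eta> * (s * exp (- (\<alpha> * real C))) \<le> XT G x - G x" .
  qed
  ultimately show ?thesis using that[of "real m" G H] m by simp
qed

text \<open>Stability would keep the long queues in a finite set \<open>A\<close> with probability
  at least one half. From there \<open>H\<close> extra arrivals at each of them lead, with
  probability at least \<open>\<kappa>\<close>, to a state where \<open>G\<close> gains, so the mean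
  gain never fades.\<close>

lemma unstable:
  assumes n: "n < N" and p: "limit_invariant n p"
    and drift: "\<And>i. i \<in> {n+1..N} \<Longrightarrow> expect p (\<psi> n i) < lam i"
    and X: "markov_process M (states {1..N}) (queue_rate {1..N} lam \<phi>) X"
  shows "\<not> stable_process M (states {n+1..N}) (\<lambda>t \<omega>. restrict (X t \<omega>) {n+1..N})"
proof
  assume "stable_process M (states {n+1..N}) (\<lambda>t \<omega>. restrict (X t \<omega>) {n+1..N})"
  then have "\<exists>A. finite A \<and> A \<subseteq> states {n+1..N} \<and>
      (\<forall>t\<ge>0. \<P>(\<omega> in M. restrict (X t \<omega>) {n+1..N} \<notin> A) \<le> 1 / 2)"
    unfolding stable_process_def by (elim allE[of _ "1 / 2"]) simp
  then obtain A where A: "finite A"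
      and A_prob: "\<And>t. t \<ge> 0 \<Longrightarrow> \<P>(\<omega> in M. restrict (X t \<omega>) {n+1..N} \<notin> A) \<le> 1 / 2"
    by blast
  interpret Q: queue_chain "{1..N}" lam \<Phi> B L by (rule full_chain)
  let ?S = "states {1..N}"
  have S: "countable ?S" by (rule countable_PiE) auto
  obtain P \<mu> where P: "transition_function ?S (queue_rate {1..N} lam \<phi>) P"
    and \<mu>S: "\<And>t. t \<ge> 0 \<Longrightarrow> set_pmf (\<mu> t) \<subseteq> ?S"
    and \<mu>: "\<And>t A. t \<ge> 0 \<Longrightarrow> measure_pmf.prob (\<mu> t) A = \<P>(\<omega> in M. X t \<omega> \<in> A)"
    and \<mu>_add: "\<And>s t. s \<ge> 0 \<Longrightarrow> t \<ge> 0 \<Longrightarrow> \<mu> (t + s) = bind_pmf (\<mu> t) (P s)"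
    by (rule markov_process_pmf[OF X S]) blast
  obtain G b H where b: "0 < b" and G: "\<And>x. \<bar>G x\<bar> \<le> b" and G_sub: "\<And>x. G x \<le> XT G x"
    and G_gain: "\<And>C. \<exists>c>0. \<forall>x. (\<forall>j\<in>{n+1..N}. H \<le> x j) \<longrightarrow> x N \<le> C \<longrightarrow> c \<le> XT G x - G x"
    by (rule escape_function[OF n p drift]) blast+
  define g where "g x = XT G x - G x" for x
  have g0: "0 \<le> g x" for x using G_sub[of x] by (simp add: g_def)
  have gb: "\<bar>g x\<bar> \<le> 2 * b" for x using Q.T_bounded[where f=G, OF G, of x] G[of x] by (simp add: g_def)
  \<comment> \<open>Bounds the last queue after the \<open>H\<close> extra arrivals, uniformly over
    starting points in \<open>A\<close>.\<close>
  define C where "C = (\<Sum>a\<in>A. a N) + H"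
  obtain c where c: "0 < c" "\<And>x. (\<forall>j\<in>{n+1..N}. H \<le> x j) \<Longrightarrow> x N \<le> C \<Longrightarrow> c \<le> g x"
    using G_gain[of C] unfolding g_def by blast
  define l where "l = Min (lam ` {1..N})"
  have l: "0 < l" "\<And>i. i \<in> {1..N} \<Longrightarrow> l \<le> lam i" using n lam_pos by (auto simp: l_def)
  \<comment> \<open>The number of extra arrivals is the same for every start, hence so are
    \<open>t0\<close> and \<open>\<kappa>\<close>.\<close>
  define J where "J = (N - n) * H"
  define t0 where "t0 = real J / (4 * L)"
  have t0: "0 \<le> t0" using L_pos by (simp add: t0_def)
  define \<kappa> where "\<kappa> = (l / (8 * L)) ^ J"
  have \<kappa>: "0 < \<kappa>" using l L_pos by (simp add: \<kappa>_def)
  have reach: "\<kappa> * c \<le> expect (P t0 x) g" if x: "x \<in> ?S" and xA: "restrict x {n+1..N} \<in> A" for x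
  proof -
    define y where "y = restrict (\<lambda>i. if n < i then x i + H else x i) {1..N}"
    have yS: "y \<in> ?S" by (simp add: y_def)
    have "(\<Sum>i\<in>{1..N}. y i - x i) = (\<Sum>i\<in>{1..N}. if n < i then H else 0)"
      by (rule sum.cong) (auto simp: y_def)
    also have "\<dots> = (\<Sum>i\<in>{n+1..N}. H)"
      by (rule sum.mono_neutral_cong_right) auto
    also have "\<dots> = J" by (simp add: J_def)
    finally have D: "(\<Sum>i\<in>{1..N}. y i - x i) = J" .
    have \<kappa>P: "\<kappa> \<le> pmf (P t0 x) y"
      using transition_pmf_reach_ge[OF full_chain uniformized_full P l x yS] unfolding D \<kappa>_def t0_def
      by (auto simp: y_def)
    have "restrict x {n+1..N} N \<le> (\<Sum>a\<in>A. a N)"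
      by (rule member_le_sum[OF xA]) (use A in auto)
    then have "y N \<le> C" using n by (simp add: y_def C_def)
    moreover have "\<forall>j\<in>{n+1..N}. H \<le> y j" by (simp add: y_def)
    ultimately have "c \<le> g y" using c(2) by blast
    then have "\<kappa> * c \<le> pmf (P t0 x) y * g y" using \<kappa> \<kappa>P c by (intro mult_mono) auto
    also have "\<dots> = expect (P t0 x) (\<lambda>z. indicator {y} z * g y)" by (simp add: measure_pmf_single)
    also have "\<dots> \<le> expect (P t0 x) g"
      by (rule expect_mono[where F="2 * b" and G="2 * b"]) (use gb g0 b in \<open>auto simp: indicator_def\<close>)
    finally show ?thesis .
  qed
  have gain: "\<kappa> * c / 2 \<le> expect (\<mu> t) (\<lambda>x. expect (XK x) G - G x)" if t: "t \<ge> t0" for t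
  proof -
    \<comment> \<open>Stability is applied at the earlier time, leaving \<open>t0\<close> for the
      arrivals.\<close>
    let ?t = "t - t0" and ?A = "{x. restrict x {n+1..N} \<in> A}"
    have t': "0 \<le> ?t" using t by simp
    have "1 - measure_pmf.prob (\<mu> ?t) ?A = measure_pmf.prob (\<mu> ?t) (- ?A)"
      using measure_pmf.prob_compl[of ?A "\<mu> ?t"] by (simp add: Compl_eq_Diff_UNIV)
    also have "\<dots> \<le> 1 / 2" using A_prob[OF t'] by (simp add: \<mu>[OF t'])
    finally have "1 / 2 \<le> measure_pmf.prob (\<mu> ?t) ?A" by simp
    then have "\<kappa> * c * (1 / 2) \<le> \<kappa> * c * measure_pmf.prob (\<mu> ?t) ?A"
      using \<kappa> c by (intro mult_left_mono) auto
    also have "\<dots> = expect (\<mu> ?t) (\<lambda>x. \<kappa> * c * indicator ?A x)" by simp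
    also have "\<dots> \<le> expect (\<mu> ?t) (\<lambda>x. expect (P t0 x) g)"
    proof (rule expect_mono[where F="\<kappa> * c" and G="2 * b"])
      show "\<bar>expect (P t0 x) g\<bar> \<le> 2 * b" for x by (rule abs_expect_le) (rule gb)
      show "\<bar>\<kappa> * c * indicator ?A x\<bar> \<le> \<kappa> * c" for x using \<kappa> c by (simp add: indicator_def)
      fix x assume "x \<in> set_pmf (\<mu> ?t)"
      then have "x \<in> ?S" using \<mu>S[OF t'] by blast
      moreover have "0 \<le> expect (P t0 x) g" by (rule Bochner_Integration.integral_nonneg) (rule g0)
      ultimately show "\<kappa> * c * indicator ?A x \<le> expect (P t0 x) g"
        using reach[of x] by (simp add: indicator_def)
    qed
    also have "\<dots> = expect (\<mu> t) g" using \<mu>_add[OF t0 t'] by (simp add: expect_bind[OF gb])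
    also have "\<dots> = expect (\<mu> t) (\<lambda>x. expect (XK x) G - G x)" by (simp add: g_def[abs_def] Q.expect_K)
    finally show ?thesis by simp
  qed
  show False
    by (rule growth_contradiction[OF uniformized_full P \<mu>S \<mu>_add G b _ t0 gain]) (use \<kappa> c in auto)
qed

end

theorem theorem3:
  fixes N n :: nat
    and lam :: "nat \<Rightarrow> real"
    and \<phi> :: "nat \<Rightarrow> (nat \<Rightarrow> nat) \<Rightarrow> real"
    and M :: "'w measure"
    and X :: "real \<Rightarrow> 'w \<Rightarrow> nat \<Rightarrow> nat"
  assumes "\<And>i. i \<in> {1..N} \<Longrightarrow> lam i > 0"
    and "bounded_allocation N \<phi>"
    and "partially_decreasing N \<phi>"
    and "\<And>i. i \<in> {1..N} \<Longrightarrow> uniform_limits_at_infinity N (\<phi> i)"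
    and "queue_length_process M N lam \<phi> X"
    and "n < N"
    and "\<And>i. i \<in> {1..n} \<Longrightarrow> lam i < limiting_service_rate N lam \<phi> (i - 1) i"
    and "\<And>i. i \<in> {n+1..N} \<Longrightarrow> lam i > limiting_service_rate N lam \<phi> n i"
  shows "\<not> stable_process M (states {n+1..N}) (\<lambda>t \<omega>. restrict (X t \<omega>) {n+1..N})"
proof -
  obtain B where B: "\<And>i x. i \<in> {1..N} \<Longrightarrow> x \<in> states {1..N} \<Longrightarrow> 0 \<le> \<phi> i x \<and> \<phi> i x \<le> B"
    using assms(2) unfolding bounded_allocation_def by blast
  \<comment> \<open>The maximum supplies the nonnegativity of the bound that the locale asks
    for.\<close>
  interpret queue_network N lam \<phi> "max B 0"
  proof
    fix i x assume "i \<in> {1..N}" "x \<in> states {1..N}"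
    then show "0 \<le> \<phi> i x" "\<phi> i x \<le> max B 0" using B by (simp_all add: le_max_iff_disj)
  qed (use assms in simp_all)
  obtain p where p: "limit_invariant n p"
    using exists_limit_invariant assms(6,7) by blast
  show ?thesis
  proof (rule unstable[OF assms(6) p])
    fix i assume i: "i \<in> {n+1..N}"
    then have "i \<in> {1..N}" by auto
    from limiting_service_rate_eq[OF assms(6) this p] assms(8)[OF i]
    show "expect p (\<psi> n i) < lam i" by simp
  qed (use assms(5) in \<open>simp add: queue_length_process_def\<close>)
qed

end
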